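(* Let $g(t) = \left(\frac{\pi}{2}\right)^{1/2}\operatorname{sech}(\pi t)$, $t \in \mathbb{R}$, and let $n \in \mathbb{N}$ with $n \ge 2$. For $a,b>0$ with $(ab)^{-1} = n$ let $\Lambda_{a,b} = a\mathbb{Z}\times b\mathbb{Z}$, and let $A(a,b)$ and $B(a,b)$ denote the sharp lower and upper frame bound, respectively, of the Gabor system $\mathcal{G}(g,\Lambda_{a,b})$. Then for all $a,b>0$ with $(ab)^{-1}=n$, $$A\left(\tfrac{1}{\sqrt n},\tfrac{1}{\sqrt n}\right) \ge A(a,b) \quad\text{and}\quad B\left(\tfrac{1}{\sqrt n},\tfrac{1}{\sqrt n}\right) \le B(a,b),$$ and in each inequality equality holds if and only if $a=b=\tfrac{1}{\sqrt n}$.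
   Context: For $g\in L^2(\mathbb{R})$ and $\lambda=(x,\omega)\in\mathbb{R}^2$ put $\pi(\lambda)g(t) = g(t-x)e^{2\pi i\omega t}$. For a lattice $\Lambda\subset\mathbb{R}^2$ the Gabor system is $\mathcal{G}(g,\Lambda)=\{\pi(\lambda)g \mid \lambda\in\Lambda\}$. The sharp lower and upper frame bounds are the largest constant $A\geq 0$ and the smallest constant $B$ such that $A\|f\|_2^2 \le \sum_{\lambda\in\Lambda}|\langle f,\pi(\lambda)g\rangle|^2 \le B\|f\|_2^2$ for all $f\in L^2(\mathbb{R})$. The density of $a\mathbb{Z}\times b\mathbb{Z}$ is $(ab)^{-1}$. *)

theory Defs
  imports "HOL-Analysis.Analysis"
begin

text \<open>
  Elements of \<open>L\<^sup>2(\<real>)\<close> are represented by Borel functions; every Lebesgue class contains one, and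
  all notions below are invariant under almost everywhere equality.
\<close>

definition L2 :: "(real \<Rightarrow> complex) set" where
  "L2 = {f \<in> borel_measurable lborel. integrable lborel (\<lambda>t. (norm (f t))\<^sup>2)}"

definition L2_inner :: "(real \<Rightarrow> complex) \<Rightarrow> (real \<Rightarrow> complex) \<Rightarrow> complex" where
  "L2_inner f h = (LINT t|lborel. f t * cnj (h t))"

definition L2_norm :: "(real \<Rightarrow> complex) \<Rightarrow> real" where
  "L2_norm f = sqrt (LINT t|lborel. (norm (f t))\<^sup>2)"

definition time_freq_shift :: "real \<times> real \<Rightarrow> (real \<Rightarrow> complex) \<Rightarrow> real \<Rightarrow> complex" where
  "time_freq_shift = (\<lambda>(x, \<omega>) g t. g (t - x) * exp (2 * of_real pi * \<i> * of_real \<omega> * of_real t))"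

definition rect_lattice :: "real \<Rightarrow> real \<Rightarrow> (real \<times> real) set" where
  "rect_lattice a b = {(a * of_int k, b * of_int l) | k l :: int. True}"

text \<open>
  The sum is taken in \<^typ>\<open>ennreal\<close>, where every sum converges; as a real sum,
  a divergent one would silently be \<open>0\<close>.
\<close>

definition frame_sum :: "(real \<Rightarrow> complex) \<Rightarrow> (real \<times> real) set \<Rightarrow> (real \<Rightarrow> complex) \<Rightarrow> ennreal" where
  "frame_sum g \<Lambda> f =
     (\<Sum>\<^sub>\<infinity>z\<in>\<Lambda>. ennreal ((norm (L2_inner f (time_freq_shift z g)))\<^sup>2))"

definition is_lower_frame_bound ::
    "(real \<Rightarrow> complex) \<Rightarrow> (real \<times> real) set \<Rightarrow> ennreal \<Rightarrow> bool" where
  "is_lower_frame_bound g \<Lambda> A \<longleftrightarrow> (\<forall>f\<in>L2. A * ennreal ((L2_norm f)\<^sup>2) \<le> frame_sum g \<Lambda> f)"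

definition is_upper_frame_bound ::
    "(real \<Rightarrow> complex) \<Rightarrow> (real \<times> real) set \<Rightarrow> ennreal \<Rightarrow> bool" where
  "is_upper_frame_bound g \<Lambda> B \<longleftrightarrow> (\<forall>f\<in>L2. frame_sum g \<Lambda> f \<le> B * ennreal ((L2_norm f)\<^sup>2))"

text \<open>
  The sharp upper bound is \<open>\<infinity>\<close> iff no finite constant works. Supremum and infimum are attained,
  as shown by the two lemmas that follow.
\<close>

definition sharp_lower_frame_bound :: "(real \<Rightarrow> complex) \<Rightarrow> (real \<times> real) set \<Rightarrow> ennreal" where
  "sharp_lower_frame_bound g \<Lambda> = Sup {A. is_lower_frame_bound g \<Lambda> A}"

definition sharp_upper_frame_bound :: "(real \<Rightarrow> complex) \<Rightarrow> (real \<times> real) set \<Rightarrow> ennreal" where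
  "sharp_upper_frame_bound g \<Lambda> = Inf {B. is_upper_frame_bound g \<Lambda> B}"

lemma sharp_lower_frame_bound_attained:
  "is_lower_frame_bound g \<Lambda> (sharp_lower_frame_bound g \<Lambda>)"
  unfolding is_lower_frame_bound_def
proof
  fix f assume f: "f \<in> L2"
  have "sharp_lower_frame_bound g \<Lambda> * ennreal ((L2_norm f)\<^sup>2)
      = (SUP A\<in>{A. is_lower_frame_bound g \<Lambda> A}. A * ennreal ((L2_norm f)\<^sup>2))"
    unfolding sharp_lower_frame_bound_def
    using SUP_mult_right_ennreal[of "\<lambda>A. A"] by simp
  also have "\<dots> \<le> frame_sum g \<Lambda> f"
    using f by (intro SUP_least) (auto simp: is_lower_frame_bound_def)
  finally show "sharp_lower_frame_bound g \<Lambda> * ennreal ((L2_norm f)\<^sup>2) \<le> frame_sum g \<Lambda> f" .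
qed

lemma frame_sum_eq_0_if_L2_norm_eq_0:
  assumes f: "f \<in> L2" and 0: "L2_norm f = 0"
  shows "frame_sum g \<Lambda> f = 0"
proof -
  have int: "integrable lborel (\<lambda>t. (norm (f t))\<^sup>2)" and meas: "f \<in> borel_measurable lborel"
    using f by (auto simp: L2_def)
  have "(LINT t|lborel. (norm (f t))\<^sup>2) = 0"
    using 0 by (simp add: L2_norm_def)
  then have ae: "AE t in lborel. f t = 0"
    using integral_nonneg_eq_0_iff_AE[OF int] by simp
  have "L2_inner f h = 0" for h
    unfolding L2_inner_def by (rule integral_eq_zero_AE) (use ae in auto)
  then show ?thesis by (simp add: frame_sum_def)
qed

lemma sharp_upper_frame_bound_attained:
  "is_upper_frame_bound g \<Lambda> (sharp_upper_frame_bound g \<Lambda>)"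
  unfolding is_upper_frame_bound_def
proof
  fix f assume f: "f \<in> L2"
  let ?N = "ennreal ((L2_norm f)\<^sup>2)"
  show "frame_sum g \<Lambda> f \<le> sharp_upper_frame_bound g \<Lambda> * ?N"
  proof (cases "L2_norm f = 0")
    case True
    then show ?thesis using frame_sum_eq_0_if_L2_norm_eq_0[OF f] by simp
  next
    case False
    then have N: "?N \<noteq> 0" "?N \<noteq> top" by auto
    have "frame_sum g \<Lambda> f / ?N \<le> sharp_upper_frame_bound g \<Lambda>"
      unfolding sharp_upper_frame_bound_def
    proof (rule Inf_greatest)
      fix B assume "B \<in> {B. is_upper_frame_bound g \<Lambda> B}"
      then have "frame_sum g \<Lambda> f \<le> B * ?N" using f by (auto simp: is_upper_frame_bound_def)
      then show "frame_sum g \<Lambda> f / ?N \<le> B"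
        using N by (simp add: divide_le_posI_ennreal mult.commute zero_less_iff_neq_zero)
    qed
    then have "frame_sum g \<Lambda> f / ?N * ?N \<le> sharp_upper_frame_bound g \<Lambda> * ?N"
      by (rule mult_right_mono) simp
    moreover have "frame_sum g \<Lambda> f / ?N * ?N = frame_sum g \<Lambda> f"
      using N by (metis ennreal_divide_times mult_divide_eq_ennreal ennreal_times_divide)
    ultimately show ?thesis by simp
  qed
qed

definition sech_window :: "real \<Rightarrow> complex" where
  "sech_window t = of_real (sqrt (pi / 2) * (1 / cosh (pi * t)))"

end

theory Submission
  imports Defs "HOL-Complex_Analysis.Complex_Analysis"
begin

text \<open>
  Let \<open>p = 1/b = n a\<close>. By Parseval's identity in the modulation parameter, the frame sum of \<open>f\<close> becomes an integral
  over \<open>s\<close> in \<open>[0,1)\<close> of quadratic forms in the sequences \<open>v\<^sub>j = f(p(s+j))\<close>, whose matrix entries are sums over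
  the translations \<open>a\<int>\<close> of products of two translates of the window (\<open>frame_sum_fibre\<close>). For the hyperbolic secant these
  sums are explicit: \<open>1/(cosh A cosh B) = (tanh A - tanh B)/sinh(A - B)\<close> telescopes when \<open>A - B\<close> is a multiple of the step
  (\<open>sech_product_has_sum\<close>). Hence all entries off the diagonal depend on \<open>i - j\<close> alone and not on \<open>s\<close>, and the forms are diagonalised
  by Fourier series. With
  \<open>\<sigma>\<^sub>x(\<theta>) = \<Sum>\<^sub>k (kx / sinh(kx)) cos(2\<pi>k\<theta>)\<close>, \<open>x = \<pi>na\<close> and \<open>y = \<pi>nb\<close>, the spectrum is the range of
  \<open>n (\<sigma>\<^sub>y(\<theta>) + \<sigma>\<^sub>x(\<xi>) - 1)\<close>. Here \<open>\<sigma>\<^sub>y\<close> is the diagonal entry, a periodized \<open>1/cosh\<^sup>2\<close>, rewritten by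
  Poisson summation (\<open>poisson_sech_squared\<close>); the Fourier transform of \<open>1/cosh\<^sup>2\<close> comes from a residue.

  The symbol is largest at \<open>(0,0)\<close>, so \<open>B(a,b) = n (\<sigma>\<^sub>x(0) + \<sigma>\<^sub>y(0) - 1)\<close>. Test functions concentrated at
  \<open>(1/2,1/2)\<close> give \<open>A(a,b) \<le> n (\<sigma>\<^sub>x(1/2) + \<sigma>\<^sub>y(1/2) - 1)\<close> for every lattice, and this is an equality for the square
  lattice, where \<open>x = y\<close> is large and the first term of the series dominates (\<open>sech_symbol_ge_half\<close>).

  The product \<open>xy = \<pi>\<^sup>2n = c\<^sup>2\<close> is fixed, and the square lattice has \<open>x = y = c\<close>. It remains to show, for \<open>x \<noteq> y\<close>,
  that \<open>\<sigma>\<^sub>x(0) + \<sigma>\<^sub>y(0) > 2 \<sigma>\<^sub>c(0)\<close> (\<open>sech_symbol_0_strict\<close>) and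
  \<open>\<sigma>\<^sub>x(1/2) + \<sigma>\<^sub>y(1/2) < 2 \<sigma>\<^sub>c(1/2)\<close> (\<open>sech_symbol_half_strict\<close>). Both rest on strict convexity of the terms as functions of
  \<open>ln x\<close> for \<open>x \<ge> 33/10\<close>; for smaller \<open>x\<close> the contribution of \<open>x\<close> alone is large enough, because \<open>n \<ge> 2\<close> gives
  \<open>c \<ge> 44/10\<close>. At \<open>1/2\<close> the series alternates and is first rearranged into a series of positive terms
  (\<open>lambert_identity\<close>), which together with Poisson summation yields the duality
  \<open>\<sigma>\<^sub>x(1/2) + \<sigma>\<^bsub>\<pi>\<^sup>2/x\<^esub>(1/2) = 1\<close> that controls small \<open>x\<close>.
\<close>

section \<open>Parseval's identity on the circle\<close>

text \<open>
  Lebesgue measure on \<open>[0,1)\<close>, kept as a measure on all of \<open>real\<close> so that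
  Borel functions of a real variable need no restriction to the interval.
\<close>

definition torus :: "real measure" where
  "torus = density lborel (indicator {0..<1})"

lemma sets_torus [measurable_cong, simp]: "sets torus = sets borel"
  by (simp add: torus_def)

lemma space_torus [simp]: "space torus = UNIV"
  by (simp add: torus_def)

lemma emeasure_torus_UNIV [simp]: "emeasure torus UNIV = 1"
  by (simp add: torus_def emeasure_density)

lemma finite_measure_torus: "finite_measure torus"
  by (rule finite_measureI) simp

interpretation torus: finite_measure torus
  by (rule finite_measure_torus)

lemma AE_torus: "AE t in torus. t \<in> {0..<1}"
  unfolding torus_def by (subst AE_density) (auto split: split_indicator)

lemma integral_torus:
  fixes f :: "real \<Rightarrow> 'a::{banach, second_countable_topology}"
  assumes "f \<in> borel_measurable borel"
  shows "(LINT t|torus. f t) = (LINT t|lborel. indicator {0..<1} t *\<^sub>R f t)"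
proof -
  have "torus = density lborel (\<lambda>t. ennreal (indicator {0..<1} t))"
    unfolding torus_def by (intro arg_cong[where f="density lborel"]) (auto simp: fun_eq_iff split: split_indicator)
  then show ?thesis using assms integral_density[of f lborel "indicator {0..<1}"] by simp
qed

lemma integrable_torus_iff:
  fixes f :: "real \<Rightarrow> 'a::{banach, second_countable_topology}"
  assumes "f \<in> borel_measurable borel"
  shows "integrable torus f \<longleftrightarrow> integrable lborel (\<lambda>t. indicator {0..<1} t *\<^sub>R f t)"
proof -
  have "torus = density lborel (\<lambda>t. ennreal (indicator {0..<1} t))"
    unfolding torus_def by (intro arg_cong[where f="density lborel"]) (auto simp: fun_eq_iff split: split_indicator)
  then show ?thesis using assms integrable_density[of f lborel "indicator {0..<1}"] by simp
qed

definition fourier_mode :: "int \<Rightarrow> real \<Rightarrow> complex" where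
  "fourier_mode l t = cis (2 * pi * l * t)"

lemma fourier_mode_0 [simp]: "fourier_mode 0 t = 1"
  by (simp add: fourier_mode_def)

lemma norm_fourier_mode [simp]: "norm (fourier_mode l t) = 1"
  by (simp add: fourier_mode_def)

lemma fourier_mode_mult: "fourier_mode k t * fourier_mode l t = fourier_mode (k + l) t"
  by (simp add: fourier_mode_def cis_mult algebra_simps)

lemma cnj_fourier_mode: "cnj (fourier_mode l t) = fourier_mode (- l) t"
  by (simp add: fourier_mode_def cis_cnj)

lemma continuous_fourier_mode [continuous_intros]: "continuous_on A (fourier_mode l)"
  unfolding fourier_mode_def cis_conv_exp by (intro continuous_intros)

lemma measurable_fourier_mode [measurable]: "fourier_mode l \<in> borel_measurable borel"
  by (intro borel_measurable_continuous_onI continuous_intros)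

lemma fourier_mode_periodic: "fourier_mode l (t + of_int j) = fourier_mode l t"
proof -
  have "2 * pi * l * (t + of_int j) = 2 * pi * l * t + 2 * pi * of_int (l * j)"
    by (simp add: algebra_simps)
  then show ?thesis unfolding fourier_mode_def
    by (metis cis_multiple_2pi cis_mult Ints_of_int mult.right_neutral)
qed

lemma integrable_torus_bounded:
  fixes f :: "real \<Rightarrow> 'a::{banach, second_countable_topology}"
  assumes "f \<in> borel_measurable borel" "\<And>t. norm (f t) \<le> B"
  shows "integrable torus f"
  by (rule torus.integrable_const_bound[of _ B]) (use assms in auto)

lemma integral_fourier_mode: "(LINT t|torus. fourier_mode l t) = (if l = 0 then 1 else 0)"
proof (cases "l = 0")
  case True
  have "measure torus UNIV = 1" by (simp add: measure_def)
  then show ?thesis using True by simp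
next
  case False
  define F where "F = (\<lambda>t. fourier_mode l t / (2 * pi * l * \<i>))"
  have eq: "(LINT t|torus. fourier_mode l t) = (LBINT t:{0..1}. fourier_mode l t)"
  proof -
    have "(LINT t|torus. fourier_mode l t) = (LINT t|lborel. indicator {0..<1} t *\<^sub>R fourier_mode l t)"
      by (rule integral_torus) simp
    also have "\<dots> = (LBINT t:{0..1}. fourier_mode l t)"
      unfolding set_lebesgue_integral_def
      by (intro integral_cong_AE) (auto intro!: AE_I[where N="{1}"] split: split_indicator)
    finally show ?thesis .
  qed
  have "(LBINT t:{0..1}. fourier_mode l t) = F 1 - F 0"
    unfolding set_lebesgue_integral_def
  proof (rule integral_FTC_atLeastAtMost)
    fix x :: real
    show "(F has_vector_derivative fourier_mode l x) (at x within {0..1})"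
      unfolding F_def fourier_mode_def cis_conv_exp using False
      by (auto intro!: derivative_eq_intros has_vector_derivative_real_field simp: field_simps scaleR_conv_of_real)
  qed (auto intro: continuous_intros)
  also have "F 1 = F 0"
    using fourier_mode_periodic[of l 0 1] by (simp add: F_def)
  finally show ?thesis using False eq by simp
qed

lemma measurable_cnj [measurable (raw)]:
  "f \<in> borel_measurable M \<Longrightarrow> (\<lambda>x. cnj (f x)) \<in> borel_measurable M"
  by (rule borel_measurable_continuous_on[where f = cnj]) (auto intro: continuous_intros)

text \<open>
  Closure under sums and multiples of modes is all that the definition has to provide; closure under
  products, which the Stone-Weierstrass theorem uses, follows by a double induction.
\<close>

inductive trig_poly :: "(real \<Rightarrow> complex) \<Rightarrow> bool" where
  mode: "trig_poly (\<lambda>t. c * fourier_mode l t)"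
| add: "trig_poly S \<Longrightarrow> trig_poly T \<Longrightarrow> trig_poly (\<lambda>t. S t + T t)"

lemma trig_poly_const: "trig_poly (\<lambda>t. c)"
  using trig_poly.mode[of c 0] by simp

lemma trig_poly_mult:
  assumes "trig_poly S" "trig_poly T"
  shows "trig_poly (\<lambda>t. S t * T t)"
  using assms
proof (induction arbitrary: T)
  case (mode c l)
  from mode show ?case
  proof (induction)
    case (mode d k)
    have "(\<lambda>t. c * fourier_mode l t * (d * fourier_mode k t)) = (\<lambda>t. (c * d) * fourier_mode (l + k) t)"
      by (simp add: fourier_mode_mult[symmetric] mult_ac)
    then show ?case by (simp add: trig_poly.mode)
  next
    case (add S T)
    then show ?case using trig_poly.add[OF add.IH] by (simp add: algebra_simps)
  qed
next
  case (add S S')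
  then show ?case using trig_poly.add[OF add.IH(1)[OF add.prems] add.IH(2)[OF add.prems]]
    by (simp add: algebra_simps)
qed

lemma trig_poly_cmult: "trig_poly T \<Longrightarrow> trig_poly (\<lambda>t. c * T t)"
  by (rule trig_poly_mult[OF trig_poly_const])

lemma measurable_trig_poly [measurable_dest]: "trig_poly T \<Longrightarrow> T \<in> borel_measurable borel"
  by (induction rule: trig_poly.induct) auto

text \<open>
  On the unit circle both coordinates are combinations of the modes \<open>1\<close> and \<open>-1\<close>,
  so every real polynomial in them is a trigonometric polynomial.
\<close>

lemma trig_poly_real_polynomial:
  fixes p :: "complex \<Rightarrow> real"
  assumes "real_polynomial_function p"
  shows "trig_poly (\<lambda>t. of_real (p (fourier_mode 1 t)))"
  using assms
proof induction
  case (linear f)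
  have f: "f z = Re z * f 1 + Im z * f \<i>" for z
  proof -
    have "f z = f (Re z *\<^sub>R 1 + Im z *\<^sub>R \<i>)"
      by (rule arg_cong[of _ _ f]) (simp add: complex_eq_iff)
    then show ?thesis using linear
      by (simp add: bounded_linear.linear linear_add linear_scale)
  qed
  have "(\<lambda>t. complex_of_real (f (fourier_mode 1 t))) =
      (\<lambda>t. (f 1 / 2 + f \<i> / (2 * \<i>)) * fourier_mode 1 t + (f 1 / 2 - f \<i> / (2 * \<i>)) * fourier_mode (-1) t)"
    by (subst f) (auto simp: fun_eq_iff fourier_mode_def complex_eq_iff field_simps)
  then show ?case by (simp only:) (intro trig_poly.intros)
next
  case (const c)
  show ?case by (rule trig_poly_const)
next
  case (add f g)
  then show ?case using trig_poly.add by fastforce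
next
  case (mult f g)
  then show ?case using trig_poly_mult by fastforce
qed

text \<open>
  Distances are measured by \<open>ennreal\<close>-valued integrals, so that no integrability condition
  has to be carried through the density argument.
\<close>

definition trig_approximable :: "(real \<Rightarrow> complex) \<Rightarrow> bool" where
  "trig_approximable F \<longleftrightarrow> F \<in> borel_measurable borel \<and>
     (\<forall>\<epsilon>>0. \<exists>T. trig_poly T \<and> (\<integral>\<^sup>+t. ennreal ((norm (F t - T t))\<^sup>2) \<partial>torus) < ennreal \<epsilon>)"

lemma norm_add_square_le: "(norm (a + b))\<^sup>2 \<le> 2 * (norm a)\<^sup>2 + 2 * (norm b)\<^sup>2"
proof -
  have "(norm (a + b))\<^sup>2 \<le> (norm a + norm b)\<^sup>2"
    by (intro power_mono norm_triangle_ineq) auto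
  also have "\<dots> \<le> 2 * (norm a)\<^sup>2 + 2 * (norm b)\<^sup>2"
    using zero_le_power2[of "norm a - norm b"] by (simp add: power2_eq_square algebra_simps)
  finally show ?thesis .
qed

lemma nn_integral_norm_add_square_le:
  fixes F G :: "'a \<Rightarrow> 'b::{real_normed_vector, second_countable_topology}"
  assumes [measurable]: "F \<in> borel_measurable M" "G \<in> borel_measurable M"
  shows "(\<integral>\<^sup>+t. ennreal ((norm (F t + G t))\<^sup>2) \<partial>M)
    \<le> 2 * (\<integral>\<^sup>+t. ennreal ((norm (F t))\<^sup>2) \<partial>M) + 2 * (\<integral>\<^sup>+t. ennreal ((norm (G t))\<^sup>2) \<partial>M)"
proof -
  have "(\<integral>\<^sup>+t. ennreal ((norm (F t + G t))\<^sup>2) \<partial>M)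
    \<le> (\<integral>\<^sup>+t. 2 * ennreal ((norm (F t))\<^sup>2) + 2 * ennreal ((norm (G t))\<^sup>2) \<partial>M)"
  proof (rule nn_integral_mono)
    fix t
    have "ennreal ((norm (F t + G t))\<^sup>2) \<le> ennreal (2 * (norm (F t))\<^sup>2 + 2 * (norm (G t))\<^sup>2)"
      by (rule ennreal_leI[OF norm_add_square_le])
    then show "ennreal ((norm (F t + G t))\<^sup>2) \<le> 2 * ennreal ((norm (F t))\<^sup>2) + 2 * ennreal ((norm (G t))\<^sup>2)"
      by (simp add: ennreal_plus ennreal_mult)
  qed
  also have "\<dots> = 2 * (\<integral>\<^sup>+t. ennreal ((norm (F t))\<^sup>2) \<partial>M) + 2 * (\<integral>\<^sup>+t. ennreal ((norm (G t))\<^sup>2) \<partial>M)"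
    by (subst nn_integral_add) (auto simp: nn_integral_cmult)
  finally show ?thesis .
qed

lemma ennreal_twice_sum_less:
  fixes X Y :: ennreal
  assumes "X < ennreal (\<epsilon> / 4)" "Y < ennreal (\<epsilon> / 4)" 
  shows "2 * X + 2 * Y < ennreal \<epsilon>"
proof -
  have e: "\<epsilon> > 0" using assms(1) by (metis ennreal_neg divide_nonpos_pos not_less_zero linorder_not_le zero_less_numeral)
  obtain x y where xy: "X = ennreal x" "Y = ennreal y" "x \<ge> 0" "y \<ge> 0" 
    using assms by (metis ennreal_cases less_top_ennreal order_less_trans ennreal_less_top)
  have "x < \<epsilon> / 4" "y < \<epsilon> / 4" using assms xy by (auto simp: ennreal_less_iff)
  moreover have "2 * X + 2 * Y = ennreal (2 * x + 2 * y)" using xy by (simp add: ennreal_plus ennreal_mult)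
  ultimately show ?thesis using xy(3,4) e by (simp only: ennreal_less_iff)
qed

lemma trig_approximableI_limit:
  assumes F [measurable]: "F \<in> borel_measurable borel"
    and "\<And>\<epsilon>. \<epsilon> > 0 \<Longrightarrow> \<exists>G. trig_approximable G \<and> (\<integral>\<^sup>+t. ennreal ((norm (F t - G t))\<^sup>2) \<partial>torus) < ennreal \<epsilon>"
  shows "trig_approximable F"
  unfolding trig_approximable_def
proof (intro conjI F allI impI)
  fix \<epsilon> :: real assume "\<epsilon> > 0"
  then have e: "\<epsilon> / 4 > 0" by simp
  obtain G where G: "trig_approximable G" "(\<integral>\<^sup>+t. ennreal ((norm (F t - G t))\<^sup>2) \<partial>torus) < ennreal (\<epsilon> / 4)"
    using assms(2)[OF e] by blast
  obtain T where T: "trig_poly T" "(\<integral>\<^sup>+t. ennreal ((norm (G t - T t))\<^sup>2) \<partial>torus) < ennreal (\<epsilon> / 4)"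
    using G(1) e unfolding trig_approximable_def by blast
  note [measurable] = measurable_trig_poly[OF T(1)]
  have [measurable]: "G \<in> borel_measurable borel" using G(1) by (simp add: trig_approximable_def)
  have "(\<integral>\<^sup>+t. ennreal ((norm (F t - T t))\<^sup>2) \<partial>torus) = (\<integral>\<^sup>+t. ennreal ((norm ((F t - G t) + (G t - T t)))\<^sup>2) \<partial>torus)"
    by simp
  also have "\<dots> \<le> 2 * (\<integral>\<^sup>+t. ennreal ((norm (F t - G t))\<^sup>2) \<partial>torus) + 2 * (\<integral>\<^sup>+t. ennreal ((norm (G t - T t))\<^sup>2) \<partial>torus)"
    by (rule nn_integral_norm_add_square_le) auto
  also have "\<dots> < ennreal \<epsilon>"
    by (rule ennreal_twice_sum_less[OF G(2) T(2)])
  finally show "\<exists>T. trig_poly T \<and> (\<integral>\<^sup>+t. ennreal ((norm (F t - T t))\<^sup>2) \<partial>torus) < ennreal \<epsilon>"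
    using T(1) by blast
qed

lemma trig_approximable_trig_poly:
  assumes "trig_poly T" shows "trig_approximable T"
  unfolding trig_approximable_def using measurable_trig_poly[OF assms] assms
  by (auto intro!: exI[of _ T] simp: ennreal_zero_less_one)

lemma trig_approximable_add:
  assumes "trig_approximable F" "trig_approximable G"
  shows "trig_approximable (\<lambda>t. F t + G t)"
  unfolding trig_approximable_def
proof (intro conjI allI impI)
  have [measurable]: "F \<in> borel_measurable borel" "G \<in> borel_measurable borel"
    using assms by (auto simp: trig_approximable_def)
  show "(\<lambda>t. F t + G t) \<in> borel_measurable borel" by simp
  fix \<epsilon> :: real assume "\<epsilon> > 0"
  then have e: "\<epsilon> / 4 > 0" by simp
  obtain S T where S: "trig_poly S" "(\<integral>\<^sup>+t. ennreal ((norm (F t - S t))\<^sup>2) \<partial>torus) < ennreal (\<epsilon> / 4)"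
    and T: "trig_poly T" "(\<integral>\<^sup>+t. ennreal ((norm (G t - T t))\<^sup>2) \<partial>torus) < ennreal (\<epsilon> / 4)"
    using assms e unfolding trig_approximable_def by meson
  note [measurable] = measurable_trig_poly[OF T(1)] measurable_trig_poly[OF S(1)]
  have "(\<integral>\<^sup>+t. ennreal ((norm (F t + G t - (S t + T t)))\<^sup>2) \<partial>torus)
      = (\<integral>\<^sup>+t. ennreal ((norm ((F t - S t) + (G t - T t)))\<^sup>2) \<partial>torus)"
    by (simp add: algebra_simps)
  also have "\<dots> \<le> 2 * (\<integral>\<^sup>+t. ennreal ((norm (F t - S t))\<^sup>2) \<partial>torus) + 2 * (\<integral>\<^sup>+t. ennreal ((norm (G t - T t))\<^sup>2) \<partial>torus)"
    by (rule nn_integral_norm_add_square_le) auto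
  also have "\<dots> < ennreal \<epsilon>"
    by (rule ennreal_twice_sum_less[OF S(2) T(2)])
  finally show "\<exists>T. trig_poly T \<and> (\<integral>\<^sup>+t. ennreal ((norm (F t + G t - T t))\<^sup>2) \<partial>torus) < ennreal \<epsilon>"
    using trig_poly.add[OF S(1) T(1)] by blast
qed

lemma trig_approximable_cmult:
  assumes "trig_approximable F"
  shows "trig_approximable (\<lambda>t. c * F t)"
proof (cases "c = 0")
  case True
  then show ?thesis by (simp add: trig_approximable_trig_poly trig_poly_const)
next
  case False
  show ?thesis unfolding trig_approximable_def
  proof (intro conjI allI impI)
    have [measurable]: "F \<in> borel_measurable borel"
      using assms by (auto simp: trig_approximable_def)
    show "(\<lambda>t. c * F t) \<in> borel_measurable borel" by simp
    fix \<epsilon> :: real assume "\<epsilon> > 0"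
    then have e: "\<epsilon> / (norm c)\<^sup>2 > 0" using False by simp
    obtain T where T: "trig_poly T" "(\<integral>\<^sup>+t. ennreal ((norm (F t - T t))\<^sup>2) \<partial>torus) < ennreal (\<epsilon> / (norm c)\<^sup>2)"
      using assms e unfolding trig_approximable_def by meson
    note [measurable] = measurable_trig_poly[OF T(1)]
    have "(\<integral>\<^sup>+t. ennreal ((norm (c * F t - c * T t))\<^sup>2) \<partial>torus)
        = (\<integral>\<^sup>+t. ennreal ((norm c)\<^sup>2) * ennreal ((norm (F t - T t))\<^sup>2) \<partial>torus)"
      by (simp add: norm_mult power_mult_distrib ennreal_mult flip: right_diff_distrib)
    also have "\<dots> = ennreal ((norm c)\<^sup>2) * (\<integral>\<^sup>+t. ennreal ((norm (F t - T t))\<^sup>2) \<partial>torus)"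
      by (rule nn_integral_cmult) simp
    also have "\<dots> < ennreal ((norm c)\<^sup>2) * ennreal (\<epsilon> / (norm c)\<^sup>2)"
      using T(2) False by (intro ennreal_mult_strict_left_mono) auto
    also have "\<dots> = ennreal \<epsilon>" using False \<open>\<epsilon> > 0\<close> by (subst ennreal_mult[symmetric]) auto
    finally show "\<exists>T. trig_poly T \<and> (\<integral>\<^sup>+t. ennreal ((norm (c * F t - T t))\<^sup>2) \<partial>torus) < ennreal \<epsilon>"
      using trig_poly_cmult[OF T(1)] by blast
  qed
qed

text \<open>
  The bridge from one class of functions to the next: a dominated pointwise limit converges in the
  square mean, and approximability survives square-mean limits.
\<close>

lemma trig_approximable_dominated:
  fixes G :: "nat \<Rightarrow> real \<Rightarrow> complex" and w :: "real \<Rightarrow> real"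
  assumes G: "\<And>n. trig_approximable (G n)"
    and F [measurable]: "F \<in> borel_measurable borel"
    and w [measurable]: "w \<in> borel_measurable borel"
    and wfin: "(\<integral>\<^sup>+t. ennreal ((w t)\<^sup>2) \<partial>torus) < \<infinity>"
    and lim: "\<And>t. t \<in> {0..<1} \<Longrightarrow> (\<lambda>n. G n t) \<longlonglongrightarrow> F t"
    and bound: "\<And>n t. norm (G n t) \<le> w t"
  shows "trig_approximable F"
proof (rule trig_approximableI_limit[OF F])
  fix \<epsilon> :: real assume e: "\<epsilon> > 0"
  have [measurable]: "G n \<in> borel_measurable borel" for n
    using G by (auto simp: trig_approximable_def)
  have "(\<lambda>n. \<integral>\<^sup>+t. ennreal ((norm (F t - G n t))\<^sup>2) \<partial>torus) \<longlonglongrightarrow> (\<integral>\<^sup>+t. 0 \<partial>torus)"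
  proof (rule nn_integral_dominated_convergence[where w = "\<lambda>t. 4 * ennreal ((w t)\<^sup>2)"])
    show "(\<integral>\<^sup>+t. 4 * ennreal ((w t)\<^sup>2) \<partial>torus) < \<infinity>"
      using wfin by (subst nn_integral_cmult) (auto simp: ennreal_mult_less_top)
    show "AE t in torus. (\<lambda>n. ennreal ((norm (F t - G n t))\<^sup>2)) \<longlonglongrightarrow> 0"
      using AE_torus
    proof eventually_elim
      case (elim t)
      have "(\<lambda>n. (norm (F t - G n t))\<^sup>2) \<longlonglongrightarrow> (norm (F t - F t))\<^sup>2"
        by (intro tendsto_intros lim elim)
      then show ?case using tendsto_ennrealI by fastforce
    qed
    show "AE t in torus. ennreal ((norm (F t - G n t))\<^sup>2) \<le> 4 * ennreal ((w t)\<^sup>2)" for n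
      using AE_torus
    proof eventually_elim
      case (elim t)
      have "norm (F t) \<le> w t"
        by (rule LIMSEQ_le_const2[OF tendsto_norm[OF lim[OF elim]]]) (use bound in auto)
      then have "norm (F t - G n t) \<le> 2 * w t"
        using bound[of n t] norm_triangle_ineq4[of "F t" "G n t"] by linarith
      then have "(norm (F t - G n t))\<^sup>2 \<le> (2 * w t)\<^sup>2" by (intro power_mono) auto
      then have "ennreal ((norm (F t - G n t))\<^sup>2) \<le> ennreal (4 * (w t)\<^sup>2)"
        by (intro ennreal_leI) (simp add: power_mult_distrib)
      then show ?case by (simp add: ennreal_mult)
    qed
  qed auto
  then have "eventually (\<lambda>n. (\<integral>\<^sup>+t. ennreal ((norm (F t - G n t))\<^sup>2) \<partial>torus) < ennreal \<epsilon>) sequentially"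
    using e by (intro order_tendstoD(2)) auto
  then obtain n where "(\<integral>\<^sup>+t. ennreal ((norm (F t - G n t))\<^sup>2) \<partial>torus) < ennreal \<epsilon>"
    using eventually_happens'[OF sequentially_bot] by blast
  then show "\<exists>G. trig_approximable G \<and> (\<integral>\<^sup>+t. ennreal ((norm (F t - G t))\<^sup>2) \<partial>torus) < ennreal \<epsilon>"
    using G by blast
qed

lemma trig_approximable_cong:
  assumes "trig_approximable F" "G \<in> borel_measurable borel" "\<And>t. t \<in> {0..<1} \<Longrightarrow> F t = G t"
  shows "trig_approximable G"
proof (rule trig_approximableI_limit[OF assms(2)], intro exI conjI)
  fix \<epsilon> :: real assume e: "\<epsilon> > 0"
  have [measurable]: "F \<in> borel_measurable borel" "G \<in> borel_measurable borel"
    using assms by (auto simp: trig_approximable_def)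
  have "(\<integral>\<^sup>+t. ennreal ((norm (G t - F t))\<^sup>2) \<partial>torus) = (\<integral>\<^sup>+t. 0 \<partial>torus)"
    by (intro nn_integral_cong_AE eventually_mono[OF AE_torus]) (use assms(3) in auto)
  then show "(\<integral>\<^sup>+t. ennreal ((norm (G t - F t))\<^sup>2) \<partial>torus) < ennreal \<epsilon>" using e by simp
qed (rule assms(1))

lemma trig_approximable_continuous_circle:
  fixes H :: "complex \<Rightarrow> real"
  assumes "continuous_on UNIV H"
  shows "trig_approximable (\<lambda>t. of_real (H (fourier_mode 1 t)))"
proof (rule trig_approximableI_limit)
  have cont: "continuous_on UNIV (\<lambda>t. complex_of_real (H (fourier_mode 1 t)))"
    by (intro continuous_intros continuous_on_compose2[OF assms]) auto
  then show "(\<lambda>t. complex_of_real (H (fourier_mode 1 t))) \<in> borel_measurable borel"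
    by (rule borel_measurable_continuous_onI)
  fix \<epsilon> :: real assume e: "\<epsilon> > 0"
  define d where "d = sqrt (\<epsilon> / 2)"
  have d: "d > 0" using e by (simp add: d_def)
  obtain p where p: "real_polynomial_function p" "\<And>x. x \<in> sphere 0 1 \<Longrightarrow> \<bar>H x - p x\<bar> < d"
    using Stone_Weierstrass_real_polynomial_function[OF compact_sphere continuous_on_subset[OF assms subset_UNIV] d, of 0 1]
    by blast
  have "(\<integral>\<^sup>+t. ennreal ((norm (complex_of_real (H (fourier_mode 1 t)) - of_real (p (fourier_mode 1 t))))\<^sup>2) \<partial>torus)
      \<le> (\<integral>\<^sup>+t. ennreal (d\<^sup>2) \<partial>torus)"
  proof (intro nn_integral_mono ennreal_leI power_mono)
    fix t
    show "norm (complex_of_real (H (fourier_mode 1 t)) - of_real (p (fourier_mode 1 t))) \<le> d"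
      using p(2)[of "fourier_mode 1 t"] by (simp flip: of_real_diff)
  qed auto
  also have "\<dots> = ennreal (\<epsilon> / 2)" using e by (simp add: d_def)
  also have "\<dots> < ennreal \<epsilon>" using e by (intro ennreal_lessI) auto
  finally show "\<exists>G. trig_approximable G \<and>
      (\<integral>\<^sup>+t. ennreal ((norm (complex_of_real (H (fourier_mode 1 t)) - G t))\<^sup>2) \<partial>torus) < ennreal \<epsilon>"
    using trig_approximable_trig_poly[OF trig_poly_real_polynomial[OF p(1)]] by blast
qed

text \<open>
  The indicator of an open set is the increasing limit of the continuous functions
  \<open>min 1 (n * dist(z, complement))\<close>.
\<close>

lemma trig_approximable_open_circle:
  fixes V :: "complex set"
  assumes "open V"
  shows "trig_approximable (\<lambda>t. indicator V (fourier_mode 1 t))"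
proof (cases "V = UNIV")
  case True
  then show ?thesis by (simp add: trig_approximable_trig_poly trig_poly_const)
next
  case False
  define h where "h = (\<lambda>n z. min 1 (real n * infdist z (- V)))"
  have [measurable]: "V \<in> sets borel" using assms by simp
  show ?thesis
  proof (rule trig_approximable_dominated[where w = "\<lambda>_. 1" and G = "\<lambda>n t. of_real (h n (fourier_mode 1 t))"])
    show "trig_approximable (\<lambda>t. complex_of_real (h n (fourier_mode 1 t)))" for n
      by (rule trig_approximable_continuous_circle) (auto simp: h_def intro!: continuous_intros)
    fix t :: real
    let ?z = "fourier_mode 1 t"
    have "(\<lambda>n. h n ?z) \<longlonglongrightarrow> indicator V ?z"
    proof (cases "?z \<in> V")
      case True
      have "infdist ?z (- V) > 0"
        using True False assms by (metis Compl_iff closed_Compl compl_eq_compl_iff[of V UNIV] Compl_UNIV_eq 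
            in_closed_iff_infdist_zero infdist_nonneg less_eq_real_def)
      then obtain N where "real N * infdist ?z (- V) > 1"
        using reals_Archimedean3 by blast
      then have "h n ?z = 1" if "n \<ge> N" for n
      proof -
        have "1 < real N * infdist ?z (- V)" by fact
        also have "\<dots> \<le> real n * infdist ?z (- V)" using that by (intro mult_right_mono infdist_nonneg) auto
        finally show ?thesis by (simp add: h_def)
      qed
      then have "eventually (\<lambda>n. h n ?z = indicator V ?z) sequentially"
        using True by (auto simp: eventually_sequentially)
      then show ?thesis by (rule tendsto_eventually)
    next
      case F: False
      then have "h n ?z = 0" for n by (simp add: h_def)
      then show ?thesis using F by simp
    qed
    then have "(\<lambda>n. complex_of_real (h n ?z)) \<longlonglongrightarrow> of_real (indicator V ?z)"
      by (rule tendsto_of_real)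
    then show "(\<lambda>n. complex_of_real (h n ?z)) \<longlonglongrightarrow> indicator V ?z"
      by (simp add: of_real_indicator)
  next
    show "norm (complex_of_real (h n (fourier_mode 1 t))) \<le> 1" for n t
      using infdist_nonneg[of "fourier_mode 1 t" "- V"] by (simp add: h_def abs_le_iff min_le_iff_disj)
  qed auto
qed

lemma trig_approximable_sum:
  assumes "\<And>i. i \<in> I \<Longrightarrow> trig_approximable (F i)"
  shows "trig_approximable (\<lambda>t. \<Sum>i\<in>I. F i t)"
  using assms
proof (induction I rule: infinite_finite_induct)
  case (insert i I)
  then show ?case by (simp add: trig_approximable_add)
qed (simp_all add: trig_approximable_trig_poly trig_poly_const)

text \<open>
  The open sets are stable under intersection and generate the Borel sets, so a Dynkin system
  argument applies. Working with subsets of the plane rather than with intervals keeps everything periodic.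
\<close>

lemma trig_approximable_borel_circle:
  fixes V :: "complex set"
  assumes "V \<in> sets borel"
  shows "trig_approximable (\<lambda>t. indicator V (fourier_mode 1 t))"
proof -
  have "Int_stable {S::complex set. open S}" by (auto simp: Int_stable_def)
  moreover have "{S::complex set. open S} \<subseteq> Pow UNIV" by simp
  moreover have "V \<in> sigma_sets UNIV {S. open S}" using assms by (simp add: borel_def)
  ultimately show ?thesis
  proof (induction rule: sigma_sets_induct_disjoint)
    case (basic A)
    then show ?case by (simp add: trig_approximable_open_circle)
  next
    case empty
    show ?case by (simp add: trig_approximable_trig_poly trig_poly_const)
  next
    case (compl A)
    have "trig_approximable (\<lambda>t. 1 + (-1) * indicator A (fourier_mode 1 t))"
      by (intro trig_approximable_add trig_approximable_cmult compl trig_approximable_trig_poly trig_poly_const)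
    moreover have "1 + (-1) * indicator A z = (indicator (UNIV - A) z :: complex)" for z
      by (auto split: split_indicator)
    ultimately show ?case by simp
  next
    case (union A)
    have "A n \<in> sets borel" for n using union(2) by (auto simp: borel_def)
    then have [measurable]: "\<Union> (range A) \<in> sets borel" by auto
    show ?case
    proof (rule trig_approximable_dominated[where w = "\<lambda>_. 1" and G = "\<lambda>n t. \<Sum>i<n. indicator (A i) (fourier_mode 1 t)"])
      show "trig_approximable (\<lambda>t. \<Sum>i<n. indicator (A i) (fourier_mode 1 t))" for n
        by (intro trig_approximable_sum union)
      fix t
      have "(\<lambda>i. indicator (A i) (fourier_mode 1 t) :: real) sums indicator (\<Union> (range A)) (fourier_mode 1 t)"
        using indicator_sums[of A "fourier_mode 1 t"] union(1) by (simp add: disjoint_family_on_def)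
      from sums_of_real[OF this, where 'a=complex]
      show "(\<lambda>n. \<Sum>i<n. indicator (A i) (fourier_mode 1 t) :: complex) \<longlonglongrightarrow> indicator (\<Union> (range A)) (fourier_mode 1 t)"
        by (simp add: sums_def of_real_indicator)
    next
      fix n t
      have "(\<Sum>i<n. indicator (A i) (fourier_mode 1 t) :: complex) = indicator (\<Union>i<n. A i) (fourier_mode 1 t)"
        by (subst indicator_UN_disjoint) (use union(1) in \<open>auto simp: disjoint_family_on_def\<close>)
      then show "norm (\<Sum>i<n. indicator (A i) (fourier_mode 1 t) :: complex) \<le> 1"
        by (simp split: split_indicator)
    qed auto
  qed
qed

lemma measurable_Arg2pi: "Arg2pi \<in> borel_measurable borel"
proof -
  have "(\<lambda>z. if z \<in> - \<real>\<^sub>\<ge>\<^sub>0 then Arg2pi z else 0) \<in> borel_measurable borel"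
    by (intro borel_measurable_continuous_on_if)
       (auto simp: closed_nonneg_Reals_complex intro!: continuous_at_imp_continuous_on continuous_at_Arg2pi)
  moreover have "(if z \<in> - \<real>\<^sub>\<ge>\<^sub>0 then Arg2pi z else 0) = Arg2pi z" for z
    by (auto simp: Arg2pi_eq_0 complex_nonneg_Reals_iff complex_is_Real_iff elim!: nonneg_Reals_cases)
  ultimately show ?thesis by simp
qed

lemma Arg2pi_fourier_mode: "t \<in> {0..<1} \<Longrightarrow> Arg2pi (fourier_mode 1 t) / (2 * pi) = t"
proof -
  assume t: "t \<in> {0..<1}"
  have "Arg2pi (fourier_mode 1 t) = 2 * pi * t"
    by (rule Arg2pi_unique[of 1]) (use t in \<open>auto simp: fourier_mode_def cis_conv_exp algebra_simps\<close>)
  then show ?thesis by simp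
qed

text \<open>
  The argument function inverts \<open>t \<mapsto> exp (2 \<pi> \<i> t)\<close> on \<open>[0,1)\<close> and is Borel, hence every Borel
  subset of \<open>[0,1)\<close> is the preimage of a Borel subset of the plane.
\<close>

lemma trig_approximable_borel:
  fixes A :: "real set"
  assumes [measurable]: "A \<in> sets borel"
  shows "trig_approximable (indicator A)"
proof -
  note [measurable] = measurable_Arg2pi
  define V where "V = {z. Arg2pi z / (2 * pi) \<in> A}"
  have "V \<in> sets borel" unfolding V_def by measurable
  then have "trig_approximable (\<lambda>t. indicator V (fourier_mode 1 t))"
    by (rule trig_approximable_borel_circle)
  then show ?thesis
    by (rule trig_approximable_cong) (auto simp: V_def Arg2pi_fourier_mode split: split_indicator)
qed

lemma trig_approximable_nonneg:
  fixes u :: "real \<Rightarrow> real"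
  assumes "u \<in> borel_measurable borel" "\<And>t. 0 \<le> u t" "(\<integral>\<^sup>+t. ennreal ((u t)\<^sup>2) \<partial>torus) < \<infinity>"
  shows "trig_approximable (\<lambda>t. of_real (u t))"
  using assms
proof (induction rule: borel_measurable_induct_real)
  case (set A)
  then show ?case by (simp add: trig_approximable_borel of_real_indicator)
next
  case (mult u c)
  show ?case
  proof (cases "c = 0")
    case True
    then show ?thesis by (simp add: trig_approximable_trig_poly trig_poly_const)
  next
    case False
    have [measurable]: "u \<in> borel_measurable borel" by fact
    have "(\<integral>\<^sup>+t. ennreal ((c * u t)\<^sup>2) \<partial>torus) = ennreal (c\<^sup>2) * (\<integral>\<^sup>+t. ennreal ((u t)\<^sup>2) \<partial>torus)"
      by (subst nn_integral_cmult[symmetric]) (auto simp: power_mult_distrib ennreal_mult)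
    then have "(\<integral>\<^sup>+t. ennreal ((u t)\<^sup>2) \<partial>torus) < \<infinity>"
      using mult.prems False by (auto simp: ennreal_mult_less_top)
    then show ?thesis using mult.IH trig_approximable_cmult[of "\<lambda>t. of_real (u t)" "of_real c"] by simp
  qed
next
  case (add u v)
  have [measurable]: "u \<in> borel_measurable borel" "v \<in> borel_measurable borel" by fact+
  have "(\<integral>\<^sup>+t. ennreal ((u t)\<^sup>2) \<partial>torus) \<le> (\<integral>\<^sup>+t. ennreal ((v t + u t)\<^sup>2) \<partial>torus)"
       "(\<integral>\<^sup>+t. ennreal ((v t)\<^sup>2) \<partial>torus) \<le> (\<integral>\<^sup>+t. ennreal ((v t + u t)\<^sup>2) \<partial>torus)"
    using add by (auto intro!: nn_integral_mono ennreal_leI power_mono)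
  then show ?case using add.IH add.prems trig_approximable_add
    by (fastforce dest: order.strict_trans1)
next
  case (seq U)
  have [measurable]: "U i \<in> borel_measurable borel" for i by fact
  have mono: "U i t \<le> u t" for i t
    using seq.hyps(3,4) by (intro incseq_le[of "\<lambda>i. U i t"]) (auto simp: incseq_def le_fun_def)
  show ?case
  proof (rule trig_approximable_dominated[where w = u and G = "\<lambda>i t. of_real (U i t)"])
    show "trig_approximable (\<lambda>t. complex_of_real (U i t))" for i
    proof (rule seq.IH)
      have "(\<integral>\<^sup>+t. ennreal ((U i t)\<^sup>2) \<partial>torus) \<le> (\<integral>\<^sup>+t. ennreal ((u t)\<^sup>2) \<partial>torus)"
        using seq.hyps(2) mono by (auto intro!: nn_integral_mono ennreal_leI power_mono)
      also have "\<dots> < \<infinity>" by fact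
      finally show "(\<integral>\<^sup>+t. ennreal ((U i t)\<^sup>2) \<partial>torus) < \<infinity>" .
    qed
    show "(\<lambda>t. complex_of_real (u t)) \<in> borel_measurable borel" "u \<in> borel_measurable borel"
      using borel_measurable_LIMSEQ_real[of borel U u] seq.hyps by auto
    show "(\<lambda>i. complex_of_real (U i t)) \<longlonglongrightarrow> complex_of_real (u t)" for t
      using seq.hyps by (intro tendsto_of_real) auto
    show "norm (complex_of_real (U i t)) \<le> u t" for i t
      using mono seq.hyps by simp
  qed fact
qed

lemma trig_approximable_real:
  fixes u :: "real \<Rightarrow> real"
  assumes [measurable]: "u \<in> borel_measurable borel" and fin: "(\<integral>\<^sup>+t. ennreal ((u t)\<^sup>2) \<partial>torus) < \<infinity>"
  shows "trig_approximable (\<lambda>t. of_real (u t))"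
proof -
  have *: "trig_approximable (\<lambda>t. of_real (max 0 (s * u t)))" if "\<bar>s\<bar> \<le> 1" for s
  proof (rule trig_approximable_nonneg)
    have "(\<integral>\<^sup>+t. ennreal ((max 0 (s * u t))\<^sup>2) \<partial>torus) \<le> (\<integral>\<^sup>+t. ennreal ((u t)\<^sup>2) \<partial>torus)"
    proof (intro nn_integral_mono ennreal_leI)
      fix t
      have "\<bar>max 0 (s * u t)\<bar> \<le> \<bar>s * u t\<bar>" by auto
      also have "\<dots> \<le> 1 * \<bar>u t\<bar>" unfolding abs_mult using that by (intro mult_right_mono) auto
      finally show "(max 0 (s * u t))\<^sup>2 \<le> (u t)\<^sup>2" by (simp only: mult_1 abs_le_square_iff)
    qed
    then show "(\<integral>\<^sup>+t. ennreal ((max 0 (s * u t))\<^sup>2) \<partial>torus) < \<infinity>" using fin by (rule order.strict_trans1)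
  qed auto
  have "trig_approximable (\<lambda>t. of_real (max 0 (1 * u t)) + (-1) * of_real (max 0 ((-1) * u t)))"
    by (intro trig_approximable_add trig_approximable_cmult *) auto
  then show ?thesis
    by (rule trig_approximable_cong) (auto simp: max_def)
qed

text \<open>
  Density of the trigonometric polynomials in \<open>L\<^sup>2\<close> of the circle; this is the completeness half
  of Parseval's identity.
\<close>

theorem trig_approximable_L2:
  assumes [measurable]: "F \<in> borel_measurable borel" and fin: "(\<integral>\<^sup>+t. ennreal ((norm (F t))\<^sup>2) \<partial>torus) < \<infinity>"
  shows "trig_approximable F"
proof -
  have "(\<integral>\<^sup>+t. ennreal ((Re (F t))\<^sup>2) \<partial>torus) < \<infinity>" "(\<integral>\<^sup>+t. ennreal ((Im (F t))\<^sup>2) \<partial>torus) < \<infinity>"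
    by (rule order.strict_trans1[OF nn_integral_mono fin], rule ennreal_leI, simp add: cmod_power2)+
  then have "trig_approximable (\<lambda>t. of_real (Re (F t)) + \<i> * of_real (Im (F t)))"
    by (intro trig_approximable_add trig_approximable_cmult trig_approximable_real) auto
  then show ?thesis by (rule trig_approximable_cong) (auto simp: complex_eq[symmetric])
qed

definition fourier_coeff :: "(real \<Rightarrow> complex) \<Rightarrow> int \<Rightarrow> complex" where
  "fourier_coeff F l = (LINT t|torus. F t * fourier_mode (- l) t)"

lemma trig_poly_finite_sum:
  assumes "trig_poly T"
  shows "\<exists>L c. finite L \<and> (\<forall>l. l \<notin> L \<longrightarrow> c l = 0) \<and> T = (\<lambda>t. \<Sum>l\<in>L. c l * fourier_mode l t)"
  using assms
proof induction
  case (mode c l)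
  show ?case by (rule exI[of _ "{l}"], rule exI[of _ "\<lambda>k. if k = l then c else 0"]) auto
next
  case (add S T)
  then obtain L c K d where *: "finite L" "\<forall>l. l \<notin> L \<longrightarrow> c l = 0" "S = (\<lambda>t. \<Sum>l\<in>L. c l * fourier_mode l t)"
    "finite K" "\<forall>l. l \<notin> K \<longrightarrow> d l = 0" "T = (\<lambda>t. \<Sum>l\<in>K. d l * fourier_mode l t)"
    by blast
  have "S t + T t = (\<Sum>l\<in>L \<union> K. (c l + d l) * fourier_mode l t)" for t
  proof -
    have "S t = (\<Sum>l\<in>L \<union> K. c l * fourier_mode l t)" "T t = (\<Sum>l\<in>L \<union> K. d l * fourier_mode l t)"
      unfolding * using * by (auto intro!: sum.mono_neutral_left)
    then show ?thesis by (simp add: sum.distrib algebra_simps)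
  qed
  then show ?case using * by (intro exI[of _ "L \<union> K"] exI[of _ "\<lambda>l. c l + d l"]) auto
qed

context
  fixes F :: "real \<Rightarrow> complex"
  assumes F [measurable]: "F \<in> borel_measurable borel"
    and fin: "(\<integral>\<^sup>+t. ennreal ((norm (F t))\<^sup>2) \<partial>torus) < \<infinity>"
begin

lemma integrable_square: "integrable torus (\<lambda>t. (norm (F t))\<^sup>2)"
  using fin by (intro integrableI_bounded) auto

lemma integrable_if_square: "integrable torus F"
proof (rule Bochner_Integration.integrable_bound)
  show "integrable torus (\<lambda>t. 1 + (norm (F t))\<^sup>2)"
    by (intro Bochner_Integration.integrable_add integrable_square) simp
  show "AE t in torus. norm (F t) \<le> norm (1 + (norm (F t))\<^sup>2)"
  proof (rule AE_I2)
    fix t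
    have "0 \<le> (norm (F t) - 1)\<^sup>2" by simp
    then have "2 * norm (F t) \<le> 1 + (norm (F t))\<^sup>2" by (simp add: power2_eq_square algebra_simps)
    then show "norm (F t) \<le> norm (1 + (norm (F t))\<^sup>2)" using norm_ge_zero[of "F t"] unfolding real_norm_def by linarith
  qed
qed simp

lemma integrable_mult_mode: "integrable torus (\<lambda>t. F t * fourier_mode l t)"
  by (rule Bochner_Integration.integrable_bound[OF integrable_norm[OF integrable_if_square]])
     (auto simp: norm_mult)

text \<open>
  Completing the square. The choice \<open>c = fourier_coeff F\<close> gives Bessel's inequality, an
  approximating \<open>c\<close> gives the reverse inequality up to \<open>\<epsilon>\<close>.
\<close>

lemma square_distance_trig_sum:
  assumes L: "finite L"
  shows "(LINT t|torus. (norm (F t - (\<Sum>l\<in>L. c l * fourier_mode l t)))\<^sup>2) =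
    (LINT t|torus. (norm (F t))\<^sup>2) - (\<Sum>l\<in>L. (norm (fourier_coeff F l))\<^sup>2)
      + (\<Sum>l\<in>L. (norm (fourier_coeff F l - c l))\<^sup>2)"
proof -
  let ?T = "\<lambda>t. \<Sum>l\<in>L. c l * fourier_mode l t"
  have int1: "integrable torus (\<lambda>t. F t * cnj (?T t))"
    unfolding cnj_sum sum_distrib_left complex_cnj_mult cnj_fourier_mode
    by (intro Bochner_Integration.integrable_sum)
       (use integrable_mult_mode in \<open>simp add: mult.left_commute[of "F _"]\<close>)
  have int2: "integrable torus (\<lambda>t. ?T t * cnj (?T t))"
  proof (rule integrable_torus_bounded)
    fix t
    have "norm (?T t) \<le> (\<Sum>l\<in>L. norm (c l))"
      by (rule order_trans[OF norm_sum]) (simp add: norm_mult)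
    then show "norm (?T t * cnj (?T t)) \<le> (\<Sum>l\<in>L. norm (c l)) * (\<Sum>l\<in>L. norm (c l))"
      unfolding norm_mult complex_mod_cnj by (intro mult_mono) (auto intro: sum_nonneg)
  qed measurable
  have val1: "(LINT t|torus. F t * cnj (?T t)) = (\<Sum>l\<in>L. cnj (c l) * fourier_coeff F l)"
  proof -
    have "(LINT t|torus. F t * cnj (?T t)) = (LINT t|torus. (\<Sum>l\<in>L. cnj (c l) * (F t * fourier_mode (- l) t)))"
      by (simp add: sum_distrib_left cnj_fourier_mode mult_ac)
    also have "\<dots> = (\<Sum>l\<in>L. cnj (c l) * fourier_coeff F l)"
      unfolding fourier_coeff_def using integrable_mult_mode by (subst Bochner_Integration.integral_sum) auto
    finally show ?thesis .
  qed
  have val2: "(LINT t|torus. ?T t * cnj (?T t)) = (\<Sum>l\<in>L. c l * cnj (c l))"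
  proof -
    have "(LINT t|torus. ?T t * cnj (?T t))
        = (LINT t|torus. (\<Sum>l\<in>L. \<Sum>k\<in>L. c l * cnj (c k) * fourier_mode (l - k) t))"
    proof (rule Bochner_Integration.integral_cong[OF refl])
      fix t
      show "?T t * cnj (?T t) = (\<Sum>l\<in>L. \<Sum>k\<in>L. c l * cnj (c k) * fourier_mode (l - k) t)"
        by (simp add: sum_product cnj_fourier_mode mult_ac flip: fourier_mode_mult[of _ t "- _", simplified])
    qed
    also have "\<dots> = (\<Sum>l\<in>L. \<Sum>k\<in>L. c l * cnj (c k) * (if l = k then 1 else 0))"
      by (subst Bochner_Integration.integral_sum;
          (subst Bochner_Integration.integral_sum)?;
          (intro Bochner_Integration.integrable_sum)?) 
         (auto simp: integral_fourier_mode intro!: sum.cong integrable_torus_bounded[where B=1] integrable_mult_right)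
    also have "\<dots> = (\<Sum>l\<in>L. c l * cnj (c l))"
      using L by (simp add: if_distrib cong: if_cong)
    finally show ?thesis .
  qed
  have "complex_of_real (LINT t|torus. (norm (F t - ?T t))\<^sup>2)
     = (LINT t|torus. complex_of_real ((norm (F t))\<^sup>2) - F t * cnj (?T t) - cnj (F t * cnj (?T t)) + ?T t * cnj (?T t))"
    by (subst integral_complex_of_real[symmetric])
       (simp add: complex_norm_square algebra_simps flip: of_real_power)
  also have "\<dots> = complex_of_real (LINT t|torus. (norm (F t))\<^sup>2) - (\<Sum>l\<in>L. cnj (c l) * fourier_coeff F l)
     - cnj (\<Sum>l\<in>L. cnj (c l) * fourier_coeff F l) + (\<Sum>l\<in>L. c l * cnj (c l))"
  proof -
    have i0: "integrable torus (\<lambda>t. complex_of_real ((norm (F t))\<^sup>2))" 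
      by (rule integrable_of_real[OF integrable_square])
    have i1: "integrable torus (\<lambda>t. cnj (F t * cnj (?T t)))" using int1 by (simp only: complex_integrable_cnj)
    have "(LINT t|torus. cnj (F t * cnj (?T t))) = cnj (LINT t|torus. F t * cnj (?T t))"
      by (rule integral_bounded_linear[OF bounded_linear_cnj int1])
    moreover have "(LINT t|torus. complex_of_real ((norm (F t))\<^sup>2)) = complex_of_real (LINT t|torus. (norm (F t))\<^sup>2)"
      by (rule integral_complex_of_real)
    ultimately show ?thesis
      using i0 i1 int1 int2 val1 val2 
      by (simp only: Bochner_Integration.integral_add Bochner_Integration.integral_diff Bochner_Integration.integrable_diff Bochner_Integration.integrable_add)
  qed
  also have "\<dots> = complex_of_real ((LINT t|torus. (norm (F t))\<^sup>2) - (\<Sum>l\<in>L. (norm (fourier_coeff F l))\<^sup>2)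
      + (\<Sum>l\<in>L. (norm (fourier_coeff F l - c l))\<^sup>2))"
    by (simp add: complex_norm_square sum_subtractf sum.distrib algebra_simps flip: of_real_power)
  finally show ?thesis by (simp only: of_real_eq_iff)
qed

lemma bessel: 
  assumes "finite L"
  shows "(\<Sum>l\<in>L. (norm (fourier_coeff F l))\<^sup>2) \<le> (LINT t|torus. (norm (F t))\<^sup>2)"
proof -
  have "0 \<le> (LINT t|torus. (norm (F t - (\<Sum>l\<in>L. fourier_coeff F l * fourier_mode l t)))\<^sup>2)" by simp
  then show ?thesis unfolding square_distance_trig_sum[OF assms] by simp
qed

theorem parseval: "((\<lambda>l. (norm (fourier_coeff F l))\<^sup>2) has_sum (LINT t|torus. (norm (F t))\<^sup>2)) UNIV"
proof -
  let ?S = "LINT t|torus. (norm (F t))\<^sup>2"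
  have summ: "(\<lambda>l. (norm (fourier_coeff F l))\<^sup>2) summable_on UNIV"
    by (rule nonneg_bdd_above_summable_on) (auto intro!: bdd_aboveI[of _ ?S] bessel)
  have "(\<Sum>\<^sub>\<infinity>l. (norm (fourier_coeff F l))\<^sup>2) \<le> ?S"
    by (rule infsum_le_finite_sums[OF summ]) (rule bessel)
  moreover have "?S \<le> (\<Sum>\<^sub>\<infinity>l. (norm (fourier_coeff F l))\<^sup>2) + \<epsilon>" if e: "\<epsilon> > 0" for \<epsilon>
  proof -
    obtain T where T: "trig_poly T" "(\<integral>\<^sup>+t. ennreal ((norm (F t - T t))\<^sup>2) \<partial>torus) < ennreal \<epsilon>"
      using trig_approximable_L2[OF F fin] e unfolding trig_approximable_def by blast
    note [measurable] = measurable_trig_poly[OF T(1)]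
    obtain L c where L: "finite L" "T = (\<lambda>t. \<Sum>l\<in>L. c l * fourier_mode l t)"
      using trig_poly_finite_sum[OF T(1)] by blast
    have "(LINT t|torus. (norm (F t - T t))\<^sup>2) = enn2real (\<integral>\<^sup>+t. ennreal ((norm (F t - T t))\<^sup>2) \<partial>torus)"
      by (rule integral_eq_nn_integral) auto
    also have "\<dots> \<le> \<epsilon>" using T(2) e by (intro enn2real_leI) auto
    finally have "?S - (\<Sum>l\<in>L. (norm (fourier_coeff F l))\<^sup>2) + (\<Sum>l\<in>L. (norm (fourier_coeff F l - c l))\<^sup>2) \<le> \<epsilon>"
      unfolding L(2) square_distance_trig_sum[OF L(1)] .
    moreover have "0 \<le> (\<Sum>l\<in>L. (norm (fourier_coeff F l - c l))\<^sup>2)" by (intro sum_nonneg) auto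
    moreover have "(\<Sum>l\<in>L. (norm (fourier_coeff F l))\<^sup>2) \<le> (\<Sum>\<^sub>\<infinity>l. (norm (fourier_coeff F l))\<^sup>2)"
      by (rule finite_sum_le_infsum[OF summ]) (use L in auto)
    ultimately show ?thesis by linarith
  qed
  then have "?S \<le> (\<Sum>\<^sub>\<infinity>l. (norm (fourier_coeff F l))\<^sup>2)" by (rule field_le_epsilon)
  ultimately show ?thesis using has_sum_infsum[OF summ] by simp
qed

end

section \<open>The Fourier transform of the squared hyperbolic secant\<close>

lemma integrable_sech_squared:
  "integrable lborel (\<lambda>u::real. 1 / (cosh u)\<^sup>2)" (is ?I)
  and integral_sech_squared: "(LINT u|lborel. 1 / (cosh (u::real))\<^sup>2) = 2" (is ?V)
proof -
  have lims: "((tanh \<circ> real_of_ereal) \<longlongrightarrow> (-1::real)) (at_right (- \<infinity>))"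
             "((tanh \<circ> real_of_ereal) \<longlongrightarrow> (1::real)) (at_left \<infinity>)"
    using tanh_real_at_bot tanh_real_at_top by (simp_all add: ereal_tendsto_simps)
  have D: "DERIV tanh x :> 1 / (cosh x)\<^sup>2" for x :: real
  proof -
    have "1 - (tanh x)\<^sup>2 = ((cosh x)\<^sup>2 - (sinh x)\<^sup>2) / (cosh x)\<^sup>2"
      by (simp add: tanh_def power_divide diff_divide_distrib)
    then have "1 - (tanh x)\<^sup>2 = 1 / (cosh x)\<^sup>2" by (simp add: cosh_square_eq)
    then show ?thesis by (auto intro!: derivative_eq_intros)
  qed
  have C: "isCont (\<lambda>u::real. 1 / (cosh u)\<^sup>2) x" for x
    by (intro continuous_intros) auto
  have "set_integrable lborel (einterval (-\<infinity>) \<infinity>) (\<lambda>u::real. 1 / (cosh u)\<^sup>2)"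
    by (rule interval_integral_FTC_nonneg[of "-\<infinity>" \<infinity> tanh _ "-1" 1]) (use lims D C in auto)
  then show ?I by (simp add: set_integrable_def)
  have "(LBINT u=-\<infinity>..\<infinity>. 1 / (cosh (u::real))\<^sup>2) = 1 - (-1)"
    by (rule interval_integral_FTC_nonneg[of "-\<infinity>" \<infinity> tanh _ "-1" 1]) (use lims D C in auto)
  then show ?V by (simp add: interval_lebesgue_integral_def set_lebesgue_integral_def)
qed

lemma complex_cosh_of_real: "cosh (complex_of_real u) = of_real (cosh u)"
  by (simp add: cosh_def scaleR_conv_of_real exp_of_real flip: of_real_minus)

text \<open>
  The strip is slightly larger than \<open>0 \<le> Im z \<le> \<pi>\<close> so that it is an open neighbourhood of the
  rectangle used below and still contains only one pole.
\<close>

lemma complex_cosh_eq_0_strip: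
  assumes "cosh z = 0" "- pi / 2 < Im z" "Im z < 3 * pi / 2"
  shows "z = \<i> * of_real (pi / 2)"
proof -
  have "cos (\<i> * z) = 0" using assms by (simp add: cosh_conv_cos)
  then obtain n :: int where n: "\<i> * z = of_real (n * pi) + of_real pi / 2"
    unfolding cos_eq_0 by auto
  then have z: "z = - \<i> * (of_real (n * pi) + of_real pi / 2)"
    by (metis mult.assoc mult_minus_left complex_i_mult_minus minus_equation_iff)
  then have im: "Im z = - (n * pi + pi / 2)" by simp
  have "n < 0" 
  proof (rule ccontr)
    assume "\<not> n < 0"
    then have "0 \<le> real_of_int n * pi" by simp
    then show False using im assms(2) by linarith
  qed
  moreover have "n > -2"
  proof (rule ccontr)
    assume "\<not> n > -2"
    then have "real_of_int n * pi \<le> (-2) * pi" by (intro mult_right_mono) auto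
    then show False using im assms(3) by linarith
  qed
  ultimately have "n = -1" by simp
  then show ?thesis using z by (simp add: complex_eq_iff)
qed

lemma norm_cosh_ge:
  "(sinh (Re z))\<^sup>2 \<le> (norm (cosh z))\<^sup>2"
proof -
  have re: "Re (cosh z) = cosh (Re z) * cos (Im z)"
    by (simp add: cosh_def exp_eq_polar field_simps Re_exp)
  have im: "Im (cosh z) = sinh (Re z) * sin (Im z)"
    by (simp add: cosh_def sinh_def Im_exp field_simps)
  have "(norm (cosh z))\<^sup>2 = (cosh (Re z))\<^sup>2 * (cos (Im z))\<^sup>2 + (sinh (Re z))\<^sup>2 * (sin (Im z))\<^sup>2"
    by (simp add: cmod_power2 re im power_mult_distrib)
  also have "\<dots> = (sinh (Re z))\<^sup>2 * ((sin (Im z))\<^sup>2 + (cos (Im z))\<^sup>2) + (cos (Im z))\<^sup>2"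
  proof -
    have "(s + 1) * c + s * d = s * (d + c) + c" for s c d :: real by (simp add: algebra_simps)
    then show ?thesis unfolding cosh_square_eq .
  qed
  finally show ?thesis unfolding sin_cos_squared_add by simp
qed

context
  fixes w :: real
begin

definition modulated_sech_sq :: "complex \<Rightarrow> complex" where
  "modulated_sech_sq z = exp (\<i> * of_real w * z) / (cosh z)\<^sup>2"

text \<open>
  The pole of \<open>exp(\<i> w z) / cosh\<^sup>2 z\<close> at \<open>\<i> \<pi> / 2\<close> is double. Since
  \<open>(exp(\<i> w z) tanh z)' = exp(\<i> w z) / cosh\<^sup>2 z + \<i> w exp(\<i> w z) tanh z\<close>, the integral over a closed contour
  equals that of \<open>- \<i> w exp(\<i> w z) tanh z\<close>, whose pole is simple with residue \<open>exp(- \<pi> w / 2)\<close>.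
\<close>

lemma contour_integral_sech_squared:
  assumes R: "R > 0"
  shows "(modulated_sech_sq has_contour_integral 2 * of_real pi * of_real w * exp (- of_real (pi * w / 2)))
           (rectpath (of_real (-R)) (Complex R pi))"
proof -
  let ?g = "rectpath (of_real (-R)) (Complex R pi)"
  let ?z0 = "\<i> * of_real (pi / 2)"
  define S where "S = {z. - pi / 2 < Im z} \<inter> {z. Im z < 3 * pi / 2}"
  have S: "open S" "connected S" "convex S"
    unfolding S_def
    by (intro open_Int convex_connected convex_Int open_halfspace_Im_gt open_halfspace_Im_lt
        convex_halfspace_Im_gt convex_halfspace_Im_lt)+
  have z0: "?z0 \<in> S" using pi_gt3 by (auto simp: S_def)
  have ch0: "cosh ?z0 = 0"
  proof -
    have "cosh ?z0 = cos (- complex_of_real (pi / 2))" by (simp add: cosh_conv_cos)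
    also have "\<dots> = 0" unfolding cos_minus cos_of_real cos_pi_half by simp
    finally show ?thesis .
  qed
  then have sh0: "sinh ?z0 \<noteq> 0" using cosh_square_eq[of ?z0] by auto
  have nz: "cosh z \<noteq> 0" if "z \<in> S - {?z0}" for z
    using complex_cosh_eq_0_strip[of z] that by (auto simp: S_def)
  have img: "path_image ?g \<subseteq> S - {?z0}"
    using R pi_gt3 by (subst path_image_rectpath) (auto simp: S_def complex_eq_iff)
  define f where "f = (\<lambda>z. exp (\<i> * of_real w * z) * sinh z / cosh z)"
  have hol: "f holomorphic_on S - {?z0}"
    unfolding f_def using nz by (intro holomorphic_intros holomorphic_on_divide) 
       (auto simp: sinh_field_def cosh_field_def intro!: holomorphic_intros)
  have outside: "winding_number ?g z = 0" if "z \<notin> S" for z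
    using that R pi_gt3 by (intro winding_number_rectpath_outside) (auto simp: S_def in_cbox_complex_iff)
  have "contour_integral ?g f = 2 * pi * \<i> * (\<Sum>p\<in>{?z0}. winding_number ?g p * residue f p)"
    using S hol img outside by (intro Residue_theorem[of S]) auto
  moreover have "winding_number ?g ?z0 = 1"
    using R pi_gt3 by (intro winding_number_rectpath) (auto simp: in_box_complex_iff)
  moreover have "residue f ?z0 = exp (\<i> * of_real w * ?z0) * sinh ?z0 / sinh ?z0"
    unfolding f_def
  proof (rule residue_simple_pole_deriv[of _ S])
    show "(\<lambda>z. exp (\<i> * of_real w * z) * sinh z) holomorphic_on S" "cosh holomorphic_on S"
      by (auto simp: sinh_field_def cosh_field_def[abs_def] intro!: holomorphic_intros)
    show "cosh ?z0 = 0" by (rule ch0)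
    show "sinh ?z0 \<noteq> 0" by (rule sh0)
    then show "exp (\<i> * of_real w * ?z0) * sinh ?z0 \<noteq> 0" by simp
    show "(cosh has_field_derivative sinh ?z0) (at ?z0)" by (auto intro!: derivative_eq_intros)
  qed (use S z0 in auto)
  moreover note sh0
  moreover have "\<i> * of_real w * ?z0 = - of_real (pi * w / 2)" by (simp add: complex_eq_iff)
  ultimately have ci: "contour_integral ?g f = 2 * pi * \<i> * exp (- of_real (pi * w / 2))"
    by simp
  have "f contour_integrable_on ?g"
    using img hol S by (intro contour_integrable_holomorphic_simple[OF hol]) (auto intro: open_Diff)
  then have f_int: "(f has_contour_integral 2 * pi * \<i> * exp (- of_real (pi * w / 2))) ?g"
    using ci has_contour_integral_integral by metis
  have "((\<lambda>z. modulated_sech_sq z + \<i> * of_real w * f z) has_contour_integral f (pathfinish ?g) - f (pathstart ?g)) ?g"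
  proof (rule contour_integral_primitive[of "S - {?z0}"])
    fix z assume z: "z \<in> S - {?z0}"
    show "(f has_field_derivative modulated_sech_sq z + \<i> * of_real w * f z) (at z within S - {?z0})"
      unfolding f_def modulated_sech_sq_def
    proof (rule DERIV_subset[OF _ subset_UNIV], rule DERIV_cong)
      let ?E = "exp (\<i> * of_real w * z)"
      have dE: "((\<lambda>z. exp (\<i> * of_real w * z)) has_field_derivative \<i> * of_real w * ?E) (at z)"
        by (auto intro!: derivative_eq_intros)
      have dS: "(sinh has_field_derivative cosh z) (at z)" and dC: "(cosh has_field_derivative sinh z) (at z)"
        by (auto intro!: derivative_eq_intros)
      show "((\<lambda>z. exp (\<i> * of_real w * z) * sinh z / cosh z) has_field_derivative
         ((\<i> * of_real w * ?E * sinh z + cosh z * ?E) * cosh z - ?E * sinh z * sinh z) / (cosh z * cosh z)) (at z)"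
        by (rule DERIV_divide[OF DERIV_mult[OF dE dS] dC nz[OF z]])
      have "(\<i> * of_real w * ?E * sinh z + cosh z * ?E) * cosh z - ?E * sinh z * sinh z
          = \<i> * of_real w * ?E * sinh z * cosh z + ?E * ((cosh z)\<^sup>2 - (sinh z)\<^sup>2)"
        by (simp add: algebra_simps power2_eq_square)
      also have "(cosh z)\<^sup>2 - (sinh z)\<^sup>2 = 1" by (simp add: cosh_square_eq)
      finally have num: "(\<i> * of_real w * ?E * sinh z + cosh z * ?E) * cosh z - ?E * sinh z * sinh z
          = \<i> * of_real w * ?E * sinh z * cosh z + ?E * 1" .
      have "(k * E * S * C + E * 1) / (C * C) = E / C\<^sup>2 + k * (E * S / C)" if "C \<noteq> 0" for k E S C :: complex
        using that unfolding add_divide_distrib by (simp add: power2_eq_square)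
      from this[OF nz[OF z], of "\<i> * of_real w" ?E "sinh z"]
      show "((\<i> * of_real w * ?E * sinh z + cosh z * ?E) * cosh z - ?E * sinh z * sinh z) / (cosh z * cosh z)
         = ?E / (cosh z)\<^sup>2 + \<i> * of_real w * (?E * sinh z / cosh z)"
        unfolding num .
    qed
  qed (use img in auto)
  then have p: "((\<lambda>z. modulated_sech_sq z + \<i> * of_real w * f z) has_contour_integral 0) ?g" by simp
  have "((\<lambda>z. (modulated_sech_sq z + \<i> * of_real w * f z) - \<i> * of_real w * f z) has_contour_integral
     (0 - \<i> * of_real w * (2 * pi * \<i> * exp (- of_real (pi * w / 2))))) ?g"
    by (intro has_contour_integral_diff p has_contour_integral_lmul f_int)
  then have fin: "(modulated_sech_sq has_contour_integral
     (0 - \<i> * of_real w * (2 * pi * \<i> * exp (- of_real (pi * w / 2))))) ?g"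
    by (simp only: add_diff_cancel_right')
  have val: "0 - \<i> * of_real w * (2 * pi * \<i> * exp (- of_real (pi * w / 2)))
      = 2 * of_real pi * of_real w * exp (- of_real (pi * w / 2))" by (simp add: mult_ac)
  show ?thesis using fin unfolding val .
qed

text \<open>
  The upper side of the rectangle repeats the lower one up to a constant factor.
\<close>

lemma modulated_sech_sq_shift: "modulated_sech_sq (z + \<i> * of_real pi) = exp (- of_real (pi * w)) * modulated_sech_sq z"
proof -
  have "cosh (z + \<i> * of_real pi) = - cosh z"
    by (simp add: cosh_add cosh_conv_cos[of "\<i> * _"] sinh_conv_sin[of "\<i> * _"] flip: mult.assoc)
  moreover have "exp (\<i> * of_real w * (z + \<i> * of_real pi)) = exp (- of_real (pi * w)) * exp (\<i> * of_real w * z)"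
    by (subst exp_add[symmetric], rule arg_cong[of _ _ exp]) (simp add: algebra_simps)
  ultimately show ?thesis by (simp add: modulated_sech_sq_def)
qed

lemma modulated_sech_sq_vertical_bound:
  assumes "R > 0" "\<bar>Re z\<bar> = R" "Im z \<in> {0..pi}"
  shows "norm (modulated_sech_sq z) \<le> exp (pi * \<bar>w\<bar>) / (sinh R)\<^sup>2"
proof -
  have "norm (exp (\<i> * of_real w * z)) \<le> exp (pi * \<bar>w\<bar>)"
  proof -
    have "- w * Im z \<le> \<bar>w\<bar> * \<bar>Im z\<bar>" by (metis abs_ge_self abs_minus_cancel abs_mult mult_minus_left)
    also have "\<dots> \<le> \<bar>w\<bar> * pi" using assms by (intro mult_left_mono) auto
    finally show ?thesis by (simp add: mult_ac)
  qed
  moreover have "(sinh R)\<^sup>2 \<le> (norm (cosh z))\<^sup>2"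
  proof -
    have "(sinh R)\<^sup>2 = (sinh (Re z))\<^sup>2" using assms(2) by (auto simp: abs_if split: if_splits)
    then show ?thesis using norm_cosh_ge[of z] by simp
  qed
  moreover have "(sinh R)\<^sup>2 > 0" using assms(1) by simp
  ultimately show ?thesis unfolding modulated_sech_sq_def norm_divide norm_power
    by (intro frac_le) auto
qed

lemma modulated_sech_sq_contour_bound:
  assumes R: "R > 0"
  shows "norm (2 * of_real pi * of_real w * exp (- of_real (pi * w / 2))
     - (1 - exp (- of_real (pi * w))) * (LBINT u:{-R..R}. modulated_sech_sq (of_real u)))
     \<le> 2 * (exp (pi * \<bar>w\<bar>) / (sinh R)\<^sup>2 * pi)"
proof -
  define a b c d where "a = complex_of_real (-R)" and "b = complex_of_real R" 
    and "c = Complex R pi" and "d = Complex (-R) pi"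
  have cont: "continuous_on (path_image (rectpath a c)) modulated_sech_sq"
  proof -
    have "cosh z \<noteq> 0" if "z \<in> path_image (rectpath a c)" for z
    proof
      assume 0: "cosh z = 0"
      have "Im z \<in> {0..pi}" "z \<noteq> \<i> * of_real (pi / 2)"
        using that R pi_gt3 unfolding a_def c_def by (subst (asm) path_image_rectpath; auto simp: complex_eq_iff)+
      then show False using complex_cosh_eq_0_strip[OF 0] pi_gt3 by auto
    qed
    then show ?thesis unfolding modulated_sech_sq_def[abs_def] by (intro continuous_intros) auto
  qed
  have rp: "rectpath a c = linepath a b +++ linepath b c +++ linepath c d +++ linepath d a"
    by (simp add: rectpath_def a_def b_def c_def d_def Let_def complex_eq_iff complex_of_real_def)
  have sub: "path_image (linepath a b) \<subseteq> path_image (rectpath a c)" "path_image (linepath b c) \<subseteq> path_image (rectpath a c)"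
       "path_image (linepath c d) \<subseteq> path_image (rectpath a c)" "path_image (linepath d a) \<subseteq> path_image (rectpath a c)"
    unfolding rp by (auto simp: path_image_join)
  have int: "modulated_sech_sq contour_integrable_on linepath a b" "modulated_sech_sq contour_integrable_on linepath b c"
    "modulated_sech_sq contour_integrable_on linepath c d" "modulated_sech_sq contour_integrable_on linepath d a"
    using sub by (auto intro!: contour_integrable_continuous_linepath continuous_on_subset[OF cont])
  define I where "I = (\<lambda>p q. contour_integral (linepath p q) modulated_sech_sq)"
  have "contour_integral (rectpath a c) modulated_sech_sq = I a b + (I b c + (I c d + I d a))"
    unfolding rp I_def using int by (simp add: contour_integrable_join valid_path_join)
  moreover have "contour_integral (rectpath a c) modulated_sech_sq = 2 * of_real pi * of_real w * exp (- of_real (pi * w / 2))"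
    unfolding a_def c_def by (rule contour_integral_unique[OF contour_integral_sech_squared[OF R]])
  moreover have "I c d = - (exp (- of_real (pi * w)) * I a b)"
  proof -
    have "I c d = - I d c" unfolding I_def by (rule contour_integral_reverse_linepath)
       (use sub in \<open>auto simp: closed_segment_commute intro!: continuous_on_subset[OF cont]\<close>)
    also have "I d c = exp (- of_real (pi * w)) * I a b"
    proof -
      have dc: "linepath d c x = linepath a b x + \<i> * of_real pi" for x
        by (simp add: linepath_def a_def b_def c_def d_def complex_eq_iff algebra_simps)
      have "c - d = b - a" by (simp add: a_def b_def c_def d_def complex_eq_iff)
      then show ?thesis unfolding I_def contour_integral_integral
        by (simp add: dc modulated_sech_sq_shift mult.assoc)
    qed
    finally show ?thesis .
  qed
  moreover have "I a b = (LBINT u:{-R..R}. modulated_sech_sq (of_real u))"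
  proof -
    have "I a b = integral {-R..R} (\<lambda>u. modulated_sech_sq (of_real u))"
      unfolding I_def a_def b_def by (subst contour_integral_linepath_Reals_eq) (use R in auto)
    moreover have "continuous_on {-R..R} (\<lambda>u. modulated_sech_sq (of_real u))"
    proof -
      have "cosh (complex_of_real u) \<noteq> 0" for u
        by (metis complex_cosh_of_real of_real_eq_0_iff cosh_real_nonzero)
      then show ?thesis unfolding modulated_sech_sq_def by (intro continuous_intros) auto
    qed
    ultimately show ?thesis
      by (simp add: set_borel_integral_eq_integral(2) borel_integrable_atLeastAtMost')
  qed
  moreover have "norm (I b c) \<le> exp (pi * \<bar>w\<bar>) / (sinh R)\<^sup>2 * pi"
  proof -
    have "norm (I b c) \<le> exp (pi * \<bar>w\<bar>) / (sinh R)\<^sup>2 * norm (c - b)"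
      unfolding I_def
    proof (rule contour_integral_bound_linepath[OF int(2)])
      fix z assume "z \<in> closed_segment b c"
      then obtain u where "0 \<le> u" "u \<le> 1" "z = (1 - u) *\<^sub>R b + u *\<^sub>R c" by (auto simp: closed_segment_def)
      then have "Re z = R" "Im z = u * pi" "0 \<le> u" "u \<le> 1"
        by (auto simp: b_def c_def left_diff_distrib)
      then show "norm (modulated_sech_sq z) \<le> exp (pi * \<bar>w\<bar>) / (sinh R)\<^sup>2" 
        using R by (intro modulated_sech_sq_vertical_bound) (auto simp: mult_left_le_one_le)
    qed auto
    also have "norm (c - b) = pi" by (simp add: b_def c_def complex_norm cmod_def)
    finally show ?thesis .
  qed
  moreover have "norm (I d a) \<le> exp (pi * \<bar>w\<bar>) / (sinh R)\<^sup>2 * pi"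
  proof -
    have "norm (I d a) \<le> exp (pi * \<bar>w\<bar>) / (sinh R)\<^sup>2 * norm (a - d)"
      unfolding I_def
    proof (rule contour_integral_bound_linepath[OF int(4)])
      fix z assume "z \<in> closed_segment d a"
      then obtain u where u: "0 \<le> u" "u \<le> 1" "z = (1 - u) *\<^sub>R d + u *\<^sub>R a" by (auto simp: closed_segment_def)
      then have "Re z = - R" "Im z = (1 - u) * pi" by (auto simp: a_def d_def left_diff_distrib)
      then show "norm (modulated_sech_sq z) \<le> exp (pi * \<bar>w\<bar>) / (sinh R)\<^sup>2" 
        using R u by (intro modulated_sech_sq_vertical_bound) (auto simp: mult_left_le_one_le)
    qed auto
    also have "norm (a - d) = pi" by (simp add: a_def d_def complex_norm cmod_def)
    finally show ?thesis .
  qed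
  ultimately have *: "2 * of_real pi * of_real w * exp (- of_real (pi * w / 2))
     - (1 - exp (- of_real (pi * w))) * (LBINT u:{-R..R}. modulated_sech_sq (of_real u)) = I b c + I d a"
    by (simp add: algebra_simps)
  have "norm (I b c + I d a) \<le> norm (I b c) + norm (I d a)" by (rule norm_triangle_ineq)
  also have "\<dots> \<le> exp (pi * \<bar>w\<bar>) / (sinh R)\<^sup>2 * pi + exp (pi * \<bar>w\<bar>) / (sinh R)\<^sup>2 * pi"
    by (rule add_mono) fact+
  finally show ?thesis unfolding * unfolding mult_2 .
qed

text \<open>
  The vertical sides of the rectangle vanish in the limit. The factor on the left is kept because it
  is \<open>0\<close> for \<open>w = 0\<close>.
\<close>

theorem fourier_transform_sech_squared:
  "(1 - exp (- of_real (pi * w))) * (LINT u|lborel. modulated_sech_sq (of_real u))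
    = 2 * of_real pi * of_real w * exp (- of_real (pi * w / 2))"
proof -
  have eq: "modulated_sech_sq (of_real u) = (1 / (cosh u)\<^sup>2) *\<^sub>R exp (\<i> * of_real (w * u))" for u
    by (simp add: modulated_sech_sq_def complex_cosh_of_real scaleR_conv_of_real field_simps)
  have norm_eq: "norm (modulated_sech_sq (of_real u)) = 1 / (cosh u)\<^sup>2" for u
    unfolding eq by (simp add: norm_exp_i_times)
  have meas: "(\<lambda>u. modulated_sech_sq (of_real u)) \<in> borel_measurable borel"
    unfolding eq
    by (intro borel_measurable_continuous_onI continuous_intros) auto
  have int: "integrable lborel (\<lambda>u. modulated_sech_sq (of_real u))"
    by (rule Bochner_Integration.integrable_bound[OF integrable_sech_squared])
       (use meas in \<open>auto simp: norm_eq\<close>)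
  define c :: complex where "c = 2 * of_real pi * of_real w * exp (- of_real (pi * w / 2))"
  define h where "h = (\<lambda>n::nat. (LBINT u:{- real n..real n}. modulated_sech_sq (of_real u)))"
  have "(\<lambda>n. LINT u|lborel. indicator {- real n..real n} u *\<^sub>R modulated_sech_sq (of_real u))
     \<longlonglongrightarrow> (LINT u|lborel. modulated_sech_sq (of_real u))"
  proof (rule integral_dominated_convergence[where w = "\<lambda>u. 1 / (cosh u)\<^sup>2"])
    show "AE u in lborel. (\<lambda>n. indicator {- real n..real n} u *\<^sub>R modulated_sech_sq (of_real u)) \<longlonglongrightarrow> modulated_sech_sq (of_real u)"
    proof (rule AE_I2)
      fix u :: real
      obtain N :: nat where "\<bar>u\<bar> \<le> real N" using real_arch_simple by blast
      then have "eventually (\<lambda>n. indicator {- real n..real n} u *\<^sub>R modulated_sech_sq (of_real u) = modulated_sech_sq (of_real u)) sequentially"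
        by (intro eventually_mono[OF eventually_ge_at_top[of N]]) (auto simp: indicator_def abs_le_iff)
      then show "(\<lambda>n. indicator {- real n..real n} u *\<^sub>R modulated_sech_sq (of_real u)) \<longlonglongrightarrow> modulated_sech_sq (of_real u)"
        by (rule tendsto_eventually)
    qed
  qed (use meas integrable_sech_squared in \<open>auto simp: norm_eq split: split_indicator\<close>)
  moreover have "(LINT u|lborel. indicator {- real n..real n} u *\<^sub>R modulated_sech_sq (of_real u)) = h n" for n
    unfolding h_def by (simp add: set_lebesgue_integral_def)
  ultimately have h: "h \<longlonglongrightarrow> (LINT u|lborel. modulated_sech_sq (of_real u))" by simp
  have "(\<lambda>n. norm (c - (1 - exp (- of_real (pi * w))) * h n)) \<longlonglongrightarrow> 0"
  proof (rule tendsto_sandwich[where f = "\<lambda>_. 0"])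
    show "eventually (\<lambda>n. norm (c - (1 - exp (- of_real (pi * w))) * h n) \<le> 2 * (exp (pi * \<bar>w\<bar>) / (sinh (real n))\<^sup>2 * pi)) sequentially"
      using eventually_gt_at_top[of 0]
    proof eventually_elim
      case (elim n)
      then show ?case using modulated_sech_sq_contour_bound[of "real n"] by (simp add: c_def h_def)
    qed
    have "filterlim (\<lambda>n. sinh (real n)) at_top sequentially"
      by (rule filterlim_compose[OF sinh_real_at_top filterlim_real_sequentially])
    then have "filterlim (\<lambda>n. (sinh (real n))\<^sup>2) at_top sequentially"
      by (intro filterlim_pow_at_top) auto
    then have "(\<lambda>n. exp (pi * \<bar>w\<bar>) / (sinh (real n))\<^sup>2) \<longlonglongrightarrow> 0"
      by (intro tendsto_divide_0[OF tendsto_const] filterlim_at_top_imp_at_infinity)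
    then have "(\<lambda>n. 2 * (exp (pi * \<bar>w\<bar>) / (sinh (real n))\<^sup>2 * pi)) \<longlonglongrightarrow> 2 * (0 * pi)"
      by (intro tendsto_intros)
    then show "(\<lambda>n. 2 * (exp (pi * \<bar>w\<bar>) / (sinh (real n))\<^sup>2 * pi)) \<longlonglongrightarrow> 0" by simp
  qed auto
  moreover have "(\<lambda>n. norm (c - (1 - exp (- of_real (pi * w))) * h n))
     \<longlonglongrightarrow> norm (c - (1 - exp (- of_real (pi * w))) * (LINT u|lborel. modulated_sech_sq (of_real u)))"
    by (intro tendsto_intros h)
  ultimately show ?thesis unfolding c_def using LIMSEQ_unique by fastforce
qed

end

lemma sech_squared_fourier:
  assumes w: "w \<noteq> 0"
  shows "(LINT u|lborel. (1 / (cosh u)\<^sup>2) *\<^sub>R cis (w * u)) = of_real (pi * w / sinh (pi * w / 2))"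
proof -
  have eq: "(1 / (cosh u)\<^sup>2) *\<^sub>R cis (w * u) = modulated_sech_sq w (of_real u)" for u
    by (simp add: modulated_sech_sq_def complex_cosh_of_real scaleR_conv_of_real cis_conv_exp field_simps)
  define q where "q = exp (- (pi * w / 2))"
  have q: "q > 0" "q \<noteq> 1" using w by (auto simp: q_def)
  have q2: "exp (- (pi * w)) = q\<^sup>2" by (simp add: q_def power2_eq_square flip: exp_add)
  have nz: "1 - q\<^sup>2 \<noteq> 0" using q by (auto simp: power2_eq_1_iff)
  have "complex_of_real (1 - q\<^sup>2) * (LINT u|lborel. modulated_sech_sq w (of_real u)) = of_real (2 * pi * w * q)"
  proof -
    have e: "exp (- complex_of_real (pi * w)) = of_real (q\<^sup>2)" "exp (- complex_of_real (pi * w / 2)) = of_real q"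
      by (simp_all only: q2[symmetric] of_real_minus[symmetric] exp_of_real) (simp add: q_def)
    show ?thesis using fourier_transform_sech_squared[of w] unfolding e by simp
  qed
  then have "(LINT u|lborel. modulated_sech_sq w (of_real u)) = of_real (2 * pi * w * q / (1 - q\<^sup>2))"
    unfolding of_real_divide using nz
    by (intro eq_divide_imp) (simp_all only: of_real_eq_0_iff mult.commute not_False_eq_True)
  also have "2 * pi * w * q / (1 - q\<^sup>2) = pi * w / sinh (pi * w / 2)"
  proof -
    have "sinh (pi * w / 2) = (1 / q - q) / 2" by (simp add: sinh_field_def q_def exp_minus field_simps)
    also have "\<dots> = (1 - q\<^sup>2) / (2 * q)" using q by (simp add: field_simps power2_eq_square)
    finally have sh: "sinh (pi * w / 2) = (1 - q\<^sup>2) / (2 * q)" .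
    show ?thesis unfolding sh using q nz by (simp add: field_simps)
  qed
  finally show ?thesis by (simp add: eq)
qed

section \<open>Sums over the integers and Fourier series\<close>

lemma has_sum_int_even:
  fixes h :: "int \<Rightarrow> real"
  assumes "summable (\<lambda>m. norm (h (int (Suc m))))" and even: "\<And>k. h (- k) = h k"
  shows "(h has_sum (h 0 + 2 * (\<Sum>m. h (int (Suc m))))) UNIV"
proof -
  define p q where "p = (\<lambda>m. int (Suc m))" and "q = (\<lambda>m. - int (Suc m))"
  have inj: "inj p" "inj q" by (auto simp: p_def q_def inj_def)
  have nat: "((\<lambda>m. h (int (Suc m))) has_sum (\<Sum>m. h (int (Suc m)))) UNIV"
    using norm_summable_imp_has_sum[OF assms(1)] summable_norm_cancel[OF assms(1)] by (simp add: summable_sums)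
  have "(h has_sum (\<Sum>m. h (int (Suc m)))) (range p)"
    using nat has_sum_reindex[OF inj(1), of h] by (simp add: o_def p_def)
  moreover have "(h has_sum (\<Sum>m. h (int (Suc m)))) (range q)"
  proof -
    have "h (q m) = h (int (Suc m))" for m unfolding q_def by (rule even)
    then show ?thesis using nat has_sum_reindex[OF inj(2), of h] by (simp add: o_def)
  qed
  moreover have "(h has_sum h 0) {0}" using has_sum_finite[of "{0}" h] by simp
  moreover have "range p \<inter> range q = {}" "{0} \<inter> (range p \<union> range q) = {}" by (auto simp: p_def q_def)
  ultimately have "(h has_sum (h 0 + ((\<Sum>m. h (int (Suc m))) + (\<Sum>m. h (int (Suc m)))))) ({0} \<union> (range p \<union> range q))"
    by (intro has_sum_Un_disjoint)
  moreover have "{0} \<union> (range p \<union> range q) = UNIV"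
  proof -
    have "k \<in> {0} \<union> (range p \<union> range q)" for k
    proof -
      have "k = p (nat k - 1)" if "k > 0" using that by (simp add: p_def)
      moreover have "k = q (nat (- k) - 1)" if "k < 0" using that by (simp add: q_def)
      ultimately show ?thesis by (cases k "0 :: int" rule: linorder_cases) blast+
    qed
    then show ?thesis by auto
  qed
  ultimately show ?thesis by (simp only: mult_2)
qed

lemma has_sum_int_imp_symmetric_limit:
  fixes h :: "int \<Rightarrow> 'a::topological_comm_monoid_add"
  assumes "(h has_sum S) UNIV"
  shows "(\<lambda>N. \<Sum>k\<in>{- int N..int N}. h k) \<longlonglongrightarrow> S"
proof -
  have "filterlim (\<lambda>N. {- int N..int N}) (finite_subsets_at_top UNIV) sequentially"
    unfolding filterlim_finite_subsets_at_top
  proof (intro allI impI)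
    fix X :: "int set" assume "finite X \<and> X \<subseteq> UNIV"
    then have M: "\<bar>k\<bar> \<le> Max (abs ` X)" if "k \<in> X" for k using that by simp
    show "\<forall>\<^sub>F y in sequentially. finite {- int y..int y} \<and> X \<subseteq> {- int y..int y} \<and> {- int y..int y} \<subseteq> UNIV"
      by (rule eventually_mono[OF eventually_ge_at_top[of "nat (Max (abs ` X))"]]) (use M in \<open>force simp: abs_le_iff nat_le_iff\<close>)
  qed
  with assms show ?thesis unfolding has_sum_def by (rule filterlim_compose)
qed

lemma summable_on_int_geometric:
  fixes r :: real
  assumes "0 \<le> r" "r < 1"
  shows "(\<lambda>k::int. r ^ nat \<bar>k\<bar>) summable_on UNIV"
proof -
  have "summable (\<lambda>m. norm (r ^ nat \<bar>int (Suc m)\<bar>))"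
    using assms summable_mult[OF summable_geometric[of r], of r] by (simp add: nat_add_distrib)
  then have "((\<lambda>k::int. r ^ nat \<bar>k\<bar>) has_sum (r ^ nat \<bar>0\<bar> + 2 * (\<Sum>m. r ^ nat \<bar>int (Suc m)\<bar>))) UNIV"
    by (intro has_sum_int_even) auto
  then show ?thesis by (rule has_sum_imp_summable)
qed

text \<open>
  Cutting the line into unit intervals. The infinite sums of this development are all reached
  from finite index sets \<open>J\<close> by dominated convergence.
\<close>

lemma integral_finite_periodization:
  fixes \<phi> :: "real \<Rightarrow> 'a::{banach, second_countable_topology}"
  assumes int: "integrable lborel \<phi>" and J: "finite J"
  shows "(LINT t|torus. (\<Sum>k\<in>J. \<phi> (t + of_int k))) = (LINT t|lborel. indicator {t. \<lfloor>t\<rfloor> \<in> J} t *\<^sub>R \<phi> t)"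
    and "k \<in> J \<Longrightarrow> integrable torus (\<lambda>t. \<phi> (t + of_int k))"
proof -
  have [measurable]: "\<phi> \<in> borel_measurable borel" using int by auto
  have ind: "indicator {0..<1} (t - of_int k) = (indicator {t. \<lfloor>t\<rfloor> = k} t :: real)" for t and k :: int
    by (auto simp: indicator_def floor_eq_iff)
  have intk: "integrable lborel (\<lambda>t. indicator {t. \<lfloor>t\<rfloor> = k} t *\<^sub>R \<phi> t)" for k
    by (rule integrable_mult_indicator[OF _ int]) simp
  have i: "integrable torus (\<lambda>t. \<phi> (t + of_int k))"
    and v: "(LINT t|torus. \<phi> (t + of_int k)) = (LINT t|lborel. indicator {t. \<lfloor>t\<rfloor> = k} t *\<^sub>R \<phi> t)" for k
  proof -
    let ?f = "\<lambda>t. indicator {t. \<lfloor>t\<rfloor> = k} t *\<^sub>R \<phi> t"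
    have eq: "?f (of_int k + 1 * t) = indicator {0..<1} t *\<^sub>R \<phi> (t + of_int k)" for t
      using ind[of "t + of_int k" k] by (simp add: add.commute)
    show "integrable torus (\<lambda>t. \<phi> (t + of_int k))"
      using lborel_integrable_real_affine[OF intk[of k], where c = 1 and t = "of_int k"] unfolding eq
      by (subst integrable_torus_iff) auto
    show "(LINT t|torus. \<phi> (t + of_int k)) = (LINT t|lborel. ?f t)"
      using lborel_integral_real_affine[of 1 ?f "of_int k"] unfolding eq
      by (subst integral_torus) auto
  qed
  show "k \<in> J \<Longrightarrow> integrable torus (\<lambda>t. \<phi> (t + of_int k))" by (rule i)
  have "(LINT t|torus. (\<Sum>k\<in>J. \<phi> (t + of_int k))) = (\<Sum>k\<in>J. (LINT t|lborel. indicator {t. \<lfloor>t\<rfloor> = k} t *\<^sub>R \<phi> t))"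
    using i v by (subst Bochner_Integration.integral_sum) auto
  also have "\<dots> = (LINT t|lborel. (\<Sum>k\<in>J. indicator {t. \<lfloor>t\<rfloor> = k} t *\<^sub>R \<phi> t))"
    using intk by (subst Bochner_Integration.integral_sum) auto
  also have "\<dots> = (LINT t|lborel. indicator {t. \<lfloor>t\<rfloor> \<in> J} t *\<^sub>R \<phi> t)"
  proof (rule Bochner_Integration.integral_cong[OF refl])
    fix t
    have "(\<Sum>k\<in>J. indicator {t. \<lfloor>t\<rfloor> = k} t *\<^sub>R \<phi> t) = (\<Sum>k\<in>J. if k = \<lfloor>t\<rfloor> then \<phi> t else 0)"
      by (intro sum.cong) (auto simp: indicator_def)
    then show "(\<Sum>k\<in>J. indicator {t. \<lfloor>t\<rfloor> = k} t *\<^sub>R \<phi> t) = indicator {t. \<lfloor>t\<rfloor> \<in> J} t *\<^sub>R \<phi> t"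
      using J by (simp add: indicator_def)
  qed
  finally show "(LINT t|torus. (\<Sum>k\<in>J. \<phi> (t + of_int k))) = (LINT t|lborel. indicator {t. \<lfloor>t\<rfloor> \<in> J} t *\<^sub>R \<phi> t)" .
qed

lemma fourier_coeff_has_sum:
  fixes c :: "int \<Rightarrow> complex"
  assumes summ: "(\<lambda>k. norm (c k)) summable_on UNIV"
    and F: "\<And>t. ((\<lambda>k. c k * fourier_mode k t) has_sum F t) UNIV"
  shows "fourier_coeff F l = c l"
proof -
  define S where "S = (\<lambda>N t. \<Sum>k\<in>{- int N..int N}. c k * fourier_mode k t)"
  have S: "(\<lambda>N. S N t) \<longlonglongrightarrow> F t" for t
    unfolding S_def by (rule has_sum_int_imp_symmetric_limit[OF F])
  have [measurable]: "S N \<in> borel_measurable borel" for N by (simp add: S_def)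
  have [measurable]: "F \<in> borel_measurable borel"
    by (rule borel_measurable_LIMSEQ_metric[OF _ S]) auto
  have bound: "norm (S N t) \<le> (\<Sum>\<^sub>\<infinity>k. norm (c k))" for N t
  proof -
    have "norm (S N t) \<le> (\<Sum>k\<in>{- int N..int N}. norm (c k))"
      unfolding S_def by (rule order_trans[OF norm_sum]) (simp add: norm_mult)
    also have "\<dots> \<le> (\<Sum>\<^sub>\<infinity>k. norm (c k))" by (rule finite_sum_le_infsum[OF summ]) auto
    finally show ?thesis .
  qed
  have "(\<lambda>N. LINT t|torus. S N t * fourier_mode (- l) t) \<longlonglongrightarrow> fourier_coeff F l"
    unfolding fourier_coeff_def
    by (rule integral_dominated_convergence[where w = "\<lambda>_. \<Sum>\<^sub>\<infinity>k. norm (c k)"])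
       (auto simp: norm_mult intro!: AE_I2 tendsto_mult S bound)
  moreover have "eventually (\<lambda>N. (LINT t|torus. S N t * fourier_mode (- l) t) = c l) sequentially"
    using eventually_ge_at_top[of "nat \<bar>l\<bar>"]
  proof eventually_elim
    case (elim N)
    have "(LINT t|torus. S N t * fourier_mode (- l) t) = (LINT t|torus. (\<Sum>k\<in>{- int N..int N}. c k * fourier_mode (k - l) t))"
      unfolding S_def sum_distrib_right mult.assoc fourier_mode_mult by simp
    also have "\<dots> = (\<Sum>k\<in>{- int N..int N}. c k * (if k = l then 1 else 0))"
      by (subst Bochner_Integration.integral_sum)
         (auto simp: integral_fourier_mode intro!: sum.cong integrable_mult_right integrable_torus_bounded[where B = 1])
    also have "\<dots> = c l"
    proof -
      have "l \<in> {- int N..int N}" using elim by auto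
      then show ?thesis by (simp add: if_distrib cong: if_cong)
    qed
    finally show ?case .
  qed
  then have "(\<lambda>N. LINT t|torus. S N t * fourier_mode (- l) t) \<longlonglongrightarrow> c l"
    by (rule tendsto_eventually)
  ultimately show ?thesis by (rule LIMSEQ_unique)
qed

text \<open>
  Uniqueness of Fourier coefficients, from Parseval's identity and continuity.
\<close>

lemma continuous_fourier_coeff_eq_0:
  assumes cont: "continuous_on UNIV F" and zero: "\<And>l. fourier_coeff F l = 0" and t: "t \<in> {0..1}"
  shows "F t = 0"
proof -
  have [measurable]: "F \<in> borel_measurable borel" by (rule borel_measurable_continuous_onI[OF cont])
  have cont': "continuous_on {0..1} (\<lambda>t. (norm (F t))\<^sup>2)"
    by (intro continuous_intros continuous_on_subset[OF cont]) auto
  have si: "set_integrable lborel {0..1} (\<lambda>t. (norm (F t))\<^sup>2)"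
    by (rule borel_integrable_atLeastAtMost'[OF cont'])
  have int: "integrable torus (\<lambda>t. (norm (F t))\<^sup>2)"
  proof (subst integrable_torus_iff)
    show "integrable lborel (\<lambda>t. indicator {0..<1} t *\<^sub>R (norm (F t))\<^sup>2)"
    proof -
      have "{0..<1} \<subseteq> {0..1::real}" by auto
      then show ?thesis using set_integrable_subset[OF si, of "{0..<1}"] by (simp add: set_integrable_def)
    qed
  qed simp
  have fin: "(\<integral>\<^sup>+t. ennreal ((norm (F t))\<^sup>2) \<partial>torus) < \<infinity>"
    using int by (simp add: integrable_iff_bounded)
  have "(LINT t|torus. (norm (F t))\<^sup>2) = 0"
  proof -
    have "((\<lambda>l::int. 0) has_sum (LINT t|torus. (norm (F t))\<^sup>2)) UNIV"
      using parseval[OF _ fin] by (simp add: zero)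
    then show ?thesis by (rule has_sum_unique[OF _ has_sum_0_simp])
  qed
  moreover have "(LINT t|torus. (norm (F t))\<^sup>2) = (LBINT t:{0..1}. (norm (F t))\<^sup>2)"
  proof -
    have "(LINT t|torus. (norm (F t))\<^sup>2) = (LINT t|lborel. indicator {0..<1} t *\<^sub>R (norm (F t))\<^sup>2)"
      by (rule integral_torus) simp
    also have "\<dots> = (LBINT t:{0..1}. (norm (F t))\<^sup>2)"
      unfolding set_lebesgue_integral_def
      by (intro integral_cong_AE) (auto intro!: AE_I[where N="{1}"] split: split_indicator)
    finally show ?thesis .
  qed
  ultimately have "((\<lambda>t. (norm (F t))\<^sup>2) has_integral 0) (cbox 0 1)"
    using set_borel_integral_eq_integral[OF si] by (simp add: has_integral_iff)
  then have "(norm (F t))\<^sup>2 = 0"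
    by (rule has_integral_0_cbox_imp_0[rotated 2]) (use cont' t in auto)
  then show ?thesis by simp
qed

lemma surj_uminus_int: "range (uminus :: int \<Rightarrow> int) = UNIV"
  by (rule surjI[of _ uminus]) simp

section \<open>The symbol\<close>

text \<open>
  The continuous extension of \<open>x / sinh x\<close>. The value at \<open>0\<close> lets one formula
  cover all integers in the series below.
\<close>

definition xsinh :: "real \<Rightarrow> real" where
  "xsinh x = (if x = 0 then 1 else x / sinh x)"

lemma xsinh_0 [simp]: "xsinh 0 = 1" by (simp add: xsinh_def)
lemma xsinh_minus [simp]: "xsinh (- x) = xsinh x" by (simp add: xsinh_def)

lemma xsinh_pos: "xsinh x > 0"
  unfolding xsinh_def by (cases x "0 :: real" rule: linorder_cases) (auto intro: divide_pos_pos divide_neg_neg)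

text \<open>
  From \<open>sinh((m+1)x) \<ge> exp(mx) sinh x\<close>.
\<close>

lemma xsinh_multiple_le:
  assumes "x > 0"
  shows "xsinh (real (Suc m) * x) \<le> real (Suc m) * xsinh x * exp (- x) ^ m"
proof -
  have s: "sinh x > 0" using assms by simp
  have "exp (real m * x) * sinh x \<le> sinh (real (Suc m) * x)"
  proof -
    have "exp (real m * x) * sinh x = (exp (real (Suc m) * x) - exp ((real m - 1) * x)) / 2"
      by (simp add: sinh_field_def right_diff_distrib algebra_simps flip: exp_add)
    also have "\<dots> \<le> (exp (real (Suc m) * x) - exp (- (real (Suc m) * x))) / 2"
    proof -
      have "- (real (Suc m) * x) \<le> (real m - 1) * x" using assms by (simp add: algebra_simps)
      then show ?thesis by simp
    qed
    finally show ?thesis by (simp add: sinh_field_def)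
  qed
  then have "real (Suc m) * x / sinh (real (Suc m) * x) \<le> real (Suc m) * x / (exp (real m * x) * sinh x)"
    using assms s by (intro divide_left_mono mult_pos_pos) auto
  also have "\<dots> = real (Suc m) * xsinh x * exp (- x) ^ m"
    using assms by (simp add: xsinh_def exp_minus power_inverse field_simps flip: exp_of_nat_mult)
  finally show ?thesis using assms by (simp add: xsinh_def)
qed

lemma summable_xsinh:
  assumes "x > 0"
  shows "summable (\<lambda>m. xsinh (real (Suc m) * x))"
proof (rule summable_comparison_test')
  have "summable (\<lambda>m. real (Suc m) * exp (- x) ^ m)"
    using geometric_deriv_sums[of "exp (- x)"] assms by (auto simp: sums_iff)
  then show "summable (\<lambda>m. xsinh x * (real (Suc m) * exp (- x) ^ m))" by (rule summable_mult)
  show "norm (xsinh (real (Suc m) * x)) \<le> xsinh x * (real (Suc m) * exp (- x) ^ m)" for m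
    using xsinh_multiple_le[OF assms, of m] xsinh_pos[of "real (Suc m) * x"] by (simp add: mult_ac)
qed

lemma xsinh_summable_on_int:
  assumes "x > 0"
  shows "(\<lambda>k::int. xsinh (of_int k * x)) summable_on UNIV"
  by (rule has_sum_imp_summable[OF has_sum_int_even])
     (use summable_xsinh[OF assms] xsinh_pos in \<open>auto simp: abs_of_pos\<close>)

lemma xsinh_abs_summable_on_int:
  "x > 0 \<Longrightarrow> (\<lambda>k::int. norm (xsinh (of_int k * x))) summable_on UNIV"
  using xsinh_summable_on_int[of x] xsinh_pos by (simp add: abs_of_pos)

text \<open>
  The Fourier series with coefficients \<open>kx / sinh(kx)\<close>, written \<open>\<sigma>\<^sub>x(\<theta>)\<close> in
  the comments. By Poisson summation it is a periodized squared hyperbolic secant, an elliptic function of \<open>\<theta>\<close>.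
\<close>

definition sech_symbol :: "real \<Rightarrow> real \<Rightarrow> real" where
  "sech_symbol x \<theta> = (\<Sum>\<^sub>\<infinity>k::int. xsinh (of_int k * x) * cos (2 * pi * of_int k * \<theta>))"

lemma sech_symbol_has_sum:
  assumes "x > 0"
  shows "((\<lambda>k::int. xsinh (of_int k * x) * cos (2 * pi * of_int k * \<theta>)) has_sum sech_symbol x \<theta>) UNIV"
  unfolding sech_symbol_def
proof (rule has_sum_infsum, rule abs_summable_summable,
       rule Infinite_Sum.abs_summable_on_comparison_test[OF xsinh_abs_summable_on_int[OF assms]])
  fix k :: int
  show "norm (xsinh (of_int k * x) * cos (2 * pi * of_int k * \<theta>)) \<le> norm (xsinh (of_int k * x))"
    by (simp add: abs_mult mult_left_le)
qed

text \<open>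
  The coefficients are even in \<open>k\<close>, so the sine parts cancel.
\<close>

lemma sech_symbol_has_sum_modes:
  assumes "x > 0"
  shows "((\<lambda>k::int. of_real (xsinh (of_int k * x)) * fourier_mode k \<theta>) has_sum of_real (sech_symbol x \<theta>)) UNIV"
proof -
  let ?h = "\<lambda>k::int. of_real (xsinh (of_int k * x)) * fourier_mode k \<theta>"
  have "?h summable_on UNIV"
    by (rule abs_summable_summable, rule Infinite_Sum.abs_summable_on_comparison_test[OF xsinh_abs_summable_on_int[OF assms]])
       (use xsinh_pos in \<open>auto simp: norm_mult abs_of_pos\<close>)
  then obtain S where S: "(?h has_sum S) UNIV" by (auto simp: summable_on_def)
  have "((\<lambda>k. Re (?h k)) has_sum Re S) UNIV" by (rule has_sum_Re[OF S])
  then have "Re S = sech_symbol x \<theta>"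
    using sech_symbol_has_sum[OF assms] by (simp add: fourier_mode_def has_sum_unique)
  moreover have "cnj S = S"
  proof -
    have "inj (uminus :: int \<Rightarrow> int)" by simp
    from has_sum_reindex[OF this, of ?h S] have r: "((\<lambda>k. ?h (- k)) has_sum S) UNIV"
      using S by (simp only: o_def surj_uminus_int)
    have "((\<lambda>k. cnj (?h (- k))) has_sum cnj S) UNIV"
      using r by (simp only: has_sum_cnj_iff)
    moreover have "cnj (?h (- k)) = ?h k" for k by (simp add: cnj_fourier_mode)
    ultimately have "(?h has_sum cnj S) UNIV" by (simp only:)
    then show ?thesis using S by (rule has_sum_unique)
  qed
  then have "Im S = 0" by (simp add: complex_eq_iff)
  ultimately have "S = of_real (sech_symbol x \<theta>)" by (simp add: complex_eq_iff)
  then show ?thesis using S by simp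
qed

lemma fourier_coeff_sech_symbol:
  assumes "x > 0"
  shows "fourier_coeff (\<lambda>\<theta>. of_real (sech_symbol x \<theta>)) l = of_real (xsinh (of_int l * x))"
proof (rule fourier_coeff_has_sum)
  show "(\<lambda>k::int. norm (complex_of_real (xsinh (of_int k * x)))) summable_on UNIV"
    using xsinh_summable_on_int[OF assms] xsinh_pos by (simp add: abs_of_pos)
qed (rule sech_symbol_has_sum_modes[OF assms])

lemma continuous_sech_symbol:
  assumes "x > 0"
  shows "continuous_on UNIV (sech_symbol x)"
proof (rule uniform_limit_theorem)
  show "uniform_limit UNIV (\<lambda>X \<theta>. \<Sum>k\<in>X. xsinh (of_int k * x) * cos (2 * pi * of_int k * \<theta>)) (sech_symbol x) (finite_subsets_at_top UNIV)"
  proof (rule Weierstrass_m_test_general'[where M = "\<lambda>k::int. xsinh (of_int k * x)"])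
    fix k :: int and \<theta>
    show "norm (xsinh (of_int k * x) * cos (2 * pi * of_int k * \<theta>)) \<le> xsinh (of_int k * x)"
      using xsinh_pos[of "of_int k * x"] by (simp add: abs_mult mult_left_le)
  qed (rule sech_symbol_has_sum[OF assms] xsinh_summable_on_int[OF assms])+
  show "\<forall>\<^sub>F X in finite_subsets_at_top UNIV. continuous_on UNIV
      (\<lambda>\<theta>. \<Sum>k\<in>X. xsinh (of_int k * x) * cos (2 * pi * of_int k * \<theta>))"
    by (intro always_eventually allI continuous_intros)
qed (rule finite_subsets_at_top_neq_bot)

section \<open>Poisson summation for the squared hyperbolic secant\<close>

lemma inverse_cosh_square_le: "1 / (cosh u)\<^sup>2 \<le> 4 * exp (- 2 * \<bar>u\<bar>)" for u :: real
proof -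
  have "exp \<bar>u\<bar> / 2 \<le> cosh u"
    by (cases "u \<ge> 0") (auto simp: cosh_field_def)
  then have "(exp \<bar>u\<bar> / 2)\<^sup>2 \<le> (cosh u)\<^sup>2" by (intro power_mono) auto
  then have "1 / (cosh u)\<^sup>2 \<le> 1 / (exp \<bar>u\<bar> / 2)\<^sup>2" by (intro divide_left_mono mult_pos_pos zero_less_power) auto
  also have "\<dots> = 4 * exp (- 2 * \<bar>u\<bar>)"
    by (simp add: power_divide exp_minus field_simps flip: exp_double)
  finally show ?thesis .
qed

lemma sech_symbol_periodic: "sech_symbol x (\<theta> + of_int j) = sech_symbol x \<theta>"
proof -
  have "cos (2 * pi * of_int k * (\<theta> + of_int j)) = cos (2 * pi * of_int k * \<theta>)" for k :: int
  proof -
    have "2 * pi * of_int k * (\<theta> + of_int j) = 2 * pi * of_int k * \<theta> + 2 * pi * of_int (k * j)" by (simp add: algebra_simps)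
    then show ?thesis by (simp only: cos_add cos_int_2pin sin_int_2pin mult_1_right mult_zero_right diff_zero)
  qed
  then show ?thesis by (simp add: sech_symbol_def)
qed

context
  fixes y :: real
  assumes y: "y > 0"
begin

definition sech_bump :: "real \<Rightarrow> real" where
  "sech_bump t = y / 2 / (cosh (y * t))\<^sup>2"

lemma continuous_sech_bump [continuous_intros]: "continuous_on A f \<Longrightarrow> continuous_on A (\<lambda>t. sech_bump (f t))"
  unfolding sech_bump_def by (intro continuous_intros) auto

lemma measurable_sech_bump [measurable]: "sech_bump \<in> borel_measurable borel"
  by (intro borel_measurable_continuous_onI continuous_sech_bump continuous_on_id)

lemma sech_bump_bound:
  assumes "\<bar>t\<bar> \<le> R"
  shows "norm (sech_bump (t + of_int k)) \<le> 2 * y * exp (2 * y * R) * exp (- 2 * y) ^ nat \<bar>k\<bar>"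
proof -
  have "norm (sech_bump (t + of_int k)) = y / 2 * (1 / (cosh (y * (t + of_int k)))\<^sup>2)" 
    using y by (simp add: sech_bump_def)
  also have "\<dots> \<le> y / 2 * (4 * exp (- 2 * \<bar>y * (t + of_int k)\<bar>))"
    using y by (intro mult_left_mono inverse_cosh_square_le) auto
  also have "\<dots> \<le> y / 2 * (4 * exp (2 * y * R - 2 * y * \<bar>of_int k\<bar>))"
  proof -
    have "\<bar>of_int k\<bar> - R \<le> \<bar>t + of_int k\<bar>" using assms by linarith
    then have "y * (\<bar>of_int k\<bar> - R) \<le> y * \<bar>t + of_int k\<bar>" using y by (intro mult_left_mono) auto
    moreover have "\<bar>y * (t + of_int k)\<bar> = y * \<bar>t + of_int k\<bar>" using y by (simp only: abs_mult abs_of_pos)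
    moreover have "y * (\<bar>of_int k\<bar> - R) = y * \<bar>of_int k\<bar> - y * R" by (rule right_diff_distrib)
    ultimately have "- 2 * \<bar>y * (t + of_int k)\<bar> \<le> 2 * y * R - 2 * y * \<bar>of_int k\<bar>" by linarith
    then show ?thesis using y by (intro mult_left_mono) auto
  qed
  also have "\<dots> = 2 * y * exp (2 * y * R) * exp (- 2 * y) ^ nat \<bar>k\<bar>"
  proof -
    have "exp (2 * y * R - 2 * y * \<bar>of_int k\<bar>) = exp (2 * y * R) * exp (real (nat \<bar>k\<bar>) * (- 2 * y))"
      by (subst exp_add[symmetric], rule arg_cong[of _ _ exp]) (simp add: algebra_simps)
    moreover have "y / 2 * (4 * (E * Q)) = 2 * y * E * Q" for E Q :: real by simp
    ultimately show ?thesis by (simp only: exp_of_nat_mult)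
  qed
  finally show ?thesis .
qed

lemma sech_bump_bound_summable:
  "(\<lambda>k::int. 2 * y * exp (2 * y * R) * exp (- 2 * y) ^ nat \<bar>k\<bar>) summable_on UNIV"
  by (intro summable_on_cmult_right summable_on_int_geometric) (use y in auto)

text \<open>
  The norm bound above is locally uniform in \<open>t\<close> and summable in \<open>k\<close>; the periodization is
  therefore continuous, which turns equality of Fourier coefficients into equality at every point.
\<close>

definition sech_periodization :: "real \<Rightarrow> real" where
  "sech_periodization t = (\<Sum>\<^sub>\<infinity>k::int. sech_bump (t + of_int k))"

lemma sech_periodization_has_sum: "((\<lambda>k::int. sech_bump (t + of_int k)) has_sum sech_periodization t) UNIV"
  unfolding sech_periodization_def
  by (rule has_sum_infsum, rule abs_summable_summable,
      rule Infinite_Sum.abs_summable_on_comparison_test'[OF sech_bump_bound_summable[of "\<bar>t\<bar>"] sech_bump_bound]) auto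

lemma continuous_sech_periodization: "continuous_on UNIV sech_periodization"
proof (rule continuous_at_imp_continuous_on, rule ballI)
  fix t :: real
  define R where "R = \<bar>t\<bar> + 1"
  have "continuous_on {-R..R} sech_periodization"
  proof (rule uniform_limit_theorem)
    show "uniform_limit {-R..R} (\<lambda>X t. \<Sum>k\<in>X. sech_bump (t + of_int k)) sech_periodization (finite_subsets_at_top UNIV)"
      by (rule Weierstrass_m_test_general'[OF sech_bump_bound[where R = R] sech_periodization_has_sum sech_bump_bound_summable]) auto
    show "\<forall>\<^sub>F X in finite_subsets_at_top UNIV. continuous_on {-R..R} (\<lambda>t. \<Sum>k\<in>X. sech_bump (t + of_int k))"
      by (intro always_eventually allI continuous_intros)
  qed (rule finite_subsets_at_top_neq_bot)
  moreover have "t \<in> interior {-R..R}" by (auto simp: R_def)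
  ultimately show "isCont sech_periodization t" by (rule continuous_on_interior)
qed

lemma sech_periodization_shift: "sech_periodization (t + of_int j) = sech_periodization t"
proof -
  have "bij (\<lambda>k::int. j + k)" by (rule bij_plus)
  from has_sum_reindex_bij_betw[OF this, of "\<lambda>k. sech_bump (t + of_int k)" "sech_periodization t"]
  have "((\<lambda>k::int. sech_bump (t + of_int (j + k))) has_sum sech_periodization t) UNIV"
    using sech_periodization_has_sum[of t] by simp
  moreover have "((\<lambda>k::int. sech_bump (t + of_int (j + k))) has_sum sech_periodization (t + of_int j)) UNIV"
    using sech_periodization_has_sum[of "t + of_int j"] by (simp add: add.assoc)
  ultimately show ?thesis by (rule has_sum_unique[THEN sym])
qed

lemma integrable_sech_bump: "integrable lborel sech_bump"
proof -
  have "integrable lborel (\<lambda>t. 1 / (cosh (0 + y * t))\<^sup>2)"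
    by (rule lborel_integrable_real_affine[OF integrable_sech_squared]) (use y in auto)
  then have "integrable lborel (\<lambda>t. y / 2 * (1 / (cosh (0 + y * t))\<^sup>2))" by (rule integrable_mult_right)
  then show ?thesis by (simp add: sech_bump_def[abs_def])
qed

lemma integral_sech_bump_mode:
  "(LINT t|lborel. of_real (sech_bump t) * fourier_mode (- l) t) = of_real (xsinh (of_int l * (pi\<^sup>2 / y)))"
proof -
  define w where "w = - 2 * pi * of_int l / y"
  define f where "f = (\<lambda>u::real. (1 / (cosh u)\<^sup>2) *\<^sub>R cis (w * u))"
  have "(LINT u|lborel. f u) = \<bar>y\<bar> *\<^sub>R (LINT t|lborel. f (0 + y * t))"
    using y by (intro lborel_integral_real_affine) auto
  then have f: "of_real y * (LINT t|lborel. f (y * t)) = (LINT u|lborel. f u)"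
    using y by (simp add: scaleR_conv_of_real)
  have "of_real (sech_bump t) * fourier_mode (- l) t = of_real (y / 2) * f (y * t)" for t
  proof -
    have "w * (y * t) = 2 * pi * of_int (- l) * t" using y by (simp add: w_def field_simps)
    then show ?thesis by (simp add: f_def sech_bump_def fourier_mode_def scaleR_conv_of_real)
  qed
  then have "(LINT t|lborel. of_real (sech_bump t) * fourier_mode (- l) t) = of_real (y / 2) * (LINT t|lborel. f (y * t))"
    by (simp only: integral_mult_right_zero)
  also have "\<dots> = (LINT u|lborel. f u) / 2" using f by simp
  also have "\<dots> = of_real (xsinh (of_int l * (pi\<^sup>2 / y)))"
  proof (cases "l = 0")
    case True
    then have "(LINT u|lborel. f u) = (LINT u|lborel. complex_of_real (1 / (cosh u)\<^sup>2))"
      by (simp add: f_def w_def scaleR_conv_of_real)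
    also have "\<dots> = 2" unfolding integral_complex_of_real integral_sech_squared by simp
    finally show ?thesis using True by simp
  next
    case False
    then have "w \<noteq> 0" using y by (simp add: w_def)
    then have "(LINT u|lborel. f u) = of_real (pi * w / sinh (pi * w / 2))" unfolding f_def by (rule sech_squared_fourier)
    moreover have "pi * w / 2 = - (of_int l * (pi\<^sup>2 / y))" by (simp add: w_def power2_eq_square)
    ultimately have "(LINT u|lborel. f u) / 2 = of_real (- (of_int l * (pi\<^sup>2 / y)) / sinh (- (of_int l * (pi\<^sup>2 / y))))"
      by (metis (no_types, lifting) divide_divide_eq_left mult.commute of_real_divide of_real_numeral times_divide_eq_left)
    then show ?thesis using False y by (simp add: xsinh_def)
  qed
  finally show ?thesis .
qed

lemma fourier_coeff_sech_periodization:
  "fourier_coeff (\<lambda>t. of_real (sech_periodization t)) l = of_real (xsinh (of_int l * (pi\<^sup>2 / y)))"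
proof -
  define S where "S = (\<lambda>N t. complex_of_real (\<Sum>k\<in>{- int N..int N}. sech_bump (t + of_int k)))"
  define g where "g = (\<lambda>t. of_real (sech_bump t) * fourier_mode (- l) t)"
  have [measurable]: "S N \<in> borel_measurable borel" for N unfolding S_def by measurable
  have [measurable]: "g \<in> borel_measurable borel" unfolding g_def by measurable
  have [measurable]: "sech_periodization \<in> borel_measurable borel"
    by (rule borel_measurable_continuous_onI[OF continuous_sech_periodization])
  have intg: "integrable lborel g"
    by (rule Bochner_Integration.integrable_bound[OF integrable_sech_bump]) (auto simp: g_def norm_mult)
  have "(\<lambda>N. LINT t|torus. S N t * fourier_mode (- l) t) \<longlonglongrightarrow> fourier_coeff (\<lambda>t. of_real (sech_periodization t)) l"
    unfolding fourier_coeff_def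
  proof (rule integral_dominated_convergence[where w = "\<lambda>_. \<Sum>\<^sub>\<infinity>k::int. 2 * y * exp (2 * y * 1) * exp (- 2 * y) ^ nat \<bar>k\<bar>"])
    show "AE t in torus. (\<lambda>N. S N t * fourier_mode (- l) t) \<longlonglongrightarrow> of_real (sech_periodization t) * fourier_mode (- l) t"
      unfolding S_def
      by (intro AE_I2 tendsto_intros has_sum_int_imp_symmetric_limit[OF sech_periodization_has_sum])
    show "AE t in torus. norm (S N t * fourier_mode (- l) t) \<le> (\<Sum>\<^sub>\<infinity>k::int. 2 * y * exp (2 * y * 1) * exp (- 2 * y) ^ nat \<bar>k\<bar>)" for N
      using AE_torus
    proof eventually_elim
      case (elim t)
      have "norm (S N t * fourier_mode (- l) t) \<le> (\<Sum>k\<in>{- int N..int N}. norm (sech_bump (t + of_int k)))"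
        unfolding S_def norm_mult norm_of_real norm_fourier_mode real_norm_def by (simp only: mult_1_right) (rule sum_abs)
      also have "\<dots> \<le> (\<Sum>k\<in>{- int N..int N}. 2 * y * exp (2 * y * 1) * exp (- 2 * y) ^ nat \<bar>k\<bar>)"
        by (intro sum_mono sech_bump_bound) (use elim in auto)
      also have "\<dots> \<le> (\<Sum>\<^sub>\<infinity>k::int. 2 * y * exp (2 * y * 1) * exp (- 2 * y) ^ nat \<bar>k\<bar>)"
        using y by (intro finite_sum_le_infsum sech_bump_bound_summable) auto
      finally show ?case .
    qed
  qed auto
  moreover have "(LINT t|torus. S N t * fourier_mode (- l) t) = (LINT t|lborel. indicator {t. \<lfloor>t\<rfloor> \<in> {- int N..int N}} t *\<^sub>R g t)" for N
  proof -
    have "S N t * fourier_mode (- l) t = (\<Sum>k\<in>{- int N..int N}. g (t + of_int k))" for t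
      by (simp add: S_def g_def fourier_mode_periodic sum_distrib_right)
    then show ?thesis using integral_finite_periodization(1)[OF intg, of "{- int N..int N}"] by simp
  qed
  moreover have "(\<lambda>N. LINT t|lborel. indicator {t. \<lfloor>t\<rfloor> \<in> {- int N..int N}} t *\<^sub>R g t) \<longlonglongrightarrow> (LINT t|lborel. g t)"
  proof (rule integral_dominated_convergence[where w = "\<lambda>t. norm (g t)"])
    show "AE t in lborel. (\<lambda>N. indicator {t. \<lfloor>t\<rfloor> \<in> {- int N..int N}} t *\<^sub>R g t) \<longlonglongrightarrow> g t"
    proof (rule AE_I2)
      fix t
      have "eventually (\<lambda>N. indicator {t. \<lfloor>t\<rfloor> \<in> {- int N..int N}} t *\<^sub>R g t = g t) sequentially"
        by (rule eventually_mono[OF eventually_ge_at_top[of "nat \<bar>\<lfloor>t\<rfloor>\<bar>"]]) (auto simp: indicator_def)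
      then show "(\<lambda>N. indicator {t. \<lfloor>t\<rfloor> \<in> {- int N..int N}} t *\<^sub>R g t) \<longlonglongrightarrow> g t" by (rule tendsto_eventually)
    qed
  qed (use intg in \<open>auto split: split_indicator\<close>)
  ultimately have "fourier_coeff (\<lambda>t. of_real (sech_periodization t)) l = (LINT t|lborel. g t)"
    using LIMSEQ_unique by fastforce
  then show ?thesis by (simp only: g_def integral_sech_bump_mode)
qed

text \<open>
  Poisson summation: both sides are continuous, have period \<open>1\<close>, and have the same
  Fourier coefficients, those of the left side being samples of the Fourier transform of \<open>1 / cosh\<^sup>2\<close>.
\<close>

theorem sech_periodization_eq_symbol: "sech_periodization \<theta> = sech_symbol (pi\<^sup>2 / y) \<theta>"
proof -
  have x: "pi\<^sup>2 / y > 0" using y by simp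
  have unit: "sech_periodization t = sech_symbol (pi\<^sup>2 / y) t" if t: "t \<in> {0..1}" for t
  proof -
    let ?F = "\<lambda>t. complex_of_real (sech_periodization t) - of_real (sech_symbol (pi\<^sup>2 / y) t)"
    have c: "continuous_on UNIV ?F"
      by (intro continuous_intros continuous_sech_periodization continuous_sech_symbol x)
    have [measurable]: "sech_periodization \<in> borel_measurable borel" "sech_symbol (pi\<^sup>2 / y) \<in> borel_measurable borel"
      by (intro borel_measurable_continuous_onI continuous_sech_periodization continuous_sech_symbol x)+
    have int: "integrable torus (\<lambda>t. complex_of_real (h t) * fourier_mode (- l) t)" 
      if h: "continuous_on UNIV h" for l and h :: "real \<Rightarrow> real"
    proof -
      have [measurable]: "h \<in> borel_measurable borel" by (rule borel_measurable_continuous_onI[OF h])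
      have "compact (h ` {0..1})" by (intro compact_continuous_image continuous_on_subset[OF h]) auto
      from compact_imp_bounded[OF this] obtain B where "\<forall>z\<in>h ` {0..1}. norm z \<le> B"
        unfolding bounded_iff by (elim exE)
      then have B: "norm (h t) \<le> B" if "t \<in> {0..1}" for t using that by blast
      show ?thesis
      proof (rule torus.integrable_const_bound[of _ B])
        show "AE t in torus. norm (complex_of_real (h t) * fourier_mode (- l) t) \<le> B"
          using AE_torus
        proof eventually_elim
          case (elim t)
          then show ?case using B[of t] by (simp add: norm_mult)
        qed
      qed measurable
    qed
    have "fourier_coeff ?F l = 0" for l
    proof -
      have "fourier_coeff ?F l = fourier_coeff (\<lambda>t. of_real (sech_periodization t)) l 
          - fourier_coeff (\<lambda>t. of_real (sech_symbol (pi\<^sup>2 / y) t)) l"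
        unfolding fourier_coeff_def left_diff_distrib
        by (intro Bochner_Integration.integral_diff int continuous_sech_periodization continuous_sech_symbol x)
      then show ?thesis by (simp add: fourier_coeff_sech_periodization fourier_coeff_sech_symbol[OF x])
    qed
    from continuous_fourier_coeff_eq_0[OF c this t] show ?thesis by simp
  qed
  have \<theta>: "\<theta> = frac \<theta> + of_int \<lfloor>\<theta>\<rfloor>" by (simp add: frac_def)
  have "frac \<theta> \<in> {0..1}" using frac_lt_1[of \<theta>] by simp
  from unit[OF this] show ?thesis
    by (subst (1 2) \<theta>) (simp only: sech_periodization_shift sech_symbol_periodic)
qed

corollary poisson_sech_squared:
  "((\<lambda>k::int. y / 2 / (cosh (y * (\<theta> + of_int k)))\<^sup>2) has_sum sech_symbol (pi\<^sup>2 / y) \<theta>) UNIV"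
  using sech_periodization_has_sum[of \<theta>] unfolding sech_periodization_eq_symbol by (simp add: sech_bump_def)

end

section \<open>The symbol at its maximum\<close>

text \<open>
  If \<open>v \<mapsto> \<phi>(exp v)\<close> is strictly convex, which is the hypothesis on \<open>t (t \<phi>'(t))'\<close> being
  positive, then \<open>\<phi>(c exp u) + \<phi>(c exp(-u))\<close> increases in \<open>u \<ge> 0\<close>. With \<open>x = c exp(-u)\<close> and \<open>y = c exp u\<close> this compares
  points of fixed product.
\<close>

lemma log_convex_pair:
  fixes \<phi> \<phi>' D :: "real \<Rightarrow> real"
  assumes lo: "lo > 0"
    and d1: "\<And>t. t \<ge> lo \<Longrightarrow> (\<phi> has_real_derivative \<phi>' t) (at t)"
    and d2: "\<And>t. t \<ge> lo \<Longrightarrow> ((\<lambda>t. t * \<phi>' t) has_real_derivative D t) (at t)"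
    and pos: "\<And>t. t \<ge> lo \<Longrightarrow> D t > 0"
    and xy: "lo \<le> x" "x < y" "x * y = c\<^sup>2" and c: "c > 0"
  shows "2 * \<phi> c < \<phi> x + \<phi> y"
proof -
  have x: "x > 0" using lo xy by linarith
  have "x * x < c\<^sup>2" unfolding xy(3)[symmetric] using x xy(2) by (rule mult_strict_left_mono[rotated])
  then have xc: "x < c" using c x by (simp add: power2_eq_square) (metis linorder_not_less mult_mono order_less_imp_le)
  define b where "b = ln (c / x)"
  have b: "b > 0" using xc x by (simp add: b_def)
  have ends: "c * exp (- b) = x" "c * exp b = y"
  proof -
    have e: "exp b = c / x" using x c by (simp add: b_def)
    show "c * exp (- b) = x" using x c by (simp add: exp_minus e)
    show "c * exp b = y" using x xy(3) by (simp add: e field_simps power2_eq_square)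
  qed
  define \<Psi> where "\<Psi> = (\<lambda>u. \<phi> (c * exp u) + \<phi> (c * exp (- u)))"
  have low: "lo \<le> c * exp (- u)" "lo \<le> c * exp u" if "0 \<le> u" "u \<le> b" for u
  proof -
    have "c * exp (- b) \<le> c * exp (- u)" using that c by simp
    then show l: "lo \<le> c * exp (- u)" using ends(1) xy(1) by linarith
    have "c * exp (- u) \<le> c * exp u" using that c by simp
    then show "lo \<le> c * exp u" using l by linarith
  qed
  have D\<Psi>: "(\<Psi> has_real_derivative c * exp u * \<phi>' (c * exp u) - c * exp (- u) * \<phi>' (c * exp (- u))) (at u)"
    if "0 \<le> u" "u \<le> b" for u
  proof -
    have "((\<lambda>u. \<phi> (c * exp u)) has_real_derivative \<phi>' (c * exp u) * (c * exp u)) (at u)"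
      by (rule DERIV_chain2[where f = \<phi> and g = "\<lambda>u. c * exp u", OF d1[OF low(2)[OF that]]]) (auto intro!: derivative_eq_intros)
    moreover have "((\<lambda>u. \<phi> (c * exp (- u))) has_real_derivative \<phi>' (c * exp (- u)) * (- (c * exp (- u)))) (at u)"
      by (rule DERIV_chain2[where f = \<phi> and g = "\<lambda>u. c * exp (- u)", OF d1[OF low(1)[OF that]]]) (auto intro!: derivative_eq_intros)
    ultimately show ?thesis unfolding \<Psi>_def
      by (rule DERIV_cong[OF DERIV_add]) (simp add: mult_ac)
  qed
  have "\<Psi> 0 < \<Psi> b"
  proof (rule DERIV_pos_imp_increasing_open[OF b])
    fix u assume u: "0 < u" "u < b"
    let ?g = "\<lambda>t. t * \<phi>' t"
    have "?g (c * exp (- u)) < ?g (c * exp u)"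
    proof (rule DERIV_pos_imp_increasing[where f = ?g])
      show "c * exp (- u) < c * exp u" using u c by simp
      show "\<exists>y. (?g has_real_derivative y) (at t) \<and> 0 < y" if "c * exp (- u) \<le> t" "t \<le> c * exp u" for t
        using d2[of t] pos[of t] low(1)[of u] that u by (intro exI[of _ "D t"]) auto
    qed
    then show "\<exists>y. (\<Psi> has_real_derivative y) (at u) \<and> 0 < y"
      using D\<Psi>[of u] u by (intro exI[of _ "c * exp u * \<phi>' (c * exp u) - c * exp (- u) * \<phi>' (c * exp (- u))"]) simp
  next
    show "continuous_on {0..b} \<Psi>"
      by (intro DERIV_continuous_on) (use D\<Psi> in \<open>auto intro: has_field_derivative_at_within\<close>)
  qed
  then show ?thesis by (simp add: \<Psi>_def ends)
qed

text \<open>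
  The later thresholds \<open>33/10\<close> and \<open>44/10\<close> are multiples of \<open>11/10\<close>, so that these two bounds
  carry all numerical estimates of exponentials.
\<close>

lemma exp_11_10_bounds: "3 \<le> exp (11/10 :: real)" "exp (11/10 :: real) \<le> 302/100"
proof -
  define P :: real where "P = (\<Sum>m<8. (11/10) ^ m / fact m)"
  define q :: real where "q = (11/10) ^ 8 / fact 8"
  obtain t :: real where t: "\<bar>t\<bar> < \<bar>11/10\<bar>" "exp (11/10) = P + exp t / fact 8 * (11/10) ^ 8"
    unfolding P_def using Maclaurin_exp_lt[of "11/10 :: real" 8] by auto
  then have E: "exp (11/10) = P + exp t * q" by (simp add: q_def)
  have q: "0 \<le> q" "q \<le> 1 / 1000" by (simp_all add: q_def fact_numeral power_divide)
  have P: "3 \<le> P" "P \<le> 301/100"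
    by (simp_all add: P_def lessThan_nat_numeral lessThan_Suc fact_numeral power_divide)
  have "0 \<le> exp t * q" using q by simp
  then show "3 \<le> exp (11/10 :: real)" using E P by linarith
  have "exp t * q \<le> exp (11/10) * (1 / 1000)" using t(1) q by (intro mult_mono) auto
  then show "exp (11/10 :: real) \<le> 302/100" using E P by linarith
qed

lemma exp_33_10_bounds: "27 \<le> exp (33/10 :: real)" "exp (33/10 :: real) \<le> 276/10"
proof -
  have e: "exp (33/10 :: real) = exp (11/10) ^ 3" by (simp flip: exp_of_nat_mult)
  have "(3::real) ^ 3 \<le> exp (11/10) ^ 3" by (intro power_mono exp_11_10_bounds) auto
  then show "27 \<le> exp (33/10 :: real)" using e by simp
  have "exp (11/10) ^ 3 \<le> (302/100 :: real) ^ 3" by (intro power_mono exp_11_10_bounds) auto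
  also have "\<dots> \<le> 276/10" by (simp add: power_divide)
  finally show "exp (33/10 :: real) \<le> 276/10" using e by simp
qed

lemma exp_44_10_ge: "81 \<le> exp (44/10 :: real)"
proof -
  have e: "exp (44/10 :: real) = exp (11/10) ^ 4" by (simp flip: exp_of_nat_mult)
  have "(3::real) ^ 4 \<le> exp (11/10) ^ 4" by (intro power_mono exp_11_10_bounds) auto
  then show ?thesis using e by simp
qed

lemma xsinh_deriv:
  assumes "t > 0"
  shows "(xsinh has_real_derivative (sinh t - t * cosh t) / (sinh t)\<^sup>2) (at t)"
proof (rule DERIV_cong_ev[THEN iffD1, OF refl _ refl])
  show "\<forall>\<^sub>F x in nhds t. x / sinh x = xsinh x"
    using eventually_nhds_in_open[of "{0<..}" t] assms by (auto elim!: eventually_mono simp: xsinh_def)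
  show "((\<lambda>x. x / sinh x) has_real_derivative (sinh t - t * cosh t) / (sinh t)\<^sup>2) (at t)"
    using assms by (auto intro!: derivative_eq_intros simp: power2_eq_square)
qed

lemma sinh_less_mult_cosh:
  assumes "t > (0::real)"
  shows "sinh t < t * cosh t"
proof -
  have "(\<lambda>t::real. t * cosh t - sinh t) 0 < (\<lambda>t. t * cosh t - sinh t) t"
  proof (rule DERIV_pos_imp_increasing_open[OF assms])
    fix u :: real assume "0 < u"
    then show "\<exists>y. ((\<lambda>t. t * cosh t - sinh t) has_real_derivative y) (at u) \<and> 0 < y"
      by (intro exI[of _ "u * sinh u"]) (auto intro!: derivative_eq_intros)
  qed (intro continuous_intros)
  then show ?thesis by simp
qed

lemma xsinh_antimono:
  assumes "0 < s" "s < t"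
  shows "xsinh t < xsinh s"
proof (rule DERIV_neg_imp_decreasing[OF assms(2)])
  fix u assume u: "s \<le> u" "u \<le> t"
  then have "u > 0" using assms by simp
  then have "(sinh u - u * cosh u) / (sinh u)\<^sup>2 < 0"
    using sinh_less_mult_cosh[of u] by (intro divide_neg_pos) auto
  then show "\<exists>y. (xsinh has_real_derivative y) (at u) \<and> y < 0"
    using xsinh_deriv[OF \<open>u > 0\<close>] by blast
qed

lemma xsinh_44_10_le: "xsinh (44/10) \<le> 109/1000"
proof -
  have "sinh (44/10 :: real) = (exp (44/10) - inverse (exp (44/10))) / 2"
    by (simp add: sinh_field_def exp_minus)
  moreover have "inverse (exp (44/10 :: real)) \<le> inverse 81"
    using exp_44_10_ge by (intro le_imp_inverse_le) auto
  ultimately have "sinh (44/10 :: real) \<ge> 404/10" using exp_44_10_ge by simp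
  then have "(44/10) / sinh (44/10 :: real) \<le> (44/10) / (404/10)"
    by (intro divide_left_mono mult_pos_pos) auto
  moreover have "xsinh (44/10) = (44/10) / sinh (44/10)" by (simp add: xsinh_def)
  ultimately show ?thesis by simp
qed

lemma xsinh_33_10_ge: "xsinh (33/10) > 2 * (109/1000)"
proof -
  have "sinh (33/10 :: real) \<le> (276/10) / 2"
    using exp_33_10_bounds(2) by (simp add: sinh_field_def) (smt (verit) exp_gt_zero)
  moreover have "sinh (33/10 :: real) > 0" by simp
  ultimately have "(33/10) / ((276/10) / 2) \<le> (33/10) / sinh (33/10 :: real)"
    by (intro divide_left_mono mult_pos_pos) auto
  moreover have "xsinh (33/10) = (33/10) / sinh (33/10)" by (simp add: xsinh_def)
  ultimately show ?thesis by simp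
qed

lemma xsinh_le_if_ge_44_10: "c \<ge> 44/10 \<Longrightarrow> xsinh c \<le> 109/1000"
proof (cases "c = 44/10")
  case True
  show ?thesis unfolding True by (rule xsinh_44_10_le)
next
  case False
  moreover assume "c \<ge> 44/10"
  ultimately have "xsinh c < xsinh (44/10)" by (intro xsinh_antimono) auto
  then show ?thesis using xsinh_44_10_le by linarith
qed

text \<open>
  For \<open>x \<ge> 33/10\<close> the function \<open>xsinh\<close> is strictly convex in \<open>ln t\<close>. For smaller \<open>x\<close> the single
  value \<open>xsinh x\<close> already exceeds \<open>2 xsinh c\<close>, because \<open>c \<ge> 44/10\<close>.
\<close>

lemma xsinh_pair:
  assumes "0 < x" "x < y" "x * y = c\<^sup>2" "c \<ge> 44/10"
  shows "2 * xsinh c < xsinh x + xsinh y"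
proof (cases "x \<ge> 33/10")
  case True
  show ?thesis
  proof (rule log_convex_pair[where lo = "33/10" and \<phi> = xsinh and x = x and y = y and c = c
        and \<phi>' = "\<lambda>t. (sinh t - t * cosh t) / (sinh t)\<^sup>2"
        and D = "\<lambda>t. ((sinh t)\<^sup>2 - 3 * t * sinh t * cosh t - t\<^sup>2 * (sinh t)\<^sup>2 + 2 * t\<^sup>2 * (cosh t)\<^sup>2) / (sinh t) ^ 3"])
    fix t :: real assume t: "33/10 \<le> t"
    show "(xsinh has_real_derivative (sinh t - t * cosh t) / (sinh t)\<^sup>2) (at t)"
      by (rule xsinh_deriv) (use t in simp)
    have s: "sinh t > 0" using t by simp
    show "((\<lambda>t. t * ((sinh t - t * cosh t) / (sinh t)\<^sup>2)) has_real_derivative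
        ((sinh t)\<^sup>2 - 3 * t * sinh t * cosh t - t\<^sup>2 * (sinh t)\<^sup>2 + 2 * t\<^sup>2 * (cosh t)\<^sup>2) / (sinh t) ^ 3) (at t)"
      using s by (auto intro!: derivative_eq_intros simp: divide_simps) (simp add: algebra_simps power2_eq_square power3_eq_cube power4_eq_xxxx)
    have c: "sinh t \<le> cosh t" using sinh_le_cosh_real by blast
    have "t * sinh t * (2 * t * sinh t - 3 * sinh t) \<le> t * cosh t * (2 * t * cosh t - 3 * sinh t)"
    proof (intro mult_mono)
      have "2 * t * sinh t \<le> 2 * t * cosh t" using c t by (intro mult_left_mono) auto
      then show "2 * t * sinh t - 3 * sinh t \<le> 2 * t * cosh t - 3 * sinh t" by simp
      have "3 * sinh t \<le> 2 * t * sinh t" using s t by (intro mult_right_mono) auto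
      then show "0 \<le> 2 * t * sinh t - 3 * sinh t" by simp
    qed (use c t in \<open>auto intro!: mult_left_mono\<close>)
    moreover have "0 < (sinh t)\<^sup>2 * (t * (t - 3) + 1)"
      using s t by (intro mult_pos_pos add_nonneg_pos mult_nonneg_nonneg) auto
    ultimately have "0 < (sinh t)\<^sup>2 - 3 * t * sinh t * cosh t - t\<^sup>2 * (sinh t)\<^sup>2 + 2 * t\<^sup>2 * (cosh t)\<^sup>2"
      by (simp add: algebra_simps power2_eq_square)
    then show "0 < ((sinh t)\<^sup>2 - 3 * t * sinh t * cosh t - t\<^sup>2 * (sinh t)\<^sup>2 + 2 * t\<^sup>2 * (cosh t)\<^sup>2) / (sinh t) ^ 3"
      using s by (intro divide_pos_pos) auto
  qed (use assms True in auto)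
next
  case False
  then have "xsinh (33/10) < xsinh x" using assms by (intro xsinh_antimono) auto
  then show ?thesis
    using xsinh_33_10_ge xsinh_le_if_ge_44_10[OF assms(4)] xsinh_pos[of y] by linarith
qed

lemma sech_symbol_le_0:
  assumes "x > 0" shows "sech_symbol x \<theta> \<le> sech_symbol x 0"
proof (rule has_sum_mono[OF sech_symbol_has_sum[OF assms] sech_symbol_has_sum[OF assms]])
  fix k :: int
  have "xsinh (of_int k * x) * cos (2 * pi * of_int k * \<theta>) \<le> xsinh (of_int k * x) * 1"
    using xsinh_pos by (intro mult_left_mono cos_le_one less_imp_le)
  then show "xsinh (of_int k * x) * cos (2 * pi * of_int k * \<theta>) \<le> xsinh (of_int k * x) * cos (2 * pi * of_int k * 0)" by simp
qed

text \<open>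
  At \<open>\<theta> = 0\<close> the inequality holds term by term, since \<open>(k x) (k y) = (k c)\<^sup>2\<close> and \<open>k c \<ge> c\<close> for \<open>k \<ge> 1\<close>.
\<close>

theorem sech_symbol_0_strict:
  assumes "0 < x" "x < y" "x * y = c\<^sup>2" "c \<ge> 44/10"
  shows "2 * sech_symbol c 0 < sech_symbol x 0 + sech_symbol y 0"
proof -
  have s: "((\<lambda>k::int. xsinh (of_int k * z)) has_sum sech_symbol z 0) UNIV" if "z > 0" for z
    using sech_symbol_has_sum[OF that, of 0] by simp
  have strict: "2 * xsinh (of_int k * c) < xsinh (of_int k * x) + xsinh (of_int k * y)" if "k \<noteq> 0" for k :: int
  proof -
    have pos: "2 * xsinh (of_int k * c) < xsinh (of_int k * x) + xsinh (of_int k * y)" if "k > 0" for k :: int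
    proof (rule xsinh_pair)
      have k: "(1::real) \<le> of_int k" using that by simp
      then have "1 * c \<le> of_int k * c" using assms by (intro mult_right_mono) auto
      then show "44/10 \<le> of_int k * c" using assms(4) by linarith
      show "of_int k * x * (of_int k * y) = (of_int k * c)\<^sup>2"
        using assms(3) by (simp add: power2_eq_square mult_ac)
    qed (use that assms in simp_all)
    show ?thesis
    proof (cases "k > 0")
      case True then show ?thesis by (rule pos)
    next
      case False
      then have "- k > 0" using that by simp
      from pos[OF this] show ?thesis by simp
    qed
  qed
  have "((\<lambda>k::int. 2 * xsinh (of_int k * c)) has_sum 2 * sech_symbol c 0) UNIV"
    by (intro has_sum_cmult_right s) (use assms in auto)
  moreover have "((\<lambda>k::int. xsinh (of_int k * x) + xsinh (of_int k * y)) has_sum (sech_symbol x 0 + sech_symbol y 0)) UNIV"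
    by (intro has_sum_add s) (use assms in auto)
  ultimately show ?thesis
  proof (rule has_sum_strict_mono)
    show "2 * xsinh (of_int k * c) \<le> xsinh (of_int k * x) + xsinh (of_int k * y)" for k :: int
      using strict[of k] by (cases "k = 0") auto
    show "2 * xsinh (of_int 1 * c) < xsinh (of_int 1 * x) + xsinh (of_int 1 * y)" by (rule strict) simp
  qed simp
qed

section \<open>The symbol at its minimum\<close>

lemma abs_sin_multiple_le: "\<bar>sin (real m * t)\<bar> \<le> real m * \<bar>sin t\<bar>"
proof (induction m)
  case (Suc m)
  have "\<bar>sin (real (Suc m) * t)\<bar> = \<bar>sin (real m * t) * cos t + cos (real m * t) * sin t\<bar>"
  proof -
    have "real (Suc m) * t = real m * t + t" by (simp add: algebra_simps)
    then show ?thesis by (simp only: sin_add)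
  qed
  also have "\<dots> \<le> \<bar>sin (real m * t)\<bar> * \<bar>cos t\<bar> + \<bar>cos (real m * t)\<bar> * \<bar>sin t\<bar>"
    unfolding abs_mult[symmetric] by (rule abs_triangle_ineq)
  also have "\<dots> \<le> real m * \<bar>sin t\<bar> * 1 + 1 * \<bar>sin t\<bar>"
    using Suc.IH by (intro add_mono mult_mono) auto
  finally show ?case by (simp add: algebra_simps)
qed simp

text \<open>
  Put \<open>\<theta> = 2t + \<pi>\<close>: the left side becomes \<open>2 sin\<^sup>2(mt)\<close> and the right side \<open>2 m\<^sup>2 sin\<^sup>2 t\<close>.
\<close>

lemma abs_cos_multiple_diff_le: "\<bar>cos (real m * \<theta>) - (- 1) ^ m\<bar> \<le> (real m)\<^sup>2 * (1 + cos \<theta>)"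
proof -
  define t where "t = (\<theta> - pi) / 2"
  have \<theta>: "\<theta> = 2 * t + pi" by (simp add: t_def field_simps)
  have 1: "cos (real m * \<theta>) = (- 1) ^ m * cos (2 * (real m * t))"
  proof -
    have "cos (real m * \<theta>) = cos (2 * (real m * t) + real m * pi)" by (simp add: \<theta> algebra_simps)
    then show ?thesis by (simp add: cos_add)
  qed
  have "\<bar>cos (real m * \<theta>) - (- 1) ^ m\<bar> = \<bar>(- 1) ^ m * (cos (2 * (real m * t)) - 1)\<bar>"
    unfolding 1 by (simp add: algebra_simps)
  also have "\<dots> = 2 * (sin (real m * t))\<^sup>2" by (simp add: abs_mult power_abs cos_double_sin)
  also have "\<dots> \<le> 2 * (real m * \<bar>sin t\<bar>)\<^sup>2"
    using power_mono[OF abs_sin_multiple_le[of m t], of 2] by simp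
  also have "\<dots> = (real m)\<^sup>2 * (2 * (sin t)\<^sup>2)" by (simp add: power_mult_distrib)
  also have "2 * (sin t)\<^sup>2 = 1 + cos \<theta>" by (simp add: \<theta> cos_add cos_double_sin)
  finally show ?thesis .
qed

lemma sech_symbol_nat:
  assumes "x > 0"
  shows "sech_symbol x \<theta> = 1 + 2 * (\<Sum>m. xsinh (real (Suc m) * x) * cos (2 * pi * real (Suc m) * \<theta>))"
    and "summable (\<lambda>m. xsinh (real (Suc m) * x) * cos (2 * pi * real (Suc m) * \<theta>))"
proof -
  let ?h = "\<lambda>k::int. xsinh (of_int k * x) * cos (2 * pi * of_int k * \<theta>)"
  have s: "summable (\<lambda>m. norm (?h (int (Suc m))))"
  proof (rule summable_comparison_test'[OF summable_xsinh[OF assms]])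
    fix m :: nat
    show "norm (norm (?h (int (Suc m)))) \<le> xsinh (real (Suc m) * x)"
      using xsinh_pos[of "real (Suc m) * x"] by (simp add: abs_mult mult_left_le)
  qed
  have "(?h has_sum (?h 0 + 2 * (\<Sum>m. ?h (int (Suc m))))) UNIV"
    by (rule has_sum_int_even[OF s]) simp
  from has_sum_unique[OF sech_symbol_has_sum[OF assms] this]
  show "sech_symbol x \<theta> = 1 + 2 * (\<Sum>m. xsinh (real (Suc m) * x) * cos (2 * pi * real (Suc m) * \<theta>))"
    by simp
  show "summable (\<lambda>m. xsinh (real (Suc m) * x) * cos (2 * pi * real (Suc m) * \<theta>))"
    using summable_norm_cancel[OF s] by simp
qed

lemma cube_le_power_8: "(real (Suc m)) ^ 3 \<le> 8 ^ m"
proof (induction m)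
  case (Suc m)
  have "(real (Suc (Suc m))) ^ 3 \<le> (2 * real (Suc m)) ^ 3" by (intro power_mono) auto
  also have "\<dots> = 8 * (real (Suc m)) ^ 3" by (simp only: power_mult_distrib) simp
  also have "\<dots> \<le> 8 * 8 ^ m" using Suc.IH by simp
  finally show ?case by simp
qed simp

text \<open>
  For large \<open>x\<close> the first term of \<open>\<sigma>\<^sub>x(\<theta>) - \<sigma>\<^sub>x(1/2)\<close>, a multiple of \<open>1 + cos(2\<pi>\<theta>)\<close>, dominates the sum of
  all the others, each of which is bounded by a multiple of the same factor.
\<close>

theorem sech_symbol_ge_half:
  assumes x: "x \<ge> 33/10"
  shows "sech_symbol x (1/2) \<le> sech_symbol x \<theta>"
proof -
  have x0: "x > 0" using x by linarith
  \<comment> \<open>the factor \<open>8\<close> absorbs the cubic growth, as \<open>(m + 1)\<^sup>3 \<le> 8\<^sup>m\<close>\<close>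
  define q where "q = 8 * exp (- x)"
  have q: "0 < q" "q \<le> 1/2"
  proof -
    have "exp (33/10) \<le> exp x" using x by simp
    then have "16 \<le> exp x" using exp_33_10_bounds(1) by linarith
    then have "inverse (exp x) \<le> inverse 16" by (intro le_imp_inverse_le) auto
    then show "q \<le> 1/2" by (simp add: q_def exp_minus)
  qed (simp add: q_def)
  define X where "X = xsinh x * (1 + cos (2 * pi * \<theta>))"
  have X: "X \<ge> 0" unfolding X_def using xsinh_pos[of x] cos_ge_minus_one[of "2 * pi * \<theta>"]
    by (intro mult_nonneg_nonneg) linarith+
  define d where "d = (\<lambda>m. xsinh (real (Suc m) * x) * cos (2 * pi * real (Suc m) * \<theta>)
     - xsinh (real (Suc m) * x) * cos (2 * pi * real (Suc m) * (1/2)))"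
  have d: "d m = xsinh (real (Suc m) * x) * (cos (real (Suc m) * (2 * pi * \<theta>)) - (- 1) ^ Suc m)" for m
  proof -
    have "cos (2 * pi * real (Suc m) * (1/2)) = (- 1) ^ Suc m"
      using cos_npi[of "Suc m"] by (simp add: mult.commute)
    moreover have "2 * pi * real (Suc m) * \<theta> = real (Suc m) * (2 * pi * \<theta>)" by (simp add: mult_ac)
    ultimately show ?thesis unfolding d_def by (simp only: right_diff_distrib)
  qed
  have sums_d: "d sums ((\<Sum>m. xsinh (real (Suc m) * x) * cos (2 * pi * real (Suc m) * \<theta>))
     - (\<Sum>m. xsinh (real (Suc m) * x) * cos (2 * pi * real (Suc m) * (1/2))))"
    unfolding d_def by (intro sums_diff summable_sums sech_symbol_nat(2) x0)
  \<comment> \<open>a lower bound for every term: it equals \<open>X\<close> at \<open>m = 0\<close> and \<open>- X q\<^sup>m\<close> afterwards\<close>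
  define b where "b = (\<lambda>m. X * ((if m = 0 then 2 else 0) - q ^ m))"
  have sums_b: "b sums (X * (2 - 1 / (1 - q)))"
    unfolding b_def using q 
    by (intro sums_mult sums_diff geometric_sums sums_If_finite_set[of "{0::nat}" "\<lambda>_. 2::real", simplified]) auto
  have "b m \<le> d m" for m
  proof (cases "m = 0")
    case True
    then show ?thesis by (simp add: b_def d X_def add.commute)
  next
    case False
    have "\<bar>d m\<bar> = xsinh (real (Suc m) * x) * \<bar>cos (real (Suc m) * (2 * pi * \<theta>)) - (- 1) ^ Suc m\<bar>"
      unfolding d abs_mult using xsinh_pos by (simp add: abs_of_pos)
    also have "\<dots> \<le> (real (Suc m) * xsinh x * exp (- x) ^ m) * ((real (Suc m))\<^sup>2 * (1 + cos (2 * pi * \<theta>)))"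
      by (intro mult_mono xsinh_multiple_le[OF x0] abs_cos_multiple_diff_le)
         (use xsinh_pos[of x] in auto)
    also have "\<dots> = X * exp (- x) ^ m * (real (Suc m)) ^ 3"
      by (simp only: X_def power2_eq_square power3_eq_cube mult_ac)
    also have "\<dots> \<le> X * exp (- x) ^ m * 8 ^ m"
      using X by (intro mult_left_mono cube_le_power_8) auto
    also have "\<dots> = X * q ^ m" by (simp only: q_def power_mult_distrib mult_ac)
    finally show ?thesis using False by (simp add: b_def)
  qed
  from sums_le[OF this sums_b sums_d]
  have "X * (2 - 1 / (1 - q)) \<le> (\<Sum>m. xsinh (real (Suc m) * x) * cos (2 * pi * real (Suc m) * \<theta>))
     - (\<Sum>m. xsinh (real (Suc m) * x) * cos (2 * pi * real (Suc m) * (1/2)))" .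
  moreover have "1 / (1 - q) \<le> 2" using q by (simp add: divide_le_eq)
  then have "0 \<le> X * (2 - 1 / (1 - q))" using X by simp
  ultimately show ?thesis unfolding sech_symbol_nat(1)[OF x0] by linarith
qed

text \<open>
  At \<open>\<theta> = 1/2\<close> the series alternates with decreasing terms.
\<close>

lemma sech_symbol_half_ge:
  assumes c: "c \<ge> 44/10"
  shows "sech_symbol c (1/2) \<ge> 1 - 2 * (109/1000)"
proof -
  have c0: "c > 0" using c by linarith
  define a where "a = (\<lambda>m. xsinh (real (Suc m) * c))"
  have "decseq a" unfolding a_def
    by (intro decseq_SucI less_imp_le xsinh_antimono) (use c0 in auto)
  moreover have "a \<longlonglongrightarrow> 0" using summable_LIMSEQ_zero[OF summable_xsinh[OF c0]] by (simp add: a_def)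
  ultimately have "(\<Sum>i. (-1) ^ i * a i) \<le> (\<Sum>i<2 * 0 + 1. (-1) ^ i * a i)"
    by (intro summable_Leibniz'(4)) (auto simp: a_def decseq_Suc_iff less_imp_le[OF xsinh_pos])
  then have "(\<Sum>i. (-1) ^ i * a i) \<le> xsinh c" by (simp add: a_def)
  moreover have "sech_symbol c (1/2) = 1 + 2 * (\<Sum>i. - ((-1) ^ i * a i))"
  proof -
    have "xsinh (real (Suc m) * c) * cos (2 * pi * real (Suc m) * (1/2)) = - ((-1) ^ m * a m)" for m
      using cos_npi[of "Suc m"] by (simp add: mult.commute a_def)
    then show ?thesis unfolding sech_symbol_nat(1)[OF c0] by (simp only:)
  qed
  moreover have "(\<Sum>i. - ((-1) ^ i * a i)) = - (\<Sum>i. (-1) ^ i * a i)"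
  proof (rule suminf_minus)
    show "summable (\<lambda>i. (-1) ^ i * a i)"
      by (rule summable_comparison_test'[OF summable_xsinh[OF c0]]) (simp add: a_def abs_mult power_abs abs_of_pos xsinh_pos)
  qed
  ultimately show ?thesis using xsinh_le_if_ge_44_10[OF c] by linarith
qed

text \<open>
  With \<open>u\<close> running through the half integers, these are the terms of the Poisson dual of
  \<open>\<sigma>\<close> at \<open>\<theta> = 1/2\<close>.
\<close>

definition sech_half_term :: "real \<Rightarrow> real \<Rightarrow> real" where
  "sech_half_term x u = x / 2 / (cosh (x * u))\<^sup>2"

text \<open>
  The reflection \<open>k \<mapsto> -1-k\<close> maps the half integer \<open>1/2+k\<close> to its negative, so both halves of the
  sum agree.
\<close>

lemma has_sum_half_integers:
  fixes S :: real
  assumes S: "((\<lambda>k::int. sech_half_term x (1/2 + of_int k)) has_sum S) UNIV"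
  shows "((\<lambda>k::nat. sech_half_term x (1/2 + real k)) has_sum (S / 2)) UNIV"
proof -
  have ij: "inj int" "inj (\<lambda>n. - 1 - int n)" by (auto simp: inj_def)
  have "(\<lambda>k::int. sech_half_term x (1/2 + of_int k)) summable_on range int"
    by (rule summable_on_subset_banach[OF has_sum_imp_summable[OF S]]) simp
  then obtain T where T: "((\<lambda>k::int. sech_half_term x (1/2 + of_int k)) has_sum T) (range int)"
    by (auto simp: summable_on_def)
  then have T': "((\<lambda>k::nat. sech_half_term x (1/2 + real k)) has_sum T) UNIV"
    unfolding has_sum_reindex[OF ij(1)] by (simp add: o_def)
  have sym: "sech_half_term x (1/2 + of_int (- 1 - int n)) = sech_half_term x (1/2 + real n)" for n
  proof -
    have "x * (1/2 + of_int (- 1 - int n)) = - (x * (1/2 + real n))" by (simp add: algebra_simps)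
    then show ?thesis unfolding sech_half_term_def by (simp only: cosh_minus)
  qed
  have "((\<lambda>k::int. sech_half_term x (1/2 + of_int k)) has_sum T) (range (\<lambda>n. - 1 - int n))"
    unfolding has_sum_reindex[OF ij(2)] o_def sym by (rule T')
  moreover have "range int \<inter> range (\<lambda>n. - 1 - int n) = {}" by auto
  ultimately have "((\<lambda>k::int. sech_half_term x (1/2 + of_int k)) has_sum (T + T)) (range int \<union> range (\<lambda>n. - 1 - int n))"
    using T by (intro has_sum_Un_disjoint)
  moreover have "range int \<union> range (\<lambda>n. - 1 - int n) = UNIV"
  proof -
    have "k \<in> range int \<union> range (\<lambda>n. - 1 - int n)" for k
    proof (cases "k \<ge> 0")
      case True
      then have "k = int (nat k)" by simp
      then show ?thesis by blast
    next
      case False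
      then have "k = - 1 - int (nat (- 1 - k))" by simp
      then show ?thesis by blast
    qed
    then show ?thesis by blast
  qed
  ultimately have "((\<lambda>k::int. sech_half_term x (1/2 + of_int k)) has_sum (T + T)) UNIV" by (simp only:)
  from has_sum_unique[OF this S] have "T = S / 2" by simp
  with T' show ?thesis by (simp only:)
qed

text \<open>
  Both sides arise from the absolutely convergent double series
  \<open>\<Sum> 2x (-1)\<^sup>m (m+1) exp(-(m+1)(2k+1)x)\<close>: summing over \<open>k\<close> first gives a geometric series and \<open>1/sinh\<close>,
  summing over \<open>m\<close> first gives \<open>1/cosh\<^sup>2\<close>.
\<close>

lemma lambert_identity:
  assumes x: "x > 0" and S: "((\<lambda>k::nat. sech_half_term x (1/2 + real k)) has_sum S) UNIV"
  shows "(\<Sum>m. (-1) ^ m * xsinh (real (Suc m) * x)) = S"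
proof -
  define a where "a = (\<lambda>(m::nat) (k::nat). 2 * x * (-1) ^ m * real (Suc m) * exp (- (real (Suc m) * real (2 * k + 1) * x)))"
  have row: "((\<lambda>k. \<bar>a m k\<bar>) has_sum xsinh (real (Suc m) * x)) UNIV"
    and row': "((\<lambda>k. a m k) has_sum ((-1) ^ m * xsinh (real (Suc m) * x))) UNIV" for m
  proof -
    define z where "z = real (Suc m) * x"
    have z: "z > 0" using x by (simp add: z_def)
    have e: "exp (- (real (Suc m) * real (2 * k + 1) * x)) = exp (- z) * exp (- 2 * z) ^ k" for k
      unfolding exp_of_nat_mult[symmetric] exp_add[symmetric] z_def by (rule arg_cong[of _ _ exp]) (simp add: algebra_simps)
    have "(\<lambda>k. 2 * z * exp (- z) * exp (- 2 * z) ^ k) sums (2 * z * exp (- z) * (1 / (1 - exp (- 2 * z))))"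
      by (intro sums_mult geometric_sums) (use z in auto)
    moreover have "2 * z * exp (- z) * (1 / (1 - exp (- 2 * z))) = xsinh z"
    proof -
      define w where "w = exp (- z)"
      have w: "0 < w" "w < 1" "exp z = 1 / w" "exp (- 2 * z) = w * w" using z
        by (auto simp: w_def exp_minus field_simps simp flip: exp_add)
      have "1 - w * w > 0" using w mult_strict_mono[of w 1 w 1] by simp
      then show ?thesis using z w unfolding xsinh_def sinh_field_def w(4)
        by (simp add: w(3) flip: w_def) (simp add: field_simps)
    qed
    ultimately have s: "(\<lambda>k. 2 * z * exp (- z) * exp (- 2 * z) ^ k) sums xsinh z" by simp
    have eq: "\<bar>a m k\<bar> = 2 * z * exp (- z) * exp (- 2 * z) ^ k" for k
      unfolding a_def e using x by (simp add: abs_mult power_abs z_def)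
    have "((\<lambda>k. \<bar>a m k\<bar>) has_sum xsinh z) UNIV"
      unfolding eq by (rule sums_nonneg_imp_has_sum[OF s]) (use z in auto)
    then show "((\<lambda>k. \<bar>a m k\<bar>) has_sum xsinh (real (Suc m) * x)) UNIV" by (simp only: z_def)
    from has_sum_cmult_right[OF this, of "(-1) ^ m"]
    show "((\<lambda>k. a m k) has_sum ((-1) ^ m * xsinh (real (Suc m) * x))) UNIV"
    proof -
      have "a m k = (-1) ^ m * \<bar>a m k\<bar>" for k
        unfolding eq unfolding a_def e z_def by (simp only: mult_ac)
      then show ?thesis using \<open>((\<lambda>k. (-1) ^ m * \<bar>a m k\<bar>) has_sum _) UNIV\<close> by (simp only: z_def)
    qed
  qed
  have col: "((\<lambda>m. a m k) has_sum sech_half_term x (1/2 + real k)) UNIV" for k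
  proof -
    define z where "z = real (2 * k + 1) * x"
    define w where "w = exp (- z)"
    have z: "z > 0" using x by (simp add: z_def)
    have w: "0 < w" "w < 1" using z by (auto simp: w_def)
    have a: "a m k = 2 * x * w * (real (Suc m) * (- w) ^ m)" for m
    proof -
      have "exp (- (real (Suc m) * real (2 * k + 1) * x)) = w * w ^ m"
        unfolding w_def z_def exp_of_nat_mult[symmetric] exp_add[symmetric] by (rule arg_cong[of _ _ exp]) (simp add: algebra_simps)
      moreover have "(- w) ^ m = (-1) ^ m * w ^ m" by (rule power_minus)
      ultimately show ?thesis by (simp add: a_def mult_ac)
    qed
    have s: "(\<lambda>m. 2 * x * w * (real (Suc m) * (- w) ^ m)) sums (2 * x * w * (1 / (1 - (- w))\<^sup>2))"
      by (intro sums_mult geometric_deriv_sums) (use w in auto)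
    have n: "summable (\<lambda>m. norm (2 * x * w * (real (Suc m) * (- w) ^ m)))"
    proof -
      have "summable (\<lambda>m. 2 * x * w * (real (Suc m) * w ^ m))"
        by (intro summable_mult sums_summable[OF geometric_deriv_sums]) (use w in auto)
      then show ?thesis using x w by (simp add: abs_mult power_abs)
    qed
    have "((\<lambda>m. a m k) has_sum (2 * x * w * (1 / (1 - (- w))\<^sup>2))) UNIV"
      unfolding a by (rule norm_summable_imp_has_sum[OF n s])
    moreover have "2 * x * w * (1 / (1 - (- w))\<^sup>2) = sech_half_term x (1/2 + real k)"
    proof -
      \<comment> \<open>a square root of \<open>w\<close>, to reach \<open>cosh (z / 2)\<close>\<close>
      define v where "v = exp (- (z / 2))"
      have v: "v > 0" "w = v * v" "exp (z / 2) = 1 / v" by (auto simp: v_def w_def exp_minus field_simps simp flip: exp_add)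
      have "x * (1/2 + real k) = z / 2" by (simp add: z_def algebra_simps)
      moreover have "cosh (z / 2) = (1 + v * v) / (2 * v)"
        unfolding cosh_field_def v(3) v_def[symmetric] using v(1) by (simp add: field_simps)
      ultimately have "sech_half_term x (1/2 + real k) = x / 2 / ((1 + v * v) / (2 * v))\<^sup>2"
        by (simp only: sech_half_term_def)
      also have "\<dots> = 2 * x * (v * v) / (1 + v * v)\<^sup>2"
        using v(1) by (simp add: power_divide power2_eq_square)
      finally show ?thesis by (simp add: v(2))
    qed
    ultimately show ?thesis by simp
  qed
  have "(\<lambda>(m, k). a m k) summable_on UNIV \<times> UNIV"
  proof (rule abs_summable_summable, subst Infinite_Sum.abs_summable_on_Sigma_iff, intro conjI ballI)
    show "(\<lambda>k. norm ((\<lambda>(m, k). a m k) (m, k))) summable_on UNIV" for m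
      using has_sum_imp_summable[OF row[of m]] by simp
    have "(\<Sum>\<^sub>\<infinity>k. norm ((\<lambda>(m, k). a m k) (m, k))) = xsinh (real (Suc m) * x)" for m
      using infsumI[OF row[of m]] by simp
    then show "(\<lambda>m. norm (\<Sum>\<^sub>\<infinity>k. norm ((\<lambda>(m, k). a m k) (m, k)))) summable_on UNIV"
      using norm_summable_imp_summable_on[of "\<lambda>m. xsinh (real (Suc m) * x)"] summable_xsinh[OF x]
      by (simp add: abs_of_pos xsinh_pos)
  qed
  from infsum_swap_banach[OF this]
  have "(\<Sum>\<^sub>\<infinity>m. (-1) ^ m * xsinh (real (Suc m) * x)) = (\<Sum>\<^sub>\<infinity>k. sech_half_term x (1/2 + real k))"
    by (simp only: infsumI[OF row'] infsumI[OF col])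
  also have "\<dots> = S" by (rule infsumI[OF S])
  moreover have "(\<Sum>\<^sub>\<infinity>m. (-1) ^ m * xsinh (real (Suc m) * x)) = (\<Sum>m. (-1) ^ m * xsinh (real (Suc m) * x))"
  proof -
    have n: "summable (\<lambda>m. norm ((-1) ^ m * xsinh (real (Suc m) * x)))"
      using summable_xsinh[OF x] by (simp add: abs_mult power_abs abs_of_pos xsinh_pos)
    show ?thesis by (rule infsumI[OF norm_summable_imp_has_sum[OF n summable_sums[OF summable_norm_cancel[OF n]]]])
  qed
  ultimately show ?thesis by simp
qed

text \<open>
  Poisson summation expresses \<open>\<sigma>\<close> at \<open>\<pi>\<^sup>2/x\<close> by the same half-integer sum to which the Lambert series
  rearrangement reduces \<open>1 - \<sigma>\<^sub>x(1/2)\<close>. For density \<open>n = 1\<close> this identity makes the lower frame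
  value vanish for all lattices, so strict optimality has to use \<open>n \<ge> 2\<close>.
\<close>

lemma sech_symbol_half_duality:
  assumes x: "x > 0"
  shows "sech_symbol x (1/2) = 1 - sech_symbol (pi\<^sup>2 / x) (1/2)"
proof -
  have "((\<lambda>k::int. sech_half_term x (1/2 + of_int k)) has_sum sech_symbol (pi\<^sup>2 / x) (1/2)) UNIV"
    using poisson_sech_squared[OF x, of "1/2"] by (simp add: sech_half_term_def)
  from lambert_identity[OF x has_sum_half_integers[OF this]]
  have L: "(\<Sum>m. (-1) ^ m * xsinh (real (Suc m) * x)) = sech_symbol (pi\<^sup>2 / x) (1/2) / 2" .
  have "sech_symbol x (1/2) = 1 + 2 * (\<Sum>i. - ((-1) ^ i * xsinh (real (Suc i) * x)))"
  proof -
    have "xsinh (real (Suc m) * x) * cos (2 * pi * real (Suc m) * (1/2)) = - ((-1) ^ m * xsinh (real (Suc m) * x))" for m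
      using cos_npi[of "Suc m"] by (simp add: mult.commute)
    then show ?thesis unfolding sech_symbol_nat(1)[OF x] by (simp only:)
  qed
  moreover have "(\<Sum>i. - ((-1) ^ i * xsinh (real (Suc i) * x))) = - (\<Sum>i. (-1) ^ i * xsinh (real (Suc i) * x))"
  proof (rule suminf_minus)
    show "summable (\<lambda>i. (-1) ^ i * xsinh (real (Suc i) * x))"
      by (rule summable_comparison_test'[OF summable_xsinh[OF x]]) (simp add: abs_mult power_abs abs_of_pos xsinh_pos)
  qed
  ultimately show ?thesis using L by simp
qed

lemma sech_symbol_half_has_sum:
  assumes x: "x > 0"
  shows "((\<lambda>k::int. sech_half_term x (1/2 + of_int k)) has_sum (1 - sech_symbol x (1/2))) UNIV"
  using poisson_sech_squared[OF x, of "1/2"] sech_symbol_half_duality[OF x] by (simp add: sech_half_term_def)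

lemma sech_squared_weighted_deriv:
  "((\<lambda>t. t / (cosh t)\<^sup>2) has_real_derivative (cosh t - 2 * t * sinh t) / (cosh t) ^ 3) (at t)"
  using cosh_real_nonzero[of t]
  by (auto intro!: derivative_eq_intros simp: divide_simps) (simp add: algebra_simps power2_eq_square power3_eq_cube power4_eq_xxxx)

text \<open>
  The terms \<open>sech_half_term x u\<close> are multiples of \<open>t / cosh\<^sup>2 t\<close> at \<open>t = x u\<close>. In contrast to the alternating
  series, the sum of these terms has only positive terms, so that strict convexity in \<open>ln t\<close> can be used term by term.
\<close>

lemma sech_squared_weighted_pair:
  fixes r s t :: real
  assumes "33/20 \<le> s" "s < t" "s * t = r\<^sup>2" "r > 0"
  shows "2 * (r / (cosh r)\<^sup>2) < s / (cosh s)\<^sup>2 + t / (cosh t)\<^sup>2"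
proof (rule log_convex_pair[where lo = "33/20" and \<phi> = "\<lambda>t. t / (cosh t)\<^sup>2" and x = s and y = t and c = r
      and \<phi>' = "\<lambda>t. (cosh t - 2 * t * sinh t) / (cosh t) ^ 3"
      and D = "\<lambda>t. ((cosh t)\<^sup>2 - 6 * t * sinh t * cosh t - 2 * t\<^sup>2 * (cosh t)\<^sup>2 + 6 * t\<^sup>2 * (sinh t)\<^sup>2) / (cosh t) ^ 4"])
  fix t :: real assume t: "33/20 \<le> t"
  let ?c = "cosh t" and ?s = "sinh t"
  show "((\<lambda>t. t / (cosh t)\<^sup>2) has_real_derivative (?c - 2 * t * ?s) / ?c ^ 3) (at t)"
    by (rule sech_squared_weighted_deriv)
  have c: "?c > 0" by simp
  have "((\<lambda>t. t * ((cosh t - 2 * t * sinh t) / (cosh t) ^ 3)) has_real_derivative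
     (((1 * ?c + ?s * t) - (4 * t * ?s + 2 * t\<^sup>2 * ?c)) * ?c ^ 3 - (t * ?c - 2 * t\<^sup>2 * ?s) * (3 * ?c\<^sup>2 * ?s)) / (?c ^ 3 * ?c ^ 3)) (at t)"
  proof -
    have n: "((\<lambda>t. t * cosh t - 2 * t\<^sup>2 * sinh t) has_real_derivative (1 * ?c + ?s * t) - (4 * t * ?s + 2 * t\<^sup>2 * ?c)) (at t)"
      by (auto intro!: derivative_eq_intros)
    have d: "((\<lambda>t. cosh t ^ 3) has_real_derivative 3 * ?c\<^sup>2 * ?s) (at t)"
      by (auto intro!: derivative_eq_intros)
    have "(\<lambda>t. t * ((cosh t - 2 * t * sinh t) / (cosh t) ^ 3)) = (\<lambda>t::real. (t * cosh t - 2 * t\<^sup>2 * sinh t) / cosh t ^ 3)"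
      by (simp add: fun_eq_iff right_diff_distrib power2_eq_square)
    then show ?thesis using DERIV_divide[OF n d] c by simp
  qed
  also have "(((1 * ?c + ?s * t) - (4 * t * ?s + 2 * t\<^sup>2 * ?c)) * ?c ^ 3 - (t * ?c - 2 * t\<^sup>2 * ?s) * (3 * ?c\<^sup>2 * ?s)) / (?c ^ 3 * ?c ^ 3)
      = (?c\<^sup>2 - 6 * t * ?s * ?c - 2 * t\<^sup>2 * ?c\<^sup>2 + 6 * t\<^sup>2 * ?s\<^sup>2) / ?c ^ 4"
  proof -
    have num: "((1 * C + S * t) - (4 * t * S + 2 * t\<^sup>2 * C)) * C ^ 3 - (t * C - 2 * t\<^sup>2 * S) * (3 * C\<^sup>2 * S)
        = (C\<^sup>2 - 6 * t * S * C - 2 * t\<^sup>2 * C\<^sup>2 + 6 * t\<^sup>2 * S\<^sup>2) * C\<^sup>2" for C S :: real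
      by (simp add: algebra_simps power2_eq_square power3_eq_cube)
    have den: "?c ^ 3 * ?c ^ 3 = ?c ^ 4 * ?c\<^sup>2" by (simp flip: power_add)
    have "A * ?c\<^sup>2 / (?c ^ 4 * ?c\<^sup>2) = A / ?c ^ 4" for A
      by (rule nonzero_mult_divide_mult_cancel_right) (use c in simp)
    then show ?thesis unfolding num den .
  qed
  finally show "((\<lambda>t. t * ((cosh t - 2 * t * sinh t) / (cosh t) ^ 3)) has_real_derivative
     (?c\<^sup>2 - 6 * t * ?s * ?c - 2 * t\<^sup>2 * ?c\<^sup>2 + 6 * t\<^sup>2 * ?s\<^sup>2) / ?c ^ 4) (at t)" .
  have ratio: "13 * ?c \<le> 14 * ?s"
  proof -
    have "exp (33/10) \<le> exp (2 * t)" using t by simp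
    then have "27 \<le> exp (2 * t)" using exp_33_10_bounds(1) by linarith
    then have "27 \<le> exp t * exp t" by (simp flip: exp_add)
    then have "27 * exp (- t) \<le> exp t" by (simp add: exp_minus field_simps)
    then show ?thesis by (simp add: cosh_field_def sinh_field_def)
  qed
  \<comment> \<open>\<open>tanh t \<ge> 13/14\<close>, so \<open>m\<close> is a lower bound for \<open>t tanh t\<close>, in which the expression is increasing\<close>
  define m where "m = 13/14 * t"
  have w: "m * ?c \<le> t * ?s" using ratio t mult_left_mono[OF ratio, of t] by (simp add: m_def algebra_simps)
  have m1: "m \<ge> 1" using t by (simp add: m_def)
  have "0 \<le> 6 * ((t * ?s - m * ?c) * (t * ?s + m * ?c - ?c))"
  proof (intro mult_nonneg_nonneg)
    have "1 * ?c \<le> m * ?c" using m1 c by (intro mult_right_mono) auto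
    moreover have "0 \<le> m * ?c" using m1 c by simp
    ultimately show "0 \<le> t * ?s + m * ?c - ?c" using w by linarith
  qed (use w in auto)
  moreover have "0 < ?c\<^sup>2 * (1 - 6 * m + 6 * m\<^sup>2 - 2 * t\<^sup>2)"
  proof (intro mult_pos_pos)
    have "1 - 6 * m + 6 * m\<^sup>2 - 2 * t\<^sup>2 = 1 + t * (311 / 98 * t - 39 / 7)"
      by (simp add: m_def power2_eq_square algebra_simps)
    also have "\<dots> > 0"
    proof -
      define s where "s = t - 33/20"
      have s: "0 \<le> s" using t by (simp add: s_def)
      have "1 + t * (311 / 98 * t - 39 / 7) = 311/98 * (s * s) + (311/98 * (33/10) - 39/7) * s + (1 + 33/20 * (311/98 * (33/20) - 39/7))"
        by (simp add: s_def field_simps)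
      moreover have "0 \<le> 311/98 * (s * s)" "0 \<le> (311/98 * (33/10) - 39/7) * s" using s by simp_all
      moreover have "0 < 1 + 33/20 * (311/98 * (33/20) - 39/7 :: real)" by simp
      ultimately show ?thesis by (simp only: add_nonneg_pos add_nonneg_nonneg)
    qed
    finally show "0 < 1 - 6 * m + 6 * m\<^sup>2 - 2 * t\<^sup>2" .
  qed (use c in simp)
  moreover have "6 * ((t * S - m * C) * (t * S + m * C - C)) + C\<^sup>2 * (1 - 6 * m + 6 * m\<^sup>2 - 2 * t\<^sup>2)
      = C\<^sup>2 - 6 * t * S * C - 2 * t\<^sup>2 * C\<^sup>2 + 6 * t\<^sup>2 * S\<^sup>2" for C S :: real
    by (simp add: algebra_simps power2_eq_square)
  ultimately have "0 < ?c\<^sup>2 - 6 * t * ?s * ?c - 2 * t\<^sup>2 * ?c\<^sup>2 + 6 * t\<^sup>2 * ?s\<^sup>2" 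
    by (metis add_nonneg_pos)
  then show "0 < (?c\<^sup>2 - 6 * t * ?s * ?c - 2 * t\<^sup>2 * ?c\<^sup>2 + 6 * t\<^sup>2 * ?s\<^sup>2) / ?c ^ 4"
    using c by (intro divide_pos_pos) auto
qed (use assms in auto)

lemma sech_squared_weighted_antimono:
  fixes s t :: real
  assumes "1 \<le> s" "s \<le> t"
  shows "t / (cosh t)\<^sup>2 \<le> s / (cosh s)\<^sup>2"
proof (rule DERIV_nonpos_imp_nonincreasing[OF assms(2)])
  fix u assume "s \<le> u" "u \<le> t"
  then have u: "1 \<le> u" using assms by simp
  have "cosh u \<le> 2 * sinh u"
  proof -
    have "3 \<le> exp (2 * u)" using exp_ge_add_one_self[of "2 * u"] u by linarith
    then have "3 \<le> exp u * exp u" by (simp flip: exp_add)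
    then have "3 * exp (- u) \<le> exp u"
      by (simp add: exp_minus field_simps)
    then show ?thesis by (simp add: cosh_field_def sinh_field_def)
  qed
  also have "\<dots> \<le> 2 * u * sinh u" using u by simp
  finally have "(cosh u - 2 * u * sinh u) / (cosh u) ^ 3 \<le> 0" by (intro divide_nonpos_pos) auto
  then show "\<exists>y. ((\<lambda>t. t / (cosh t)\<^sup>2) has_real_derivative y) (at u) \<and> y \<le> 0"
    using sech_squared_weighted_deriv[of u] by blast
qed

lemma sech_squared_weighted_33_20: "33/20 / (cosh (33/20))\<^sup>2 > (2 * (109/1000) :: real)"
proof -
  define E where "E = exp (33/10 :: real)"
  have E: "27 \<le> E" "E \<le> 276/10" using exp_33_10_bounds by (auto simp: E_def)
  have "(cosh (33/20 :: real))\<^sup>2 = (E + 2 + inverse E) / 4"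
  proof -
    have "exp (33/20 :: real) * exp (33/20) = E" unfolding E_def by (simp flip: exp_add)
    moreover have "((e + inverse e) / 2)\<^sup>2 = (e * e + 2 + inverse (e * e)) / 4" if "e > 0" for e :: real
      using that by (simp add: power2_eq_square field_simps)
    ultimately show ?thesis by (metis cosh_field_def exp_gt_zero exp_minus)
  qed
  also have "\<dots> \<le> (276/10 + 2 + inverse 27) / 4"
    using E le_imp_inverse_le[of 27 E] by (intro divide_right_mono add_mono) auto
  also have "\<dots> \<le> 75/10" by simp
  finally have "33/20 / (75/10) \<le> 33/20 / (cosh (33/20 :: real))\<^sup>2"
    by (intro divide_left_mono mult_pos_pos) auto
  then show ?thesis by simp
qed

text \<open>
  The claim is that \<open>\<Lambda>(x) = 1 - \<sigma>\<^sub>x(1/2)\<close>, a sum of \<open>sech_half_term\<close>s, satisfies \<open>\<Lambda>(x) + \<Lambda>(y) > 2 \<Lambda>(c)\<close>.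
  If \<open>x \<ge> 33/10\<close>, convexity gives this for every term. Otherwise \<open>\<Lambda>(x)\<close> alone exceeds \<open>2 \<Lambda>(c)\<close>: by its two
  largest terms if \<open>x \<ge> 2\<close>, and by the duality, which makes \<open>\<Lambda>(x)\<close> close to \<open>1\<close>, if \<open>x < 2\<close>.
\<close>

theorem sech_symbol_half_strict:
  assumes "0 < x" "x < y" "x * y = c\<^sup>2" "c \<ge> 44/10"
  shows "sech_symbol x (1/2) + sech_symbol y (1/2) < 2 * sech_symbol c (1/2)"
proof -
  have pos: "y > 0" "c > 0" using assms by auto
  have L_nonneg: "1 - sech_symbol z (1/2) \<ge> 0" if "z > 0" for z
    by (rule has_sum_nonneg[OF sech_symbol_half_has_sum[OF that]]) (use that in \<open>auto simp: sech_half_term_def\<close>)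
  have Lc: "1 - sech_symbol c (1/2) \<le> 2 * (109/1000)" using sech_symbol_half_ge[OF assms(4)] by linarith
  consider "x \<ge> 33/10" | "2 \<le> x" "x < 33/10" | "x < 2" by linarith
  then show ?thesis
  proof cases
    case 1
    have strict: "2 * sech_half_term c (1/2 + of_int k) < sech_half_term x (1/2 + of_int k) + sech_half_term y (1/2 + of_int k)" for k :: int
    proof -
      define u :: real where "u = \<bar>1/2 + of_int k\<bar>"
      have u: "u \<ge> 1/2"
      proof (cases "k \<ge> 0")
        case True then show ?thesis by (simp add: u_def)
      next
        case False
        then have "real_of_int k \<le> -1" by linarith
        then show ?thesis by (simp add: u_def)
      qed
      have eq: "sech_half_term z (1/2 + of_int k) = (z * u) / (cosh (z * u))\<^sup>2 * (1 / (2 * u))" if "z > 0" for z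
      proof -
        have "cosh (z * (1/2 + of_int k)) = cosh (z * u)"
          using that unfolding u_def by (metis abs_mult abs_of_pos cosh_real_abs)
        then show ?thesis using u by (simp add: sech_half_term_def)
      qed
      have "2 * (c * u / (cosh (c * u))\<^sup>2) < x * u / (cosh (x * u))\<^sup>2 + y * u / (cosh (y * u))\<^sup>2"
      proof (rule sech_squared_weighted_pair)
        show "33/20 \<le> x * u" using mult_mono[OF 1 u] assms(1) by simp
        show "x * u * (y * u) = (c * u)\<^sup>2"
          unfolding power_mult_distrib assms(3)[symmetric] by (simp add: power2_eq_square)
      qed (use u assms pos in auto)
      then have "2 * (c * u / (cosh (c * u))\<^sup>2) * (1 / (2 * u)) < (x * u / (cosh (x * u))\<^sup>2 + y * u / (cosh (y * u))\<^sup>2) * (1 / (2 * u))"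
        using u by (intro mult_strict_right_mono) auto
      then show ?thesis unfolding eq[OF assms(1)] eq[OF pos(1)] eq[OF pos(2)] by (simp only: distrib_right mult.assoc)
    qed
    have "((\<lambda>k::int. 2 * sech_half_term c (1/2 + of_int k)) has_sum 2 * (1 - sech_symbol c (1/2))) UNIV"
      by (intro has_sum_cmult_right sech_symbol_half_has_sum pos)
    moreover have "((\<lambda>k::int. sech_half_term x (1/2 + of_int k) + sech_half_term y (1/2 + of_int k))
        has_sum ((1 - sech_symbol x (1/2)) + (1 - sech_symbol y (1/2)))) UNIV"
      by (intro has_sum_add sech_symbol_half_has_sum pos assms)
    ultimately have "2 * (1 - sech_symbol c (1/2)) < (1 - sech_symbol x (1/2)) + (1 - sech_symbol y (1/2))"
      by (rule has_sum_strict_mono[where x = 0]) (rule less_imp_le[OF strict] strict UNIV_I)+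
    then show ?thesis by (simp add: right_diff_distrib)
  next
    case 2
    \<comment> \<open>the two largest terms belong to \<open>u = 1/2\<close> and \<open>u = -1/2\<close>, that is, to \<open>t = x/2 \<in> [1, 33/20)\<close>\<close>
    have "2 * (33/20 / (cosh (33/20 :: real))\<^sup>2) \<le> 2 * (x / 2 / (cosh (x / 2))\<^sup>2)"
      using 2 by (intro mult_left_mono sech_squared_weighted_antimono) auto
    also have "\<dots> = (\<Sum>k\<in>{0, -1 :: int}. sech_half_term x (1/2 + of_int k))"
    proof -
      have "sech_half_term x (1/2 + of_int (-1)) = sech_half_term x (1/2 + of_int 0)"
        unfolding sech_half_term_def by simp
      then show ?thesis by (simp add: sech_half_term_def)
    qed
    also have "\<dots> \<le> 1 - sech_symbol x (1/2)"
      by (rule finite_sum_le_has_sum[OF sech_symbol_half_has_sum[OF assms(1)]]) (use assms in \<open>auto simp: sech_half_term_def\<close>)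
    finally show ?thesis using sech_squared_weighted_33_20 L_nonneg[OF pos(1)] Lc by linarith
  next
    case 3
    have p: "pi\<^sup>2 / x \<ge> 44/10"
    proof -
      have "(3::real)\<^sup>2 \<le> pi\<^sup>2" using pi_gt3 by (intro power_mono) auto
      moreover have "44/10 * x \<le> 9" using 3 by simp
      ultimately have "44/10 * x \<le> pi\<^sup>2" by simp
      then show ?thesis using assms(1) by (simp add: le_divide_eq)
    qed
    have "sech_symbol x (1/2) \<le> 2 * (109/1000)"
      using sech_symbol_half_duality[OF assms(1)] sech_symbol_half_ge[OF p] by linarith
    then show ?thesis using L_nonneg[OF pos(1)] Lc by linarith
  qed
qed

section \<open>Telescoping sums of window products\<close>

text \<open>
  Unordered sums of extended nonnegative reals are treated as integrals over counting measure, where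
  the theorems of Tonelli and Fubini apply.
\<close>

lemma nn_integral_count_space_eq_SUP:
  fixes f :: "'a::countable \<Rightarrow> ennreal"
  shows "(\<integral>\<^sup>+x. f x \<partial>count_space UNIV) = (SUP F\<in>{F. finite F}. \<Sum>x\<in>F. f x)"
proof (rule antisym)
  have fin: "(\<Sum>x\<in>F. f x) \<le> (SUP F\<in>{F. finite F}. \<Sum>x\<in>F. f x)" if "finite F" for F
    using that by (intro SUP_upper) auto
  show "(\<integral>\<^sup>+x. f x \<partial>count_space UNIV) \<le> (SUP F\<in>{F. finite F}. \<Sum>x\<in>F. f x)"
  proof -
    define g where "g = (\<lambda>i. f (from_nat i) * indicator (range (to_nat :: 'a \<Rightarrow> nat)) i)"
    have bij: "bij_betw (to_nat :: 'a \<Rightarrow> nat) UNIV (range (to_nat :: 'a \<Rightarrow> nat))"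
      by (rule bij_betw_imageI[OF inj_to_nat refl])
    have "(\<integral>\<^sup>+x. f x \<partial>count_space UNIV) = (\<integral>\<^sup>+x. f (from_nat (to_nat (x :: 'a))) \<partial>count_space UNIV)" by simp
    also have "\<dots> = (\<integral>\<^sup>+i. f (from_nat i) \<partial>count_space (range (to_nat :: 'a \<Rightarrow> nat)))"
      by (rule nn_integral_bij_count_space[OF bij])
    also have "\<dots> = (\<integral>\<^sup>+i. g i \<partial>count_space UNIV)"
      unfolding g_def by (rule nn_integral_count_space_indicator) simp
    also have "\<dots> = (\<Sum>i. g i)" by (rule nn_integral_count_space_nat)
    also have "\<dots> = (SUP N. \<Sum>i<N. g i)" by (rule suminf_eq_SUP)
    also have "\<dots> \<le> (SUP F\<in>{F. finite F}. \<Sum>x\<in>F. f x)"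
    proof (rule SUP_least)
      fix N
      have "(\<Sum>i<N. g i) = (\<Sum>i\<in>{..<N} \<inter> range (to_nat :: 'a \<Rightarrow> nat). f (from_nat i))"
      proof -
        have "g i = (if i \<in> range (to_nat :: 'a \<Rightarrow> nat) then f (from_nat i) else 0)" for i
          by (simp add: g_def)
        then show ?thesis by (simp only: sum.inter_restrict[OF finite_lessThan])
      qed
      also have "\<dots> = (\<Sum>x\<in>(to_nat :: 'a \<Rightarrow> nat) -` {..<N}. f x)"
        by (rule sum.reindex_cong[of to_nat]) (auto simp: image_iff inj_on_def)
      also have "\<dots> \<le> (SUP F\<in>{F. finite F}. \<Sum>x\<in>F. f x)"
        by (intro fin finite_vimageI) auto
      finally show "(\<Sum>i<N. g i) \<le> (SUP F\<in>{F. finite F}. \<Sum>x\<in>F. f x)" .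
    qed
    finally show ?thesis .
  qed
  show "(SUP F\<in>{F. finite F}. \<Sum>x\<in>F. f x) \<le> (\<integral>\<^sup>+x. f x \<partial>count_space UNIV)"
  proof (rule SUP_least)
    fix F :: "'a set" assume "F \<in> {F. finite F}"
    then have "(\<Sum>x\<in>F. f x) = (\<integral>\<^sup>+x. f x \<partial>count_space F)" by (simp add: nn_integral_count_space_finite)
    also have "\<dots> = (\<integral>\<^sup>+x. f x * indicator F x \<partial>count_space UNIV)"
      by (rule nn_integral_count_space_indicator) simp
    also have "\<dots> \<le> (\<integral>\<^sup>+x. f x \<partial>count_space UNIV)" by (intro nn_integral_mono) (auto split: split_indicator)
    finally show "(\<Sum>x\<in>F. f x) \<le> (\<integral>\<^sup>+x. f x \<partial>count_space UNIV)" .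
  qed
qed

lemma infsum_ennreal_eq_nn_integral:
  fixes f :: "'a::countable \<Rightarrow> ennreal"
  shows "(\<Sum>\<^sub>\<infinity>x. f x) = (\<integral>\<^sup>+x. f x \<partial>count_space UNIV)"
  unfolding nn_integral_count_space_eq_SUP by (subst nonneg_infsum_complete) auto

lemma nn_integral_count_space_has_sum:
  fixes h :: "'a::countable \<Rightarrow> real"
  assumes "(h has_sum S) UNIV" "\<And>x. h x \<ge> 0"
  shows "(\<integral>\<^sup>+x. ennreal (h x) \<partial>count_space UNIV) = ennreal S"
proof -
  have "ennreal S = (SUP F\<in>{F. finite F \<and> F \<subseteq> UNIV}. ennreal (sum h F))"
    using infsum_nonneg_is_SUPREMUM_ennreal[OF has_sum_imp_summable[OF assms(1)]] assms(2) infsumI[OF assms(1)] by simp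
  also have "\<dots> = (SUP F\<in>{F. finite F}. \<Sum>x\<in>F. ennreal (h x))"
    using assms(2) by (simp add: sum_ennreal)
  finally show ?thesis by (simp add: nn_integral_count_space_eq_SUP)
qed

lemma nonneg_symmetric_limit_has_sum:
  fixes h :: "int \<Rightarrow> real"
  assumes h: "\<And>k. h k \<ge> 0" and lim: "(\<lambda>N. \<Sum>k\<in>{- int N..int N}. h k) \<longlonglongrightarrow> S"
  shows "(h has_sum S) UNIV"
proof -
  have inc: "incseq (\<lambda>N. \<Sum>k\<in>{- int N..int N}. h k)"
    unfolding incseq_def using h by (intro allI impI sum_mono2) auto
  have "h summable_on UNIV"
  proof (rule nonneg_bdd_above_summable_on[OF h], rule bdd_aboveI[of _ S])
    fix s assume "s \<in> sum h ` {F. F \<subseteq> UNIV \<and> finite F}"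
    then obtain F where F: "finite F" "s = sum h F" by auto
    define M where "M = nat (Max (abs ` insert 0 F))"
    have "F \<subseteq> {- int M..int M}"
    proof
      fix k assume "k \<in> F"
      then have "\<bar>k\<bar> \<le> Max (abs ` insert 0 F)" using F by (intro Max_ge) auto
      then show "k \<in> {- int M..int M}" by (simp add: M_def abs_le_iff)
    qed
    then have "s \<le> (\<Sum>k\<in>{- int M..int M}. h k)" unfolding F(2) using h by (intro sum_mono2) auto
    also have "\<dots> \<le> S" by (rule incseq_le[OF inc lim])
    finally show "s \<le> S" .
  qed
  then obtain T where T: "(h has_sum T) UNIV" by (auto simp: summable_on_def)
  from LIMSEQ_unique[OF has_sum_int_imp_symmetric_limit[OF T] lim] T show ?thesis by (simp only:)
qed

lemma tanh_telescoping_has_sum: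
  fixes \<alpha> u :: real
  assumes \<alpha>: "\<alpha> > 0"
  shows "((\<lambda>k::int. tanh (u - \<alpha> * of_int k) - tanh (u - \<alpha> * of_int (k + 1))) has_sum 2) UNIV"
proof (rule nonneg_symmetric_limit_has_sum)
  show "0 \<le> tanh (u - \<alpha> * of_int k) - tanh (u - \<alpha> * of_int (k + 1))" for k :: int
    using \<alpha> by (simp add: algebra_simps)
  have eq: "(\<Sum>k\<in>{- int N..int N}. tanh (u - \<alpha> * of_int k) - tanh (u - \<alpha> * of_int (k + 1)))
      = tanh (u + \<alpha> * real N) - tanh (u - \<alpha> * (real N + 1))" for N
  proof (induction N)
    case (Suc N)
    have "{- int (Suc N)..int (Suc N)} = insert (- int (Suc N)) (insert (int (Suc N)) {- int N..int N})" by auto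
    then have "(\<Sum>k\<in>{- int (Suc N)..int (Suc N)}. tanh (u - \<alpha> * of_int k) - tanh (u - \<alpha> * of_int (k + 1)))
      = (tanh (u - \<alpha> * of_int (- int (Suc N))) - tanh (u - \<alpha> * of_int (- int (Suc N) + 1)))
       + ((tanh (u - \<alpha> * of_int (int (Suc N))) - tanh (u - \<alpha> * of_int (int (Suc N) + 1)))
       + (tanh (u + \<alpha> * real N) - tanh (u - \<alpha> * (real N + 1))))"
      using Suc.IH by simp
    also have "\<dots> = tanh (u + \<alpha> * real (Suc N)) - tanh (u - \<alpha> * (real (Suc N) + 1))"
      by (simp add: algebra_simps)
    finally show ?case .
  qed simp
  have "filterlim (\<lambda>N. u + \<alpha> * real N) at_top sequentially"
    using \<alpha> by (intro filterlim_tendsto_add_at_top[OF tendsto_const] filterlim_tendsto_pos_mult_at_top[OF tendsto_const] filterlim_real_sequentially)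
  then have "(\<lambda>N. tanh (u + \<alpha> * real N)) \<longlonglongrightarrow> 1"
    by (rule filterlim_compose[OF tanh_real_at_top])
  moreover have "filterlim (\<lambda>N. (\<alpha> - u) + \<alpha> * real N) at_top sequentially"
    using \<alpha> by (intro filterlim_tendsto_add_at_top[OF tendsto_const] filterlim_tendsto_pos_mult_at_top[OF tendsto_const] filterlim_real_sequentially)
  then have "(\<lambda>N. tanh ((\<alpha> - u) + \<alpha> * real N)) \<longlonglongrightarrow> 1"
    by (rule filterlim_compose[OF tanh_real_at_top])
  then have "(\<lambda>N. - tanh ((\<alpha> - u) + \<alpha> * real N)) \<longlonglongrightarrow> - 1" by (rule tendsto_minus)
  then have "(\<lambda>N. tanh (u - \<alpha> * (real N + 1))) \<longlonglongrightarrow> - 1"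
    unfolding tanh_minus[symmetric] by (simp add: algebra_simps)
  ultimately have "(\<lambda>N. tanh (u + \<alpha> * real N) - tanh (u - \<alpha> * (real N + 1))) \<longlonglongrightarrow> 1 - (- 1)"
    by (rule tendsto_diff)
  then show "(\<lambda>N. \<Sum>k\<in>{- int N..int N}. tanh (u - \<alpha> * of_int k) - tanh (u - \<alpha> * of_int (k + 1))) \<longlonglongrightarrow> 2"
    unfolding eq by simp
qed

lemma has_sum_finite_sum:
  fixes f :: "'i \<Rightarrow> 'a \<Rightarrow> 'b::topological_comm_monoid_add"
  assumes "\<And>i. i \<in> I \<Longrightarrow> ((\<lambda>x. f i x) has_sum S i) A"
  shows "((\<lambda>x. \<Sum>i\<in>I. f i x) has_sum (\<Sum>i\<in>I. S i)) A"
  using assms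
proof (induction I rule: infinite_finite_induct)
  case (insert i I)
  then show ?case by (simp add: has_sum_add)
qed simp_all

text \<open>
  The key identity of the proof. Since \<open>sinh(A - B) = sinh A cosh B - cosh A sinh B\<close>, the product
  \<open>1/(cosh A cosh B)\<close> is \<open>(tanh A - tanh B) / sinh(A - B)\<close>. When \<open>A - B\<close> is \<open>N\<close> steps of the lattice, the sum
  over the lattice telescopes, and its value does not depend on \<open>u\<close>.
\<close>

lemma sech_product_has_sum:
  fixes \<alpha> u :: real
  assumes \<alpha>: "\<alpha> > 0" and N: "N \<ge> 1"
  shows "((\<lambda>k::int. 1 / (cosh (u - \<alpha> * of_int k) * cosh (u - \<alpha> * real N - \<alpha> * of_int k))) has_sum
     (2 * real N / sinh (\<alpha> * real N))) UNIV"
proof -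
  have s: "sinh (\<alpha> * real N) > 0" using \<alpha> N by simp
  have tele: "1 / (cosh (u - \<alpha> * of_int k) * cosh (u - \<alpha> * real N - \<alpha> * of_int k))
     = (1 / sinh (\<alpha> * real N)) * (\<Sum>i<N. tanh ((u - \<alpha> * real i) - \<alpha> * of_int k) - tanh ((u - \<alpha> * real i) - \<alpha> * of_int (k + 1)))" for k :: int
  proof -
    define A where "A = u - \<alpha> * of_int k"
    have "(\<Sum>i<N. tanh ((u - \<alpha> * real i) - \<alpha> * of_int k) - tanh ((u - \<alpha> * real i) - \<alpha> * of_int (k + 1)))
       = (\<Sum>i<N. tanh (A - \<alpha> * real i) - tanh (A - \<alpha> * real (Suc i)))"
      by (intro sum.cong refl) (simp add: A_def algebra_simps)
    also have "\<dots> = tanh A - tanh (A - \<alpha> * real N)"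
      using sum_lessThan_telescope'[of "\<lambda>i. tanh (A - \<alpha> * real i)" N] by simp
    also have "\<dots> = sinh (\<alpha> * real N) / (cosh A * cosh (A - \<alpha> * real N))"
    proof -
      have "sinh (\<alpha> * real N) = sinh (A - (A - \<alpha> * real N))" by simp
      also have "\<dots> = sinh A * cosh (A - \<alpha> * real N) - cosh A * sinh (A - \<alpha> * real N)" by (rule sinh_diff)
      finally have eq: "sinh (\<alpha> * real N) = sinh A * cosh (A - \<alpha> * real N) - cosh A * sinh (A - \<alpha> * real N)" .
      show ?thesis unfolding eq tanh_def by (simp add: divide_simps)
    qed
    finally have "(1 / sinh (\<alpha> * real N)) * (\<Sum>i<N. tanh ((u - \<alpha> * real i) - \<alpha> * of_int k) - tanh ((u - \<alpha> * real i) - \<alpha> * of_int (k + 1)))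
      = 1 / (cosh A * cosh (A - \<alpha> * real N))" using s \<alpha> N by simp
    moreover have "A - \<alpha> * real N = u - \<alpha> * real N - \<alpha> * of_int k" by (simp add: A_def)
    ultimately show ?thesis by (simp only: A_def)
  qed
  have "((\<lambda>k::int. \<Sum>i<N. tanh ((u - \<alpha> * real i) - \<alpha> * of_int k) - tanh ((u - \<alpha> * real i) - \<alpha> * of_int (k + 1))) has_sum (\<Sum>i<N. 2)) UNIV"
    by (intro has_sum_finite_sum tanh_telescoping_has_sum \<alpha>)
  from has_sum_cmult_right[OF this, of "1 / sinh (\<alpha> * real N)"]
  show ?thesis unfolding tele by (simp add: mult.commute)
qed

section \<open>Quadratic forms on the fibres\<close>

text \<open>
  Lattice parameters of integer density. With \<open>p = 1/b = n a\<close> the period of the modulations is a multiple of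
  the translation step; integrality of \<open>n\<close> enters through this only.
\<close>

locale sech_lattice =
  fixes n :: nat and a b :: real
  assumes n: "n \<ge> 1" and a: "a > 0" and b: "b > 0" and nab: "real n * a * b = 1"
begin

definition p :: real where "p = real n * a"

abbreviation time_symbol :: "real \<Rightarrow> real" where
  "time_symbol \<equiv> sech_symbol (pi * (real n * b))"

abbreviation freq_symbol :: "real \<Rightarrow> real" where
  "freq_symbol \<equiv> sech_symbol (pi * p)"

abbreviation gabor_sum :: "(real \<Rightarrow> complex) \<Rightarrow> ennreal" where
  "gabor_sum \<equiv> frame_sum sech_window (rect_lattice a b)"

lemma p_pos: "p > 0" using n a by (simp add: p_def)
lemma b_times_p: "b * p = 1" using nab by (simp add: p_def mult_ac)
lemma xy_pos: "pi * p > 0" "pi * (real n * b) > 0" using p_pos n b by auto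

definition real_window :: "real \<Rightarrow> real" where "real_window t = sqrt (pi / 2) * (1 / cosh (pi * t))"

lemma sech_window_eq: "sech_window t = of_real (real_window t)" by (simp add: sech_window_def real_window_def)

lemma continuous_real_window [continuous_intros]: "continuous_on A f \<Longrightarrow> continuous_on A (\<lambda>t. real_window (f t))"
  unfolding real_window_def by (intro continuous_intros) auto

lemma measurable_real_window [measurable]: "real_window \<in> borel_measurable borel"
  by (intro borel_measurable_continuous_onI continuous_real_window continuous_on_id)

lemma real_window_mult: "real_window s * real_window t = pi / 2 * (1 / (cosh (pi * s) * cosh (pi * t)))"
proof -
  have "(r * (1 / A)) * (r * (1 / B)) = r * r * (1 / (A * B))" for r A B :: real by simp
  moreover have "sqrt (pi / 2) * sqrt (pi / 2) = pi / 2" by simp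
  ultimately show ?thesis unfolding real_window_def by (simp only:)
qed

text \<open>
  Translates of the window by different multiples of \<open>p\<close> have a lattice-summed product that is a constant: the
  Gram entries form a Toeplitz matrix that does not depend on the point \<open>t\<close>.
\<close>

lemma gram_off_diagonal:
  assumes "i \<noteq> j"
  shows "((\<lambda>k::int. p * (real_window (t + of_int i * p - a * of_int k) * real_window (t + of_int j * p - a * of_int k)))
     has_sum real n * xsinh (pi * p * of_int (i - j))) UNIV"
proof -
  have main: "((\<lambda>k::int. p * (real_window (t + of_int i * p - a * of_int k) * real_window (t + of_int j * p - a * of_int k)))
     has_sum real n * xsinh (pi * p * of_int (i - j))) UNIV" if ij: "j < i" for i j :: int
  proof -
    define N where "N = n * nat (i - j)"
    have N: "N \<ge> 1" using n ij by (simp add: N_def)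
    have rN: "real N = real n * of_int (i - j)" using ij by (simp add: N_def)
    have aN: "pi * a * real N = pi * p * of_int (i - j)" by (simp add: rN p_def)
    define u where "u = pi * (t + of_int i * p)"
    have "((\<lambda>k::int. (p * (pi / 2)) * (1 / (cosh (u - pi * a * of_int k) * cosh (u - pi * a * real N - pi * a * of_int k)))) has_sum
       (p * (pi / 2)) * (2 * real N / sinh (pi * a * real N))) UNIV"
      by (intro has_sum_cmult_right sech_product_has_sum N) (use a in simp)
    moreover have "(p * (pi / 2)) * (1 / (cosh (u - pi * a * of_int k) * cosh (u - pi * a * real N - pi * a * of_int k)))
       = p * (real_window (t + of_int i * p - a * of_int k) * real_window (t + of_int j * p - a * of_int k))" for k :: int
    proof -
      have "pi * (t + of_int i * p - a * of_int k) = u - pi * a * of_int k" by (simp add: u_def algebra_simps)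
      moreover have "pi * (t + of_int j * p - a * of_int k) = u - pi * a * real N - pi * a * of_int k"
        unfolding aN by (simp add: u_def algebra_simps)
      ultimately show ?thesis unfolding real_window_mult by (simp only: mult.assoc)
    qed
    moreover have "(p * (pi / 2)) * (2 * real N / sinh (pi * a * real N)) = real n * xsinh (pi * p * of_int (i - j))"
    proof -
      have "pi * p * of_int (i - j) > 0" using p_pos ij by simp
      then have "pi * p * of_int (i - j) \<noteq> 0" by linarith
      then have x: "xsinh (pi * p * of_int (i - j)) = pi * p * of_int (i - j) / sinh (pi * p * of_int (i - j))"
        unfolding xsinh_def by (simp only: if_False)
      have "(p * (pi / 2)) * (2 * real N) = real n * (pi * p * of_int (i - j))" unfolding rN by simp
      then show ?thesis unfolding aN x by (simp only: times_divide_eq_right)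
    qed
    ultimately show ?thesis by (simp only:)
  qed
  show ?thesis
  proof (cases "j < i")
    case True then show ?thesis by (rule main)
  next
    case False
    then have "i < j" using assms by simp
    from main[OF this] have "((\<lambda>k::int. p * (real_window (t + of_int i * p - a * of_int k) * real_window (t + of_int j * p - a * of_int k)))
       has_sum real n * xsinh (pi * p * of_int (j - i))) UNIV" by (simp only: mult.commute[of "real_window (t + of_int j * p - _)"])
    moreover have "pi * p * of_int (j - i) = - (pi * p * of_int (i - j))" by (simp add: algebra_simps)
    ultimately show ?thesis by (simp only: xsinh_minus)
  qed
qed

text \<open>
  On the diagonal nothing telescopes; the sum is a periodized squared secant, hence a symbol
  by Poisson summation.
\<close>

lemma gram_diagonal:
  "((\<lambda>k::int. p * (real_window (t + of_int j * p - a * of_int k) * real_window (t + of_int j * p - a * of_int k)))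
     has_sum real n * time_symbol (t / a)) UNIV"
proof -
  define \<theta> where "\<theta> = t / a + of_int (j * int n)"
  have y: "pi * a > 0" using a by simp
  have "pi\<^sup>2 / (pi * a) = pi * (real n * b)"
  proof -
    have "1 / a = real n * b" using nab a by (simp add: field_simps)
    moreover have "pi\<^sup>2 / (pi * a) = pi * (1 / a)" using a by (simp add: power2_eq_square)
    ultimately show ?thesis by (simp only:)
  qed
  with poisson_sech_squared[OF y, of \<theta>]
  have "((\<lambda>k::int. pi * a / 2 / (cosh (pi * a * (\<theta> + of_int k)))\<^sup>2) has_sum time_symbol \<theta>) UNIV"
    by (simp only:)
  moreover have "time_symbol \<theta> = time_symbol (t / a)"
    unfolding \<theta>_def by (rule sech_symbol_periodic)
  ultimately have "((\<lambda>k::int. pi * a / 2 / (cosh (pi * a * (\<theta> + of_int k)))\<^sup>2) has_sum time_symbol (t / a)) (range uminus)"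
    by (simp only: surj_uminus_int)
  then have "((\<lambda>k::int. pi * a / 2 / (cosh (pi * a * (\<theta> + of_int (- k))))\<^sup>2) has_sum time_symbol (t / a)) UNIV"
    by (subst (asm) has_sum_reindex) (simp_all add: o_def)
  from has_sum_cmult_right[OF this, of "real n"]
  have "((\<lambda>k::int. real n * (pi * a / 2 / (cosh (pi * a * (\<theta> + of_int (- k))))\<^sup>2)) has_sum real n * time_symbol (t / a)) UNIV" .
  moreover have "real n * (pi * a / 2 / (cosh (pi * a * (\<theta> + of_int (- k))))\<^sup>2)
     = p * (real_window (t + of_int j * p - a * of_int k) * real_window (t + of_int j * p - a * of_int k))" for k :: int
  proof -
    have arg: "pi * (t + of_int j * p - a * of_int k) = pi * a * (\<theta> + of_int (- k))"
      using a by (simp add: \<theta>_def p_def field_simps)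
    show ?thesis unfolding real_window_mult arg by (simp add: p_def power2_eq_square)
  qed
  ultimately show ?thesis by (simp only:)
qed

text \<open>
  The Toeplitz form also contains the diagonal entries \<open>xsinh 0 = 1\<close>, which is why \<open>1\<close> is subtracted in
  the next definition.
\<close>

definition toeplitz_form :: "int set \<Rightarrow> (int \<Rightarrow> complex) \<Rightarrow> complex" where
  "toeplitz_form J v = (\<Sum>i\<in>J. \<Sum>j\<in>J. v i * cnj (v j) * of_real (xsinh (pi * p * of_int (i - j))))"

definition fibre_form :: "real \<Rightarrow> int set \<Rightarrow> (int \<Rightarrow> complex) \<Rightarrow> real" where
  "fibre_form s J v = real n * ((time_symbol (real n * s) - 1) * (\<Sum>j\<in>J. (norm (v j))\<^sup>2)
     + Re (toeplitz_form J v))"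

text \<open>
  Here \<open>v j\<close> stands for \<open>f(p(s+j))\<close>. Expanding the square and summing over the translations \<open>k\<close> gives the
  Gram entries computed above.
\<close>

lemma fibre_form_has_sum:
  assumes J: "finite J"
  shows "((\<lambda>k::int. p * (norm (\<Sum>j\<in>J. v j * of_real (real_window (p * (s + of_int j) - a * of_int k))))\<^sup>2) has_sum fibre_form s J v) UNIV"
proof -
  let ?W = "time_symbol (real n * s)"
  define \<Gamma> where "\<Gamma> = (\<lambda>i j. if i = j then real n * ?W else real n * xsinh (pi * p * of_int (i - j)))"
  let ?g = "\<lambda>j k. real_window (p * (s + of_int j) - a * of_int k)"
  have arg: "p * (s + of_int j) - a * of_int k = p * s + of_int j * p - a * of_int k" for j k :: int
    by (simp add: algebra_simps)
  have psa: "p * s / a = real n * s" using a by (simp add: p_def)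
  have \<Gamma>: "((\<lambda>k::int. p * (?g i k * ?g j k)) has_sum \<Gamma> i j) UNIV" for i j
  proof (cases "i = j")
    case True
    then show ?thesis unfolding arg \<Gamma>_def using gram_diagonal[of "p * s" j]
      by (simp only: psa refl if_True)
  next
    case False
    then show ?thesis unfolding arg \<Gamma>_def using gram_off_diagonal[OF False, of "p * s"]
      by (simp only: if_False)
  qed
  have eq: "complex_of_real (p * (norm (\<Sum>j\<in>J. v j * of_real (?g j k)))\<^sup>2)
     = (\<Sum>i\<in>J. \<Sum>j\<in>J. v i * cnj (v j) * of_real (p * (?g i k * ?g j k)))" for k
  proof -
    have "complex_of_real (p * (norm (\<Sum>j\<in>J. v j * of_real (?g j k)))\<^sup>2)
       = of_real p * ((\<Sum>i\<in>J. v i * of_real (?g i k)) * cnj (\<Sum>j\<in>J. v j * of_real (?g j k)))"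
      by (simp only: of_real_mult complex_norm_square)
    also have "\<dots> = (\<Sum>i\<in>J. \<Sum>j\<in>J. of_real p * ((v i * of_real (?g i k)) * (cnj (v j) * of_real (?g j k))))"
      unfolding cnj_sum complex_cnj_mult complex_cnj_complex_of_real sum_product
      unfolding sum_distrib_left ..
    also have "\<dots> = (\<Sum>i\<in>J. \<Sum>j\<in>J. v i * cnj (v j) * of_real (p * (?g i k * ?g j k)))"
      by (intro sum.cong refl) (simp only: of_real_mult mult_ac)
    finally show ?thesis .
  qed
  have "((\<lambda>k. complex_of_real (p * (norm (\<Sum>j\<in>J. v j * of_real (?g j k)))\<^sup>2)) has_sum
      (\<Sum>i\<in>J. \<Sum>j\<in>J. v i * cnj (v j) * of_real (\<Gamma> i j))) UNIV"
    unfolding eq by (intro has_sum_finite_sum has_sum_cmult_right has_sum_of_real \<Gamma>)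
  from has_sum_Re[OF this]
  have "((\<lambda>k. p * (norm (\<Sum>j\<in>J. v j * of_real (?g j k)))\<^sup>2) has_sum
      Re (\<Sum>i\<in>J. \<Sum>j\<in>J. v i * cnj (v j) * of_real (\<Gamma> i j))) UNIV" by (simp only: Re_complex_of_real)
  moreover have "Re (\<Sum>i\<in>J. \<Sum>j\<in>J. v i * cnj (v j) * of_real (\<Gamma> i j)) = fibre_form s J v"
  proof -
    have "v i * cnj (v j) * of_real (\<Gamma> i j) = of_real (real n) * (v i * cnj (v j) * of_real (xsinh (pi * p * of_int (i - j))))
        + (if i = j then of_real (real n * (?W - 1) * (norm (v i))\<^sup>2) else 0)" for i j
    proof (cases "i = j")
      case True
      show ?thesis unfolding True \<Gamma>_def of_real_mult complex_norm_square by (simp add: algebra_simps)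
    next
      case False
      then show ?thesis by (simp add: \<Gamma>_def)
    qed
    then have "(\<Sum>i\<in>J. \<Sum>j\<in>J. v i * cnj (v j) * of_real (\<Gamma> i j)) = of_real (real n) * toeplitz_form J v
       + (\<Sum>i\<in>J. of_real (real n * (?W - 1) * (norm (v i))\<^sup>2))"
      unfolding toeplitz_form_def using J by (simp add: sum.distrib sum_distrib_left)
    also have "(\<Sum>i\<in>J. complex_of_real (real n * (?W - 1) * (norm (v i))\<^sup>2))
        = of_real (real n * ((?W - 1) * (\<Sum>i\<in>J. (norm (v i))\<^sup>2)))"
      by (simp only: of_real_sum of_real_mult sum_distrib_left mult.assoc)
    also have "Re (of_real (real n) * toeplitz_form J v + \<dots>) = fibre_form s J v"
      by (simp add: fibre_form_def distrib_left)
    finally show ?thesis .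
  qed
  ultimately show ?thesis by (simp only:)
qed

text \<open>
  The form equals \<open>\<integral> \<sigma>(\<xi>) \<bar>V(\<xi>)\<bar>\<^sup>2 d\<xi>\<close> for the trigonometric polynomial \<open>V\<close> with coefficients \<open>v\<close>,
  while \<open>\<integral> \<bar>V\<bar>\<^sup>2\<close> is the sum of the squares.
\<close>

lemma toeplitz_form_bounds:
  assumes J: "finite J" and m: "\<And>\<xi>. m \<le> freq_symbol \<xi>" and M: "\<And>\<xi>. freq_symbol \<xi> \<le> M"
  shows "m * (\<Sum>j\<in>J. (norm (v j))\<^sup>2) \<le> Re (toeplitz_form J v)"
    and "Re (toeplitz_form J v) \<le> M * (\<Sum>j\<in>J. (norm (v j))\<^sup>2)"
proof -
  let ?C = "freq_symbol"
  define V where "V = (\<lambda>\<xi>. \<Sum>j\<in>J. v j * fourier_mode (- j) \<xi>)"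
  have [measurable]: "?C \<in> borel_measurable borel"
    by (intro borel_measurable_continuous_onI continuous_sech_symbol xy_pos)
  have [measurable]: "V \<in> borel_measurable borel" unfolding V_def by measurable
  define B where "B = max \<bar>m\<bar> \<bar>M\<bar>"
  have CB: "\<bar>?C \<xi>\<bar> \<le> B" for \<xi> using m[of \<xi>] M[of \<xi>] by (simp add: B_def)
  have exp_VV: "V \<xi> * cnj (V \<xi>) = (\<Sum>i\<in>J. \<Sum>j\<in>J. v i * cnj (v j) * fourier_mode (- (i - j)) \<xi>)" for \<xi>
  proof -
    have "V \<xi> * cnj (V \<xi>) = (\<Sum>i\<in>J. \<Sum>j\<in>J. (v i * fourier_mode (- i) \<xi>) * (cnj (v j) * fourier_mode j \<xi>))"
      by (simp add: V_def sum_product cnj_fourier_mode)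
    also have "\<dots> = (\<Sum>i\<in>J. \<Sum>j\<in>J. v i * cnj (v j) * fourier_mode (- (i - j)) \<xi>)"
    proof (intro sum.cong refl)
      fix i j
      have "fourier_mode (- (i - j)) \<xi> = fourier_mode (- i) \<xi> * fourier_mode j \<xi>"
        by (simp add: fourier_mode_mult)
      then show "(v i * fourier_mode (- i) \<xi>) * (cnj (v j) * fourier_mode j \<xi>) = v i * cnj (v j) * fourier_mode (- (i - j)) \<xi>"
        by (simp only: mult_ac)
    qed
    finally show ?thesis .
  qed
  have gen: "(LINT \<xi>|torus. of_real (h \<xi>) * (V \<xi> * cnj (V \<xi>)))
     = (\<Sum>i\<in>J. \<Sum>j\<in>J. v i * cnj (v j) * fourier_coeff (\<lambda>\<xi>. of_real (h \<xi>)) (i - j))"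
    if [measurable]: "h \<in> borel_measurable borel" and h: "\<And>\<xi>. \<bar>h \<xi>\<bar> \<le> B'" for h B'
  proof -
    have i: "integrable torus (\<lambda>\<xi>. of_real (h \<xi>) * fourier_mode l \<xi>)" for l
      by (rule integrable_torus_bounded[where B = B']) (use h in \<open>auto simp: norm_mult\<close>)
    have "(LINT \<xi>|torus. of_real (h \<xi>) * (V \<xi> * cnj (V \<xi>)))
      = (LINT \<xi>|torus. (\<Sum>i\<in>J. \<Sum>j\<in>J. v i * cnj (v j) * (of_real (h \<xi>) * fourier_mode (- (i - j)) \<xi>)))"
      unfolding exp_VV sum_distrib_left by (simp only: mult.left_commute)
    also have "\<dots> = (\<Sum>i\<in>J. \<Sum>j\<in>J. (LINT \<xi>|torus. v i * cnj (v j) * (of_real (h \<xi>) * fourier_mode (- (i - j)) \<xi>)))"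
      by (subst Bochner_Integration.integral_sum, intro Bochner_Integration.integrable_sum integrable_mult_right i,
          intro sum.cong refl Bochner_Integration.integral_sum integrable_mult_right i)
    also have "\<dots> = (\<Sum>i\<in>J. \<Sum>j\<in>J. v i * cnj (v j) * fourier_coeff (\<lambda>\<xi>. of_real (h \<xi>)) (i - j))"
      unfolding fourier_coeff_def by (simp only: integral_mult_right_zero)
    finally show ?thesis .
  qed
  have VV: "complex_of_real ((norm (V \<xi>))\<^sup>2) = V \<xi> * cnj (V \<xi>)" for \<xi>
    by (rule complex_norm_square)
  have T: "complex_of_real (LINT \<xi>|torus. ?C \<xi> * (norm (V \<xi>))\<^sup>2) = toeplitz_form J v"
  proof -
    have "complex_of_real (LINT \<xi>|torus. ?C \<xi> * (norm (V \<xi>))\<^sup>2) = (LINT \<xi>|torus. of_real (?C \<xi>) * (V \<xi> * cnj (V \<xi>)))"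
      unfolding VV[symmetric] of_real_mult[symmetric] by (rule integral_complex_of_real[symmetric])
    also have "\<dots> = toeplitz_form J v"
      unfolding gen[OF \<open>?C \<in> _\<close> CB] toeplitz_form_def fourier_coeff_sech_symbol[OF xy_pos(1)] by (simp only: mult.commute[of "pi * p"])
    finally show ?thesis .
  qed
  have N: "complex_of_real (LINT \<xi>|torus. (norm (V \<xi>))\<^sup>2) = of_real (\<Sum>j\<in>J. (norm (v j))\<^sup>2)"
  proof -
    have "complex_of_real (LINT \<xi>|torus. (norm (V \<xi>))\<^sup>2) = (LINT \<xi>|torus. of_real 1 * (V \<xi> * cnj (V \<xi>)))"
      unfolding VV[symmetric] of_real_1 mult_1_left by (rule integral_complex_of_real[symmetric])
    also have "\<dots> = (\<Sum>i\<in>J. \<Sum>j\<in>J. v i * cnj (v j) * (if j = i then 1 else 0))"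
      using gen[of "\<lambda>_. 1" 1] by (simp add: fourier_coeff_def integral_fourier_mode)
    also have "\<dots> = of_real (\<Sum>j\<in>J. (norm (v j))\<^sup>2)"
    proof -
      have "(\<Sum>i\<in>J. \<Sum>j\<in>J. v i * cnj (v j) * (if j = i then 1 else 0)) = (\<Sum>i\<in>J. v i * cnj (v i))"
        using J by (simp add: if_distrib cong: if_cong)
      then show ?thesis by (simp only: of_real_sum complex_norm_square)
    qed
    finally show ?thesis .
  qed
  have N': "(LINT \<xi>|torus. (norm (V \<xi>))\<^sup>2) = (\<Sum>j\<in>J. (norm (v j))\<^sup>2)" using N by (simp only: of_real_eq_iff)
  have T': "(LINT \<xi>|torus. ?C \<xi> * (norm (V \<xi>))\<^sup>2) = Re (toeplitz_form J v)" using T by (metis Re_complex_of_real)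
  have Vb: "(norm (V \<xi>))\<^sup>2 \<le> (\<Sum>j\<in>J. norm (v j))\<^sup>2" for \<xi>
    unfolding V_def by (intro power_mono order_trans[OF norm_sum]) (auto simp: norm_mult)
  have i1: "integrable torus (\<lambda>\<xi>. (norm (V \<xi>))\<^sup>2)"
    by (rule integrable_torus_bounded[where B = "(\<Sum>j\<in>J. norm (v j))\<^sup>2"]) (use Vb in auto)
  have i2: "integrable torus (\<lambda>\<xi>. ?C \<xi> * (norm (V \<xi>))\<^sup>2)"
  proof (rule integrable_torus_bounded[where B = "B * (\<Sum>j\<in>J. norm (v j))\<^sup>2"])
    fix \<xi>
    have "norm (?C \<xi> * (norm (V \<xi>))\<^sup>2) = \<bar>?C \<xi>\<bar> * (norm (V \<xi>))\<^sup>2" by (simp add: abs_mult)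
    also have "\<dots> \<le> B * (\<Sum>j\<in>J. norm (v j))\<^sup>2" using CB[of \<xi>] Vb[of \<xi>] by (intro mult_mono) auto
    finally show "norm (?C \<xi> * (norm (V \<xi>))\<^sup>2) \<le> B * (\<Sum>j\<in>J. norm (v j))\<^sup>2" .
  qed measurable
  have "m * (LINT \<xi>|torus. (norm (V \<xi>))\<^sup>2) \<le> (LINT \<xi>|torus. ?C \<xi> * (norm (V \<xi>))\<^sup>2)"
    unfolding integral_mult_right_zero[symmetric]
    by (intro integral_mono i2 integrable_mult_right i1 mult_right_mono m) simp
  then show "m * (\<Sum>j\<in>J. (norm (v j))\<^sup>2) \<le> Re (toeplitz_form J v)" unfolding N' T' .
  have "(LINT \<xi>|torus. ?C \<xi> * (norm (V \<xi>))\<^sup>2) \<le> M * (LINT \<xi>|torus. (norm (V \<xi>))\<^sup>2)"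
    unfolding integral_mult_right_zero[symmetric]
    by (intro integral_mono i2 integrable_mult_right i1 mult_right_mono M) simp
  then show "Re (toeplitz_form J v) \<le> M * (\<Sum>j\<in>J. (norm (v j))\<^sup>2)" unfolding N' T' .
qed

end

section \<open>Fibre decomposition of the frame sum\<close>

lemma L2_measurable: "f \<in> L2 \<Longrightarrow> f \<in> borel_measurable borel"
  by (simp add: L2_def)

lemma L2_integrable: "f \<in> L2 \<Longrightarrow> integrable lborel (\<lambda>t. (norm (f t))\<^sup>2)"
  by (simp add: L2_def)

lemma L2_norm_square: "(L2_norm f)\<^sup>2 = (LINT t|lborel. (norm (f t))\<^sup>2)"
  by (simp add: L2_norm_def)

lemma nn_integral_sum_square_finite:
  fixes F :: "'i \<Rightarrow> 'a \<Rightarrow> 'b::{real_normed_vector, second_countable_topology}"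
  assumes "\<And>i. i \<in> I \<Longrightarrow> F i \<in> borel_measurable M"
    and "\<And>i. i \<in> I \<Longrightarrow> (\<integral>\<^sup>+t. ennreal ((norm (F i t))\<^sup>2) \<partial>M) < \<infinity>"
  shows "(\<integral>\<^sup>+t. ennreal ((norm (\<Sum>i\<in>I. F i t))\<^sup>2) \<partial>M) < \<infinity>"
  using assms
proof (induction I rule: infinite_finite_induct)
  case (insert i I)
  have m: "F i \<in> borel_measurable M" "(\<lambda>t. \<Sum>i\<in>I. F i t) \<in> borel_measurable M"
    using insert by auto
  have fin: "(\<integral>\<^sup>+t. ennreal ((norm (F i t))\<^sup>2) \<partial>M) < \<infinity>" "(\<integral>\<^sup>+t. ennreal ((norm (\<Sum>i\<in>I. F i t))\<^sup>2) \<partial>M) < \<infinity>"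
    using insert by auto
  have "(\<integral>\<^sup>+t. ennreal ((norm (\<Sum>i\<in>insert i I. F i t))\<^sup>2) \<partial>M)
     = (\<integral>\<^sup>+t. ennreal ((norm (F i t + (\<Sum>i\<in>I. F i t)))\<^sup>2) \<partial>M)" using insert(1,2) by simp
  also have "\<dots> \<le> 2 * (\<integral>\<^sup>+t. ennreal ((norm (F i t))\<^sup>2) \<partial>M) + 2 * (\<integral>\<^sup>+t. ennreal ((norm (\<Sum>i\<in>I. F i t))\<^sup>2) \<partial>M)"
    by (rule nn_integral_norm_add_square_le[OF m])
  also have "\<dots> < \<infinity>" using fin by (simp add: ennreal_mult_less_top)
  finally show ?case .
qed simp_all

context sech_lattice
begin

definition supported_in :: "(real \<Rightarrow> complex) \<Rightarrow> int set \<Rightarrow> bool" where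
  "supported_in f J \<longleftrightarrow> finite J \<and> (\<forall>t. \<lfloor>t / p\<rfloor> \<notin> J \<longrightarrow> f t = 0)"

lemma supported_scaled: "supported_in f J \<Longrightarrow> \<lfloor>s\<rfloor> \<notin> J \<Longrightarrow> f (p * s) = 0"
  using p_pos by (simp add: supported_in_def)

definition fibre :: "(real \<Rightarrow> complex) \<Rightarrow> real \<Rightarrow> int \<Rightarrow> complex" where
  "fibre f s j = f (p * (s + of_int j))"

lemma measurable_real_window_compose [measurable (raw)]:
  "h \<in> borel_measurable M \<Longrightarrow> (\<lambda>x. real_window (h x)) \<in> borel_measurable M"
  by (rule measurable_compose[OF _ measurable_real_window])

lemma measurable_fibre [measurable]:
  assumes [measurable]: "f \<in> borel_measurable borel"
  shows "(\<lambda>s. fibre f s j) \<in> borel_measurable borel"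
  unfolding fibre_def by measurable

lemma integrable_scaled:
  assumes "f \<in> L2"
  shows "integrable lborel (\<lambda>s. (norm (f (p * s)))\<^sup>2)"
  using lborel_integrable_real_affine[OF L2_integrable[OF assms], where c = p and t = 0] p_pos by simp

lemma integrable_fibre:
  assumes "f \<in> L2"
  shows "integrable torus (\<lambda>s. (norm (fibre f s j))\<^sup>2)"
  using integral_finite_periodization(2)[OF integrable_scaled[OF assms], of "{j}" j] by (simp add: fibre_def)

lemma L2_norm_fibre:
  assumes f: "f \<in> L2" and J: "supported_in f J"
  shows "ennreal ((L2_norm f)\<^sup>2) = ennreal p * (\<integral>\<^sup>+s. ennreal (\<Sum>j\<in>J. (norm (fibre f s j))\<^sup>2) \<partial>torus)"
proof -
  note [measurable] = L2_measurable[OF f]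
  have fin: "finite J" using J by (simp add: supported_in_def)
  have "(L2_norm f)\<^sup>2 = \<bar>p\<bar> *\<^sub>R (LINT s|lborel. (norm (f (0 + p * s)))\<^sup>2)"
    unfolding L2_norm_square using p_pos by (intro lborel_integral_real_affine) auto
  also have "(LINT s|lborel. (norm (f (0 + p * s)))\<^sup>2) = (LINT s|lborel. indicator {s. \<lfloor>s\<rfloor> \<in> J} s *\<^sub>R (norm (f (p * s)))\<^sup>2)"
    by (rule Bochner_Integration.integral_cong[OF refl]) (use supported_scaled[OF J] in \<open>auto simp: indicator_def\<close>)
  also have "\<dots> = (LINT s|torus. (\<Sum>j\<in>J. (norm (f (p * (s + of_int j))))\<^sup>2))"
    by (rule integral_finite_periodization(1)[OF integrable_scaled[OF f] fin, symmetric])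
  finally have "(L2_norm f)\<^sup>2 = p * (LINT s|torus. (\<Sum>j\<in>J. (norm (fibre f s j))\<^sup>2))"
    using p_pos by (simp add: fibre_def)
  moreover have "(\<integral>\<^sup>+s. ennreal (\<Sum>j\<in>J. (norm (fibre f s j))\<^sup>2) \<partial>torus) = ennreal (LINT s|torus. (\<Sum>j\<in>J. (norm (fibre f s j))\<^sup>2))"
    by (intro nn_integral_eq_integral Bochner_Integration.integrable_sum integrable_fibre f)
       (auto intro!: AE_I2 sum_nonneg)
  ultimately show ?thesis using p_pos by (simp add: ennreal_mult')
qed

text \<open>
  By periodicity of the modes, the inner products of \<open>f\<close> with the modulations of the \<open>k\<close>-th translate of the window are the
  Fourier coefficients of this function.
\<close>

definition periodized :: "(real \<Rightarrow> complex) \<Rightarrow> int set \<Rightarrow> int \<Rightarrow> real \<Rightarrow> complex" where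
  "periodized f J k s = (\<Sum>j\<in>J. fibre f s j * of_real (real_window (p * (s + of_int j) - a * of_int k)))"

lemma abs_real_window_le: "\<bar>real_window t\<bar> \<le> sqrt (pi / 2)"
proof -
  have "1 / cosh (pi * t) \<le> 1" using cosh_real_ge_1[of "pi * t"] by (simp add: divide_le_eq)
  then have "sqrt (pi / 2) * (1 / cosh (pi * t)) \<le> sqrt (pi / 2) * 1" by (intro mult_left_mono) auto
  moreover have "0 \<le> real_window t" by (simp add: real_window_def)
  ultimately show ?thesis by (simp add: real_window_def)
qed

lemma measurable_periodized [measurable]:
  assumes [measurable]: "f \<in> borel_measurable borel"
  shows "periodized f J k \<in> borel_measurable borel"
  unfolding periodized_def[abs_def] by measurable

lemma periodized_square_finite:
  assumes f: "f \<in> L2"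
  shows "(\<integral>\<^sup>+s. ennreal ((norm (periodized f J k s))\<^sup>2) \<partial>torus) < \<infinity>"
  unfolding periodized_def
proof (rule nn_integral_sum_square_finite)
  note [measurable] = L2_measurable[OF f]
  fix j
  show "(\<lambda>s. fibre f s j * of_real (real_window (p * (s + of_int j) - a * of_int k))) \<in> borel_measurable torus" by measurable
  have "(\<integral>\<^sup>+s. ennreal ((norm (fibre f s j * of_real (real_window (p * (s + of_int j) - a * of_int k))))\<^sup>2) \<partial>torus)
     \<le> (\<integral>\<^sup>+s. ennreal (pi / 2 * (norm (fibre f s j))\<^sup>2) \<partial>torus)"
  proof (intro nn_integral_mono ennreal_leI)
    fix s
    have "(real_window (p * (s + of_int j) - a * of_int k))\<^sup>2 \<le> (sqrt (pi / 2))\<^sup>2"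
      using power_mono[OF abs_real_window_le, of _ 2] by simp
    then have "(real_window (p * (s + of_int j) - a * of_int k))\<^sup>2 \<le> pi / 2" by simp
    then have "(norm (fibre f s j))\<^sup>2 * (real_window (p * (s + of_int j) - a * of_int k))\<^sup>2 \<le> (norm (fibre f s j))\<^sup>2 * (pi / 2)"
      by (intro mult_left_mono) auto
    then show "(norm (fibre f s j * of_real (real_window (p * (s + of_int j) - a * of_int k))))\<^sup>2 \<le> pi / 2 * (norm (fibre f s j))\<^sup>2"
      by (simp add: norm_mult power_mult_distrib mult.commute)
  qed
  also have "\<dots> < \<infinity>"
    using integrable_mult_right[OF integrable_fibre[OF f, of j], of "pi / 2"] by (simp add: integrable_iff_bounded abs_mult)
  finally show "(\<integral>\<^sup>+s. ennreal ((norm (fibre f s j * of_real (real_window (p * (s + of_int j) - a * of_int k))))\<^sup>2) \<partial>torus) < \<infinity>" .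
qed

lemma integrable_window_product_scaled:
  assumes f: "f \<in> L2"
  shows "integrable lborel (\<lambda>s. f (p * s) * of_real (real_window (p * s - a * of_int k)) * fourier_mode l s)"
proof (rule Bochner_Integration.integrable_bound)
  note [measurable] = L2_measurable[OF f]
  have "integrable lborel (\<lambda>s. 1 / (cosh (- pi * a * of_int k + (pi * p) * s))\<^sup>2)"
    by (rule lborel_integrable_real_affine[OF integrable_sech_squared]) (use p_pos in auto)
  then have "integrable lborel (\<lambda>s. pi / 2 * (1 / (cosh (- pi * a * of_int k + (pi * p) * s))\<^sup>2))"
    by (rule integrable_mult_right)
  moreover have "pi / 2 * (1 / (cosh (- pi * a * of_int k + (pi * p) * s))\<^sup>2) = (real_window (p * s - a * of_int k))\<^sup>2" for s
  proof -
    have "- pi * a * of_int k + (pi * p) * s = pi * (p * s - a * of_int k)" by (simp add: algebra_simps)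
    then show ?thesis using real_window_mult[of "p * s - a * of_int k" "p * s - a * of_int k"] by (simp only: power2_eq_square)
  qed
  ultimately have "integrable lborel (\<lambda>s. (real_window (p * s - a * of_int k))\<^sup>2)" by (simp only:)
  then show "integrable lborel (\<lambda>s. (norm (f (p * s)))\<^sup>2 + (real_window (p * s - a * of_int k))\<^sup>2)"
    by (intro Bochner_Integration.integrable_add integrable_scaled f)
  show "(\<lambda>s. f (p * s) * of_real (real_window (p * s - a * of_int k)) * fourier_mode l s) \<in> borel_measurable lborel" by measurable
  show "AE s in lborel. norm (f (p * s) * of_real (real_window (p * s - a * of_int k)) * fourier_mode l s)
      \<le> norm ((norm (f (p * s)))\<^sup>2 + (real_window (p * s - a * of_int k))\<^sup>2)"
  proof (rule AE_I2)
    fix s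
    have "x * \<bar>y\<bar> \<le> x\<^sup>2 + y\<^sup>2" for x y :: real
    proof -
      have "0 \<le> (x - \<bar>y\<bar>)\<^sup>2 + x\<^sup>2 + y\<^sup>2" by simp
      then show ?thesis by (simp add: power2_eq_square algebra_simps)
    qed
    from this[of "norm (f (p * s))" "real_window (p * s - a * of_int k)"]
    show "norm (f (p * s) * of_real (real_window (p * s - a * of_int k)) * fourier_mode l s)
      \<le> norm ((norm (f (p * s)))\<^sup>2 + (real_window (p * s - a * of_int k))\<^sup>2)" by (simp add: norm_mult)
  qed
qed

lemma L2_inner_shift_scaled:
  "L2_inner f (time_freq_shift (a * of_int k, b * of_int l) sech_window)
    = of_real p * (LINT s|lborel. f (p * s) * of_real (real_window (p * s - a * of_int k)) * fourier_mode (- l) s)"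
proof -
  define h where "h = (\<lambda>t. f t * cnj (time_freq_shift (a * of_int k, b * of_int l) sech_window t))"
  have "L2_inner f (time_freq_shift (a * of_int k, b * of_int l) sech_window) = \<bar>p\<bar> *\<^sub>R (LINT s|lborel. h (0 + p * s))"
    unfolding L2_inner_def h_def using p_pos by (intro lborel_integral_real_affine) auto
  moreover have "h (0 + p * s) = f (p * s) * of_real (real_window (p * s - a * of_int k)) * fourier_mode (- l) s" for s
  proof -
    have "2 * of_real pi * \<i> * of_real (b * of_int l) * of_real (p * s) = \<i> * of_real (2 * pi * of_int l * s)"
    proof -
      have "2 * pi * (b * of_int l) * (p * s) = (b * p) * (2 * pi * of_int l * s)" by (simp add: mult_ac)
      then have "2 * pi * (b * of_int l) * (p * s) = 2 * pi * of_int l * s" by (simp only: b_times_p mult_1_left)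
      then have "complex_of_real (2 * pi * (b * of_int l) * (p * s)) = of_real (2 * pi * of_int l * s)" by (rule arg_cong)
      then show ?thesis by (simp add: mult_ac)
    qed
    then have "exp (2 * of_real pi * \<i> * of_real (b * of_int l) * of_real (p * s)) = fourier_mode l s"
      by (simp only: fourier_mode_def cis_conv_exp)
    then show ?thesis by (simp add: h_def time_freq_shift_def sech_window_eq cnj_fourier_mode)
  qed
  ultimately show ?thesis using p_pos by (simp only: scaleR_conv_of_real abs_of_pos)
qed

lemma frame_coefficient:
  assumes f: "f \<in> L2" and J: "supported_in f J"
  shows "L2_inner f (time_freq_shift (a * of_int k, b * of_int l) sech_window) = of_real p * fourier_coeff (periodized f J k) l"
proof -
  let ?\<phi> = "\<lambda>s. f (p * s) * of_real (real_window (p * s - a * of_int k)) * fourier_mode (- l) s"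
  have fin: "finite J" using J by (simp add: supported_in_def)
  have "(LINT s|lborel. ?\<phi> s) = (LINT s|lborel. indicator {s. \<lfloor>s\<rfloor> \<in> J} s *\<^sub>R ?\<phi> s)"
    by (rule Bochner_Integration.integral_cong[OF refl]) (use supported_scaled[OF J] in \<open>auto simp: indicator_def\<close>)
  also have "\<dots> = (LINT s|torus. (\<Sum>j\<in>J. ?\<phi> (s + of_int j)))"
    by (rule integral_finite_periodization(1)[OF integrable_window_product_scaled[OF f] fin, symmetric])
  also have "\<dots> = fourier_coeff (periodized f J k) l"
    unfolding fourier_coeff_def periodized_def fibre_def sum_distrib_right fourier_mode_periodic ..
  finally show ?thesis unfolding L2_inner_shift_scaled by simp
qed

definition gabor_coefficient :: "(real \<Rightarrow> complex) \<Rightarrow> int \<Rightarrow> int \<Rightarrow> complex" where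
  "gabor_coefficient f k l = L2_inner f (time_freq_shift (a * of_int k, b * of_int l) sech_window)"

lemma frame_sum_eq_pairs:
  "gabor_sum f = (\<integral>\<^sup>+z. ennreal ((norm (gabor_coefficient f (fst z) (snd z)))\<^sup>2) \<partial>count_space UNIV)"
proof -
  let ?e = "\<lambda>z. ennreal ((norm (L2_inner f (time_freq_shift z sech_window)))\<^sup>2)"
  define \<iota> where "\<iota> = (\<lambda>z::int \<times> int. (a * of_int (fst z), b * of_int (snd z)))"
  have inj: "inj \<iota>" using a b by (auto simp: inj_def \<iota>_def)
  have "\<iota> = (\<lambda>(k, l). (a * of_int k, b * of_int l))" by (auto simp: \<iota>_def)
  then have rng: "rect_lattice a b = range \<iota>" by (auto simp: rect_lattice_def)
  have "gabor_sum f = (\<Sum>\<^sub>\<infinity>z. ?e (\<iota> z))"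
    unfolding frame_sum_def rng using infsum_reindex[OF inj, of ?e] by (simp add: o_def)
  also have "\<dots> = (\<integral>\<^sup>+z. ?e (\<iota> z) \<partial>count_space UNIV)" by (rule infsum_ennreal_eq_nn_integral)
  finally show ?thesis by (simp only: gabor_coefficient_def \<iota>_def)
qed

lemma frame_sum_eq_nn_integral:
  "gabor_sum f =
    (\<integral>\<^sup>+k. (\<integral>\<^sup>+l. ennreal ((norm (L2_inner f (time_freq_shift (a * of_int k, b * of_int l) sech_window)))\<^sup>2)
       \<partial>count_space (UNIV :: int set)) \<partial>count_space (UNIV :: int set))"
  unfolding frame_sum_eq_pairs nn_integral_fst_count_space[symmetric] by (simp add: gabor_coefficient_def)

text \<open>
  Parseval's identity removes the sum over the modulations; the sum over the translations is then done
  pointwise in \<open>s\<close>. The frame operator is thereby decomposed over the circle.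
\<close>

theorem frame_sum_fibre:
  assumes f: "f \<in> L2" and J: "supported_in f J"
  shows "gabor_sum f = ennreal p * (\<integral>\<^sup>+s. ennreal (fibre_form s J (fibre f s)) \<partial>torus)"
proof -
  note [measurable] = L2_measurable[OF f]
  have fin: "finite J" using J by (simp add: supported_in_def)
  have row: "(\<integral>\<^sup>+l. ennreal ((norm (L2_inner f (time_freq_shift (a * of_int k, b * of_int l) sech_window)))\<^sup>2) \<partial>count_space UNIV)
     = ennreal (p\<^sup>2) * (\<integral>\<^sup>+s. ennreal ((norm (periodized f J k s))\<^sup>2) \<partial>torus)" for k :: int
  proof -
    let ?P = "periodized f J k"
    have sq: "(norm (L2_inner f (time_freq_shift (a * of_int k, b * of_int l) sech_window)))\<^sup>2 = p\<^sup>2 * (norm (fourier_coeff ?P l))\<^sup>2" for l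
      unfolding frame_coefficient[OF f J] by (simp add: norm_mult power_mult_distrib)
    have "((\<lambda>l. p\<^sup>2 * (norm (fourier_coeff ?P l))\<^sup>2) has_sum p\<^sup>2 * (LINT s|torus. (norm (?P s))\<^sup>2)) UNIV"
      by (intro has_sum_cmult_right parseval periodized_square_finite f) measurable
    from nn_integral_count_space_has_sum[OF this]
    have "(\<integral>\<^sup>+l. ennreal (p\<^sup>2 * (norm (fourier_coeff ?P l))\<^sup>2) \<partial>count_space UNIV) = ennreal (p\<^sup>2 * (LINT s|torus. (norm (?P s))\<^sup>2))"
      by simp
    also have "\<dots> = ennreal (p\<^sup>2) * ennreal (LINT s|torus. (norm (?P s))\<^sup>2)" by (simp add: ennreal_mult)
    also have "ennreal (LINT s|torus. (norm (?P s))\<^sup>2) = (\<integral>\<^sup>+s. ennreal ((norm (?P s))\<^sup>2) \<partial>torus)"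
      by (intro nn_integral_eq_integral[symmetric] integrable_square periodized_square_finite f) auto
    finally show ?thesis unfolding sq .
  qed
  have "gabor_sum f
     = (\<integral>\<^sup>+k. ennreal (p\<^sup>2) * (\<integral>\<^sup>+s. ennreal ((norm (periodized f J k s))\<^sup>2) \<partial>torus) \<partial>count_space UNIV)"
    unfolding frame_sum_eq_nn_integral row ..
  also have "\<dots> = (\<integral>\<^sup>+k. (\<integral>\<^sup>+s. ennreal p * ennreal (p * (norm (periodized f J k s))\<^sup>2) \<partial>torus) \<partial>count_space UNIV)"
  proof (rule nn_integral_cong)
    fix k :: int
    have "ennreal (p\<^sup>2) * ennreal (x\<^sup>2) = ennreal p * ennreal (p * x\<^sup>2)" for x :: real
    proof -
      have "p\<^sup>2 * x\<^sup>2 = p * (p * x\<^sup>2)" by (simp add: power2_eq_square)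
      then show ?thesis using p_pos by (simp flip: ennreal_mult)
    qed
    then show "ennreal (p\<^sup>2) * (\<integral>\<^sup>+s. ennreal ((norm (periodized f J k s))\<^sup>2) \<partial>torus)
       = (\<integral>\<^sup>+s. ennreal p * ennreal (p * (norm (periodized f J k s))\<^sup>2) \<partial>torus)"
      by (subst nn_integral_cmult[symmetric]) auto
  qed
  also have "\<dots> = (\<integral>\<^sup>+s. (\<integral>\<^sup>+k. ennreal p * ennreal (p * (norm (periodized f J k s))\<^sup>2) \<partial>count_space UNIV) \<partial>torus)"
    by (rule nn_integral_count_space_nn_integral[symmetric]) auto
  also have "\<dots> = (\<integral>\<^sup>+s. ennreal p * ennreal (fibre_form s J (fibre f s)) \<partial>torus)"
  proof (rule nn_integral_cong)
    fix s
    have "(\<integral>\<^sup>+k. ennreal p * ennreal (p * (norm (periodized f J k s))\<^sup>2) \<partial>count_space UNIV)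
        = ennreal p * (\<integral>\<^sup>+k. ennreal (p * (norm (periodized f J k s))\<^sup>2) \<partial>count_space UNIV)"
      by (rule nn_integral_cmult) simp
    also have "(\<integral>\<^sup>+k. ennreal (p * (norm (periodized f J k s))\<^sup>2) \<partial>count_space UNIV) = ennreal (fibre_form s J (fibre f s))"
      unfolding periodized_def by (rule nn_integral_count_space_has_sum[OF fibre_form_has_sum[OF fin]]) (use p_pos in auto)
    finally show "(\<integral>\<^sup>+k. ennreal p * ennreal (p * (norm (periodized f J k s))\<^sup>2) \<partial>count_space UNIV)
        = ennreal p * ennreal (fibre_form s J (fibre f s))" .
  qed
  also have "\<dots> = ennreal p * (\<integral>\<^sup>+s. ennreal (fibre_form s J (fibre f s)) \<partial>torus)"
  proof (rule nn_integral_cmult)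
    have [measurable]: "time_symbol \<in> borel_measurable borel"
      by (intro borel_measurable_continuous_onI continuous_sech_symbol xy_pos)
    show "(\<lambda>s. ennreal (fibre_form s J (fibre f s))) \<in> borel_measurable torus"
      unfolding fibre_form_def toeplitz_form_def by measurable
  qed
  finally show ?thesis .
qed

end

section \<open>Frame bounds from the symbol\<close>

lemma sech_symbol_ge_uminus:
  assumes "x > 0"
  shows "- sech_symbol x 0 \<le> sech_symbol x \<theta>"
proof (rule has_sum_mono[OF _ sech_symbol_has_sum[OF assms]])
  show "((\<lambda>k::int. - (xsinh (of_int k * x) * cos (2 * pi * of_int k * 0))) has_sum - sech_symbol x 0) UNIV"
    by (simp only: has_sum_uminus minus_minus sech_symbol_has_sum[OF assms])
  fix k :: int
  have "xsinh (of_int k * x) * (- 1) \<le> xsinh (of_int k * x) * cos (2 * pi * of_int k * \<theta>)"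
    using xsinh_pos by (intro mult_left_mono cos_ge_minus_one less_imp_le)
  then show "- (xsinh (of_int k * x) * cos (2 * pi * of_int k * 0)) \<le> xsinh (of_int k * x) * cos (2 * pi * of_int k * \<theta>)" by simp
qed

context sech_lattice
begin

lemma fibre_form_le:
  assumes J: "finite J" and M1: "\<And>\<theta>. time_symbol \<theta> \<le> M1" and M2: "\<And>\<xi>. freq_symbol \<xi> \<le> M2"
  shows "fibre_form s J v \<le> real n * (M1 + M2 - 1) * (\<Sum>j\<in>J. (norm (v j))\<^sup>2)"
proof -
  let ?N = "\<Sum>j\<in>J. (norm (v j))\<^sup>2" and ?W = "time_symbol (real n * s)"
  have N: "?N \<ge> 0" by (intro sum_nonneg) auto
  have "(?W - 1) * ?N \<le> (M1 - 1) * ?N" using M1[of "real n * s"] N by (intro mult_right_mono) auto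
  moreover have "Re (toeplitz_form J v) \<le> M2 * ?N" by (rule toeplitz_form_bounds(2)[OF J sech_symbol_ge_uminus[OF xy_pos(1)] M2])
  ultimately have "(?W - 1) * ?N + Re (toeplitz_form J v) \<le> (M1 + M2 - 1) * ?N" by (simp add: algebra_simps)
  then show ?thesis unfolding fibre_form_def mult.assoc by (intro mult_left_mono) auto
qed

lemma fibre_form_ge:
  assumes J: "finite J" and m1: "\<And>\<theta>. m1 \<le> time_symbol \<theta>" and m2: "\<And>\<xi>. m2 \<le> freq_symbol \<xi>"
  shows "real n * (m1 + m2 - 1) * (\<Sum>j\<in>J. (norm (v j))\<^sup>2) \<le> fibre_form s J v"
proof -
  let ?N = "\<Sum>j\<in>J. (norm (v j))\<^sup>2" and ?W = "time_symbol (real n * s)"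
  have N: "?N \<ge> 0" by (intro sum_nonneg) auto
  have "(m1 - 1) * ?N \<le> (?W - 1) * ?N" using m1[of "real n * s"] N by (intro mult_right_mono) auto
  moreover have "m2 * ?N \<le> Re (toeplitz_form J v)"
    by (rule toeplitz_form_bounds(1)[OF J m2 sech_symbol_le_0[OF xy_pos(1)]])
  ultimately have "(m1 + m2 - 1) * ?N \<le> (?W - 1) * ?N + Re (toeplitz_form J v)" by (simp add: algebra_simps)
  then show ?thesis unfolding fibre_form_def mult.assoc by (intro mult_left_mono) auto
qed

definition upper_value :: real where
  "upper_value = real n * (time_symbol 0 + freq_symbol 0 - 1)"

lemma upper_value_nonneg: "upper_value \<ge> 0"
proof -
  have "sech_symbol x 0 \<ge> 1" if "x > 0" for x
  proof -
    have "(\<Sum>k\<in>{0::int}. xsinh (of_int k * x) * cos (2 * pi * of_int k * 0)) \<le> sech_symbol x 0"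
      by (rule finite_sum_le_has_sum[OF sech_symbol_has_sum[OF that]]) (use xsinh_pos in \<open>auto intro: less_imp_le\<close>)
    then show ?thesis by simp
  qed
  from this[OF xy_pos(1)] this[OF xy_pos(2)] show ?thesis by (simp add: upper_value_def)
qed

lemma frame_sum_le_supported:
  assumes f: "f \<in> L2" and J: "supported_in f J"
  shows "gabor_sum f \<le> ennreal upper_value * ennreal ((L2_norm f)\<^sup>2)"
proof -
  note [measurable] = L2_measurable[OF f]
  have fin: "finite J" using J by (simp add: supported_in_def)
  have "(\<integral>\<^sup>+s. ennreal (fibre_form s J (fibre f s)) \<partial>torus)
     \<le> (\<integral>\<^sup>+s. ennreal upper_value * ennreal (\<Sum>j\<in>J. (norm (fibre f s j))\<^sup>2) \<partial>torus)"
  proof (rule nn_integral_mono)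
    fix s
    have "fibre_form s J (fibre f s) \<le> upper_value * (\<Sum>j\<in>J. (norm (fibre f s j))\<^sup>2)"
      unfolding upper_value_def by (rule fibre_form_le[OF fin]) (auto intro: sech_symbol_le_0 xy_pos)
    then show "ennreal (fibre_form s J (fibre f s)) \<le> ennreal upper_value * ennreal (\<Sum>j\<in>J. (norm (fibre f s j))\<^sup>2)"
      using upper_value_nonneg by (simp add: ennreal_leI ennreal_mult[symmetric] sum_nonneg)
  qed
  also have "\<dots> = ennreal upper_value * (\<integral>\<^sup>+s. ennreal (\<Sum>j\<in>J. (norm (fibre f s j))\<^sup>2) \<partial>torus)"
    by (rule nn_integral_cmult) measurable
  finally have "ennreal p * (\<integral>\<^sup>+s. ennreal (fibre_form s J (fibre f s)) \<partial>torus)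
     \<le> ennreal p * (ennreal upper_value * (\<integral>\<^sup>+s. ennreal (\<Sum>j\<in>J. (norm (fibre f s j))\<^sup>2) \<partial>torus))"
    by (rule mult_left_mono) simp
  then show ?thesis unfolding frame_sum_fibre[OF f J] L2_norm_fibre[OF f J] by (simp only: mult.left_commute)
qed

text \<open>
  The bounds \<open>m1\<close> and \<open>m2\<close> are parameters here; \<open>sech_symbol_ge_half\<close> supplies them when the
  lattice is close enough to the square one.
\<close>

lemma frame_sum_ge_supported:
  assumes f: "f \<in> L2" and J: "supported_in f J"
    and m1: "\<And>\<theta>. m1 \<le> time_symbol \<theta>" and m2: "\<And>\<xi>. m2 \<le> freq_symbol \<xi>"
    and K: "K = real n * (m1 + m2 - 1)" "K \<ge> 0"
  shows "ennreal K * ennreal ((L2_norm f)\<^sup>2) \<le> gabor_sum f"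
proof -
  note [measurable] = L2_measurable[OF f]
  have fin: "finite J" using J by (simp add: supported_in_def)
  have "ennreal K * (\<integral>\<^sup>+s. ennreal (\<Sum>j\<in>J. (norm (fibre f s j))\<^sup>2) \<partial>torus)
     = (\<integral>\<^sup>+s. ennreal K * ennreal (\<Sum>j\<in>J. (norm (fibre f s j))\<^sup>2) \<partial>torus)"
    by (rule nn_integral_cmult[symmetric]) measurable
  also have "\<dots> \<le> (\<integral>\<^sup>+s. ennreal (fibre_form s J (fibre f s)) \<partial>torus)"
  proof (rule nn_integral_mono)
    fix s
    have "K * (\<Sum>j\<in>J. (norm (fibre f s j))\<^sup>2) \<le> fibre_form s J (fibre f s)"
      unfolding K by (rule fibre_form_ge[OF fin m1 m2])
    then show "ennreal K * ennreal (\<Sum>j\<in>J. (norm (fibre f s j))\<^sup>2) \<le> ennreal (fibre_form s J (fibre f s))"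
      using K(2) by (simp add: ennreal_leI ennreal_mult[symmetric] sum_nonneg)
  qed
  finally have "ennreal p * (ennreal K * (\<integral>\<^sup>+s. ennreal (\<Sum>j\<in>J. (norm (fibre f s j))\<^sup>2) \<partial>torus))
     \<le> ennreal p * (\<integral>\<^sup>+s. ennreal (fibre_form s J (fibre f s)) \<partial>torus)"
    by (rule mult_left_mono) simp
  then show ?thesis unfolding frame_sum_fibre[OF f J] L2_norm_fibre[OF f J] by (simp only: mult.left_commute)
qed

lemma L2_restrict:
  assumes f: "f \<in> L2" and S [measurable]: "S \<in> sets borel"
  shows "(\<lambda>t. indicator S t *\<^sub>R f t) \<in> L2"
proof -
  note [measurable] = L2_measurable[OF f]
  have "integrable lborel (\<lambda>t. (norm (indicator S t *\<^sub>R f t))\<^sup>2)"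
    by (rule Bochner_Integration.integrable_bound[OF L2_integrable[OF f]]) (auto split: split_indicator)
  then show ?thesis by (simp add: L2_def)
qed

text \<open>
  Truncation to finitely many periods, for passing from compact support to all of \<open>L\<^sup>2\<close>.
\<close>

definition block :: "nat \<Rightarrow> real set" where "block N = {t. \<lfloor>t / p\<rfloor> \<in> {- int N..int N}}"

lemma measurable_block [measurable]: "block N \<in> sets borel"
proof -
  have "block N = {t. - real N \<le> t / p \<and> t / p < real N + 1}"
    by (auto simp: block_def le_floor_iff floor_le_iff)
  then show ?thesis by simp
qed

lemma eventually_in_block: "eventually (\<lambda>N. t \<in> block N) sequentially"
  by (rule eventually_mono[OF eventually_ge_at_top[of "nat \<bar>\<lfloor>t / p\<rfloor>\<bar>"]]) (auto simp: block_def)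

definition inner_part :: "nat \<Rightarrow> (real \<Rightarrow> complex) \<Rightarrow> real \<Rightarrow> complex" where
  "inner_part N f t = indicator (block N) t *\<^sub>R f t"

definition outer_part :: "nat \<Rightarrow> (real \<Rightarrow> complex) \<Rightarrow> real \<Rightarrow> complex" where
  "outer_part N f t = indicator (- block N) t *\<^sub>R f t"

lemma inner_part_L2: "f \<in> L2 \<Longrightarrow> inner_part N f \<in> L2"
  unfolding inner_part_def[abs_def] by (rule L2_restrict) measurable

lemma outer_part_L2: "f \<in> L2 \<Longrightarrow> outer_part N f \<in> L2"
  unfolding outer_part_def[abs_def] by (rule L2_restrict) measurable

lemma inner_part_supported: "supported_in (inner_part N f) {- int N..int N}"
  unfolding supported_in_def inner_part_def block_def by auto

lemma L2_norm_inner_part_tendsto: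
  assumes f: "f \<in> L2"
  shows "(\<lambda>N. (L2_norm (inner_part N f))\<^sup>2) \<longlonglongrightarrow> (L2_norm f)\<^sup>2"
  unfolding L2_norm_square
proof (rule integral_dominated_convergence[where w = "\<lambda>t. (norm (f t))\<^sup>2"])
  note [measurable] = L2_measurable[OF f] L2_measurable[OF inner_part_L2[OF f]]
  show "AE t in lborel. (\<lambda>N. (norm (inner_part N f t))\<^sup>2) \<longlonglongrightarrow> (norm (f t))\<^sup>2"
  proof (rule AE_I2)
    fix t
    have "eventually (\<lambda>N. (norm (inner_part N f t))\<^sup>2 = (norm (f t))\<^sup>2) sequentially"
      using eventually_in_block[of t] by (rule eventually_mono) (simp add: inner_part_def)
    then show "(\<lambda>N. (norm (inner_part N f t))\<^sup>2) \<longlonglongrightarrow> (norm (f t))\<^sup>2" by (rule tendsto_eventually)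
  qed
  show "integrable lborel (\<lambda>t. (norm (f t))\<^sup>2)" by (rule L2_integrable[OF f])
  show "(\<lambda>t. (norm (f t))\<^sup>2) \<in> borel_measurable lborel" by measurable
  show "(\<lambda>t. (norm (inner_part N f t))\<^sup>2) \<in> borel_measurable lborel" for N by measurable
  show "AE t in lborel. norm ((norm (inner_part N f t))\<^sup>2) \<le> (norm (f t))\<^sup>2" for N
    by (rule AE_I2) (auto simp: inner_part_def split: split_indicator)
qed

lemma L2_norm_outer_part_tendsto:
  assumes f: "f \<in> L2"
  shows "(\<lambda>N. (L2_norm (outer_part N f))\<^sup>2) \<longlonglongrightarrow> 0"
proof -
  note [measurable] = L2_measurable[OF f]
  have "(L2_norm (outer_part N f))\<^sup>2 = (L2_norm f)\<^sup>2 - (L2_norm (inner_part N f))\<^sup>2" for N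
    unfolding L2_norm_square
      Bochner_Integration.integral_diff[OF L2_integrable[OF f] L2_integrable[OF inner_part_L2[OF f]], symmetric]
    by (intro Bochner_Integration.integral_cong refl) (simp add: inner_part_def outer_part_def split: split_indicator)
  moreover have "(\<lambda>N. (L2_norm f)\<^sup>2 - (L2_norm (inner_part N f))\<^sup>2) \<longlonglongrightarrow> (L2_norm f)\<^sup>2 - (L2_norm f)\<^sup>2"
    by (intro tendsto_intros L2_norm_inner_part_tendsto f)
  ultimately show ?thesis by simp
qed

lemma gabor_coefficient_scaled: "gabor_coefficient f k l
    = of_real p * (LINT s|lborel. f (p * s) * of_real (real_window (p * s - a * of_int k)) * fourier_mode (- l) s)"
  unfolding gabor_coefficient_def by (rule L2_inner_shift_scaled)

lemma gabor_coefficient_inner_outer: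
  assumes f: "f \<in> L2"
  shows "gabor_coefficient (inner_part N f) k l = gabor_coefficient f k l - gabor_coefficient (outer_part N f) k l"
  unfolding gabor_coefficient_scaled right_diff_distrib[symmetric]
    Bochner_Integration.integral_diff[OF integrable_window_product_scaled[OF f] integrable_window_product_scaled[OF outer_part_L2[OF f]], symmetric]
  by (intro arg_cong[where f = "(*) (of_real p)"] Bochner_Integration.integral_cong refl)
     (simp add: inner_part_def outer_part_def split: split_indicator)

lemma gabor_coefficient_inner_part_tendsto:
  assumes f: "f \<in> L2"
  shows "(\<lambda>N. gabor_coefficient (inner_part N f) k l) \<longlonglongrightarrow> gabor_coefficient f k l"
  unfolding gabor_coefficient_scaled
proof (intro tendsto_mult tendsto_const)
  note [measurable] = L2_measurable[OF f] L2_measurable[OF inner_part_L2[OF f]]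
  let ?h = "\<lambda>f s. f (p * s) * of_real (real_window (p * s - a * of_int k)) * fourier_mode (- l) s"
  show "(\<lambda>N. LINT s|lborel. ?h (inner_part N f) s) \<longlonglongrightarrow> (LINT s|lborel. ?h f s)"
  proof (rule integral_dominated_convergence[where w = "\<lambda>s. norm (?h f s)"])
    show "AE s in lborel. (\<lambda>N. ?h (inner_part N f) s) \<longlonglongrightarrow> ?h f s"
    proof (rule AE_I2)
      fix s
      have "eventually (\<lambda>N. ?h (inner_part N f) s = ?h f s) sequentially"
        using eventually_in_block[of "p * s"] by (rule eventually_mono) (simp add: inner_part_def)
      then show "(\<lambda>N. ?h (inner_part N f) s) \<longlonglongrightarrow> ?h f s" by (rule tendsto_eventually)
    qed
    show "integrable lborel (\<lambda>s. norm (?h f s))" by (intro integrable_norm integrable_window_product_scaled f)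
    show "AE s in lborel. norm (?h (inner_part N f) s) \<le> norm (?h f s)" for N
      by (rule AE_I2) (auto simp: inner_part_def norm_mult split: split_indicator)
  qed measurable
qed

text \<open>
  Every finite part of the frame sum is continuous under truncation of \<open>f\<close>.
\<close>

theorem frame_sum_le:
  assumes f: "f \<in> L2"
  shows "gabor_sum f \<le> ennreal upper_value * ennreal ((L2_norm f)\<^sup>2)"
  unfolding frame_sum_eq_pairs nn_integral_count_space_eq_SUP
proof (rule SUP_least)
  let ?e = "\<lambda>f z. (norm (gabor_coefficient f (fst z) (snd z)))\<^sup>2"
  fix F :: "(int \<times> int) set" assume "F \<in> {F. finite F}"
  then have F: "finite F" by simp
  have "(\<Sum>z\<in>F. ?e f z) \<le> upper_value * (L2_norm f)\<^sup>2"
  proof (rule LIMSEQ_le)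
    show "(\<lambda>N. \<Sum>z\<in>F. ?e (inner_part N f) z) \<longlonglongrightarrow> (\<Sum>z\<in>F. ?e f z)"
      by (intro tendsto_intros gabor_coefficient_inner_part_tendsto f)
    show "(\<lambda>N. upper_value * (L2_norm (inner_part N f))\<^sup>2) \<longlonglongrightarrow> upper_value * (L2_norm f)\<^sup>2"
      by (intro tendsto_intros L2_norm_inner_part_tendsto f)
    show "\<exists>N. \<forall>n\<ge>N. (\<Sum>z\<in>F. ?e (inner_part n f) z) \<le> upper_value * (L2_norm (inner_part n f))\<^sup>2"
    proof (intro exI[of _ 0] allI impI)
      fix N
      have "ennreal (\<Sum>z\<in>F. ?e (inner_part N f) z) = (\<Sum>z\<in>F. ennreal (?e (inner_part N f) z))"
        by (simp add: sum_ennreal)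
      also have "\<dots> \<le> gabor_sum (inner_part N f)"
        unfolding frame_sum_eq_pairs nn_integral_count_space_eq_SUP using F by (intro SUP_upper) auto
      also have "\<dots> \<le> ennreal upper_value * ennreal ((L2_norm (inner_part N f))\<^sup>2)"
        by (rule frame_sum_le_supported[OF inner_part_L2[OF f] inner_part_supported])
      also have "\<dots> = ennreal (upper_value * (L2_norm (inner_part N f))\<^sup>2)"
        using upper_value_nonneg by (simp add: ennreal_mult)
      finally show "(\<Sum>z\<in>F. ?e (inner_part N f) z) \<le> upper_value * (L2_norm (inner_part N f))\<^sup>2"
        using upper_value_nonneg by (simp add: ennreal_le_iff)
    qed
  qed
  then have "ennreal (\<Sum>z\<in>F. ?e f z) \<le> ennreal (upper_value * (L2_norm f)\<^sup>2)" by (rule ennreal_leI)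
  then show "(\<Sum>z\<in>F. ennreal (?e f z)) \<le> ennreal upper_value * ennreal ((L2_norm f)\<^sup>2)"
    using upper_value_nonneg by (simp add: sum_ennreal ennreal_mult)
qed

lemma norm_diff_square_weighted:
  assumes "\<epsilon> > 0"
  shows "(norm (x - y))\<^sup>2 \<le> (1 + \<epsilon>) * (norm x)\<^sup>2 + (1 + 1 / \<epsilon>) * (norm y)\<^sup>2"
proof -
  have "(norm (x - y))\<^sup>2 \<le> (norm x + norm y)\<^sup>2" by (intro power_mono norm_triangle_ineq4) auto
  moreover have "(1 + \<epsilon>) * X\<^sup>2 + (1 + 1 / \<epsilon>) * Y\<^sup>2 - (X + Y)\<^sup>2 = (\<epsilon> * X - Y)\<^sup>2 / \<epsilon>" for X Y :: real
    using assms by (simp add: power2_eq_square field_simps)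
  from this[of "norm x" "norm y"]
  have "(norm x + norm y)\<^sup>2 \<le> (1 + \<epsilon>) * (norm x)\<^sup>2 + (1 + 1 / \<epsilon>) * (norm y)\<^sup>2"
  proof -
    have "0 \<le> (\<epsilon> * norm x - norm y)\<^sup>2 / \<epsilon>" using assms by simp
    then show ?thesis using \<open>_ = (\<epsilon> * norm x - norm y)\<^sup>2 / \<epsilon>\<close> by linarith
  qed
  ultimately show ?thesis by linarith
qed

text \<open>
  The coefficients of the truncated function differ from those of \<open>f\<close> by the coefficients of the
  remainder. These are small in \<open>\<ell>\<^sup>2\<close> by the upper frame bound, so the lower bound passes to the limit.
\<close>

theorem frame_sum_ge:
  assumes f: "f \<in> L2"
    and m1: "\<And>\<theta>. m1 \<le> time_symbol \<theta>" and m2: "\<And>\<xi>. m2 \<le> freq_symbol \<xi>"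
    and K: "K = real n * (m1 + m2 - 1)" "K \<ge> 0"
  shows "ennreal K * ennreal ((L2_norm f)\<^sup>2) \<le> gabor_sum f"
proof -
  let ?FS = "gabor_sum"
  have "?FS f \<le> ennreal (upper_value * (L2_norm f)\<^sup>2)"
    using frame_sum_le[OF f] upper_value_nonneg by (simp add: ennreal_mult)
  then obtain r where r: "?FS f = ennreal r" "r \<ge> 0"
    by (metis ennreal_cases ennreal_less_top neq_top_trans top.not_eq_extremum)
  have main: "K * (L2_norm f)\<^sup>2 \<le> (1 + \<epsilon>) * r" if e: "\<epsilon> > 0" for \<epsilon>
  proof (rule LIMSEQ_le)
    show "(\<lambda>N. K * (L2_norm (inner_part N f))\<^sup>2) \<longlonglongrightarrow> K * (L2_norm f)\<^sup>2"
      by (intro tendsto_intros L2_norm_inner_part_tendsto f)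
    have "(\<lambda>N. (1 + \<epsilon>) * r + (1 + 1 / \<epsilon>) * (upper_value * (L2_norm (outer_part N f))\<^sup>2)) \<longlonglongrightarrow> (1 + \<epsilon>) * r + (1 + 1 / \<epsilon>) * (upper_value * 0)"
      by (intro tendsto_intros L2_norm_outer_part_tendsto f)
    then show "(\<lambda>N. (1 + \<epsilon>) * r + (1 + 1 / \<epsilon>) * (upper_value * (L2_norm (outer_part N f))\<^sup>2)) \<longlonglongrightarrow> (1 + \<epsilon>) * r" by simp
    show "\<exists>N. \<forall>n\<ge>N. K * (L2_norm (inner_part n f))\<^sup>2 \<le> (1 + \<epsilon>) * r + (1 + 1 / \<epsilon>) * (upper_value * (L2_norm (outer_part n f))\<^sup>2)"
    proof (intro exI[of _ 0] allI impI)
      fix N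
      let ?e = "\<lambda>f z. (norm (gabor_coefficient f (fst z) (snd z)))\<^sup>2"
      have "ennreal (K * (L2_norm (inner_part N f))\<^sup>2) = ennreal K * ennreal ((L2_norm (inner_part N f))\<^sup>2)"
        using K(2) by (simp add: ennreal_mult)
      also have "\<dots> \<le> ?FS (inner_part N f)"
        by (rule frame_sum_ge_supported[OF inner_part_L2[OF f] inner_part_supported m1 m2 K])
      also have "\<dots> \<le> (\<integral>\<^sup>+z. ennreal (1 + \<epsilon>) * ennreal (?e f z) + ennreal (1 + 1 / \<epsilon>) * ennreal (?e (outer_part N f) z) \<partial>count_space UNIV)"
        unfolding frame_sum_eq_pairs
      proof (rule nn_integral_mono)
        fix z :: "int \<times> int"
        have "?e (inner_part N f) z \<le> (1 + \<epsilon>) * ?e f z + (1 + 1 / \<epsilon>) * ?e (outer_part N f) z"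
          unfolding gabor_coefficient_inner_outer[OF f] by (rule norm_diff_square_weighted[OF e])
        then have "ennreal (?e (inner_part N f) z) \<le> ennreal ((1 + \<epsilon>) * ?e f z + (1 + 1 / \<epsilon>) * ?e (outer_part N f) z)"
          by (rule ennreal_leI)
        also have "\<dots> = ennreal (1 + \<epsilon>) * ennreal (?e f z) + ennreal (1 + 1 / \<epsilon>) * ennreal (?e (outer_part N f) z)"
        proof -
          have "ennreal (c * u + d * v) = ennreal c * ennreal u + ennreal d * ennreal v"
            if "0 \<le> c" "0 \<le> d" "0 \<le> u" "0 \<le> v" for c d u v :: real
            using that by (simp add: ennreal_mult)
          then show ?thesis using e by simp
        qed
        finally show "ennreal (?e (inner_part N f) z) \<le> ennreal (1 + \<epsilon>) * ennreal (?e f z) + ennreal (1 + 1 / \<epsilon>) * ennreal (?e (outer_part N f) z)" .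
      qed
      also have "\<dots> = ennreal (1 + \<epsilon>) * ?FS f + ennreal (1 + 1 / \<epsilon>) * ?FS (outer_part N f)"
        unfolding frame_sum_eq_pairs by (subst nn_integral_add) (auto simp: nn_integral_cmult)
      also have "\<dots> \<le> ennreal (1 + \<epsilon>) * ennreal r + ennreal (1 + 1 / \<epsilon>) * (ennreal upper_value * ennreal ((L2_norm (outer_part N f))\<^sup>2))"
        unfolding r(1) by (intro add_left_mono mult_left_mono frame_sum_le outer_part_L2 f) simp
      also have "\<dots> = ennreal ((1 + \<epsilon>) * r + (1 + 1 / \<epsilon>) * (upper_value * (L2_norm (outer_part N f))\<^sup>2))"
        using e r(2) upper_value_nonneg by (subst ennreal_plus) (auto simp: ennreal_mult)
      finally show "K * (L2_norm (inner_part N f))\<^sup>2 \<le> (1 + \<epsilon>) * r + (1 + 1 / \<epsilon>) * (upper_value * (L2_norm (outer_part N f))\<^sup>2)"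
        using e r(2) upper_value_nonneg by (subst (asm) ennreal_le_iff) auto
    qed
  qed
  have "K * (L2_norm f)\<^sup>2 \<le> r"
  proof (rule LIMSEQ_le_const)
    have "(\<lambda>m. (1 + inverse (real (Suc m))) * r) \<longlonglongrightarrow> (1 + 0) * r"
      by (intro tendsto_intros LIMSEQ_inverse_real_of_nat)
    then show "(\<lambda>m. (1 + inverse (real (Suc m))) * r) \<longlonglongrightarrow> r" by simp
    show "\<exists>N. \<forall>m\<ge>N. K * (L2_norm f)\<^sup>2 \<le> (1 + inverse (real (Suc m))) * r"
      by (intro exI[of _ 0] allI impI main) simp
  qed
  then have "ennreal (K * (L2_norm f)\<^sup>2) \<le> ennreal r" by (rule ennreal_leI)
  then show ?thesis unfolding r(1) using K(2) by (simp add: ennreal_mult)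
qed

end

section \<open>Sharpness of the bounds\<close>

lemma cesaro_mean:
  fixes f :: "nat \<Rightarrow> real"
  assumes "f \<longlonglongrightarrow> S"
  shows "(\<lambda>L. (\<Sum>i<L. f i) / real L) \<longlonglongrightarrow> S"
proof (rule LIMSEQ_I)
  fix r :: real assume r: "r > 0"
  then obtain N where N: "\<And>i. i \<ge> N \<Longrightarrow> norm (f i - S) < r / 2"
    using LIMSEQ_D[OF assms, of "r / 2"] by auto
  define C where "C = (\<Sum>i<N. norm (f i - S))"
  have C: "C \<ge> 0" unfolding C_def by (intro sum_nonneg) auto
  obtain M :: nat where M: "2 * C / r < real M" using reals_Archimedean2 by blast
  show "\<exists>no. \<forall>L\<ge>no. norm ((\<Sum>i<L. f i) / real L - S) < r"
  proof (intro exI[of _ "Suc (max N M)"] allI impI)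
    fix L assume L: "Suc (max N M) \<le> L"
    then have L0: "real L > 0" and NL: "N \<le> L" and ge_M: "real M \<le> real L" by auto
    have bnd: "(\<Sum>i<L. norm (f i - S)) \<le> C + real L * (r / 2)"
    proof -
      have "(\<Sum>i<L. norm (f i - S)) = C + (\<Sum>i\<in>{N..<L}. norm (f i - S))"
        proof -
        have "{..<L} = {..<N} \<union> {N..<L}" "{..<N} \<inter> {N..<L} = {}" using NL by auto
        then show ?thesis unfolding C_def by (simp only: sum.union_disjoint finite_lessThan finite_atLeastLessThan)
      qed
      also have "(\<Sum>i\<in>{N..<L}. norm (f i - S)) \<le> (\<Sum>i\<in>{N..<L}. r / 2)"
        by (rule sum_mono, rule less_imp_le, rule N) simp
      also have "\<dots> \<le> real L * (r / 2)" using r NL by simp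
      finally show ?thesis by simp
    qed
    have "(\<Sum>i<L. f i) / real L - S = (\<Sum>i<L. f i - S) / real L"
      using L0 by (simp add: sum_subtractf field_simps)
    also have "norm \<dots> \<le> (\<Sum>i<L. norm (f i - S)) / real L"
      using L0 by (simp add: divide_right_mono sum_abs)
    also have "\<dots> \<le> (C + real L * (r / 2)) / real L"
      using bnd L0 by (intro divide_right_mono) auto
    also have "\<dots> < r"
    proof -
      have "2 * C / r < real L" using M ge_M by linarith
      then have "2 * C < r * real L" using r by (simp add: divide_less_eq mult.commute)
      then show ?thesis using L0 by (simp add: field_simps)
    qed
    finally show "norm ((\<Sum>i<L. f i) / real L - S) < r" .
  qed
qed

text \<open>
  Passing from \<open>L\<close> to \<open>L + 1\<close> adds one row and one column to the Toeplitz sum, that is, a symmetric partial sum of the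
  series. The quotient is therefore a Cesaro mean of these partial sums.
\<close>

lemma toeplitz_mean_tendsto:
  fixes h :: "int \<Rightarrow> real"
  assumes "(h has_sum S) UNIV"
  shows "(\<lambda>L. (\<Sum>i<L. \<Sum>j<L. h (int i - int j)) / real L) \<longlonglongrightarrow> S"
proof -
  define A where "A = (\<lambda>N. \<Sum>k\<in>{- int N..int N}. h k)"
  have "(\<Sum>i<L. \<Sum>j<L. h (int i - int j)) = (\<Sum>N<L. A N)" for L
  proof (induction L)
    case (Suc L)
    have A: "A L = (\<Sum>i<L. h (int i - int L)) + (\<Sum>j<L. h (int L - int j)) + h 0"
    proof -
      have 1: "(\<Sum>i<L. h (int i - int L)) = (\<Sum>k\<in>{- int L..<0}. h k)"
        by (rule sum.reindex_bij_witness[of _ "\<lambda>k. nat (k + int L)" "\<lambda>i. int i - int L"]) auto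
      have 2: "(\<Sum>j<L. h (int L - int j)) = (\<Sum>k\<in>{1..int L}. h k)"
        by (rule sum.reindex_bij_witness[of _ "\<lambda>k. nat (int L - k)" "\<lambda>j. int L - int j"]) auto
      have "{- int L..int L} = insert 0 ({- int L..<0} \<union> {1..int L})" by auto
      then have "A L = h 0 + ((\<Sum>k\<in>{- int L..<0}. h k) + (\<Sum>k\<in>{1..int L}. h k))"
        unfolding A_def by (subst sum.union_disjoint[symmetric]) auto
      then show ?thesis unfolding 1 2 by simp
    qed
    have "(\<Sum>i<Suc L. \<Sum>j<Suc L. h (int i - int j)) = (\<Sum>i<L. \<Sum>j<L. h (int i - int j)) + A L"
      unfolding A by (simp add: sum.distrib)
    then show ?case using Suc.IH by simp
  qed simp
  then show ?thesis
    using cesaro_mean[OF has_sum_int_imp_symmetric_limit[OF assms]] by (simp add: A_def)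
qed

context sech_lattice
begin

text \<open>
  The Toeplitz form of the sequence \<open>fourier_mode j \<xi>\<close>, \<open>j < L\<close>, per unit of its squared norm.
\<close>

definition toeplitz_mean :: "nat \<Rightarrow> real \<Rightarrow> real" where
  "toeplitz_mean L \<xi> =
    (\<Sum>i<L. \<Sum>j<L. xsinh (of_int (int i - int j) * (pi * p)) * cos (2 * pi * of_int (int i - int j) * \<xi>)) / real L"

context
  fixes L :: nat and \<xi> s0 \<delta> :: real
  assumes L: "L \<ge> 1" and s0: "0 \<le> s0" and \<delta>: "\<delta> > 0" "s0 + \<delta> < 1"
begin

text \<open>
  A test function concentrated near the spectral point \<open>(n s0, \<xi>)\<close>: short pulses at \<open>p(s0 + j)\<close> whose phases
  advance by \<open>2\<pi>\<xi>\<close>.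
\<close>

definition comb :: "real \<Rightarrow> complex" where
  "comb t = (\<Sum>j\<in>{0..<int L}. indicator {s0..s0 + \<delta>} (t / p - of_int j) *\<^sub>R fourier_mode j \<xi>)"

lemma measurable_comb [measurable]: "comb \<in> borel_measurable borel"
  unfolding comb_def[abs_def] by measurable

lemma comb_supported: "supported_in comb {0..<int L}"
  unfolding supported_in_def
proof (intro conjI allI impI)
  fix t assume t: "\<lfloor>t / p\<rfloor> \<notin> {0..<int L}"
  have "t / p - of_int j \<notin> {s0..s0 + \<delta>}" if "j \<in> {0..<int L}" for j
  proof
    assume "t / p - of_int j \<in> {s0..s0 + \<delta>}"
    then have "\<lfloor>t / p\<rfloor> = j" using s0 \<delta> by (intro floor_unique) auto
    then show False using t that by simp
  qed
  then show "comb t = 0" unfolding comb_def by (intro sum.neutral) auto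
qed simp

lemma comb_L2: "comb \<in> L2"
proof -
  have "integrable lborel (\<lambda>t. (norm (comb t))\<^sup>2)"
  proof (rule Bochner_Integration.integrable_bound)
    show "integrable lborel (\<lambda>t. indicator {0..p * (real L + 1)} t *\<^sub>R (real L)\<^sup>2)"
      by (intro integrable_real_indicator integrable_scaleR_left impI) (auto simp: emeasure_lborel_Icc_eq)
    show "AE t in lborel. norm ((norm (comb t))\<^sup>2) \<le> norm (indicator {0..p * (real L + 1)} t *\<^sub>R (real L)\<^sup>2)"
    proof (rule AE_I2)
      fix t
      have "norm (comb t) \<le> (\<Sum>j\<in>{0..<int L}. 1)"
        unfolding comb_def by (rule order_trans[OF norm_sum]) (intro sum_mono, simp split: split_indicator)
      then have b: "(norm (comb t))\<^sup>2 \<le> (real L)\<^sup>2" by (intro power_mono) auto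
      have z: "comb t = 0" if "t \<notin> {0..p * (real L + 1)}"
      proof -
        have "\<lfloor>t / p\<rfloor> \<notin> {0..<int L}"
        proof
          assume "\<lfloor>t / p\<rfloor> \<in> {0..<int L}"
          then have "0 \<le> t / p" "t / p \<le> real L + 1" by (simp_all, linarith+)
          then have "0 \<le> t" "t \<le> p * (real L + 1)" using p_pos by (simp_all add: zero_le_divide_iff divide_le_eq mult.commute)
          then show False using that by simp
        qed
        then show ?thesis using comb_supported by (simp add: supported_in_def)
      qed
      show "norm ((norm (comb t))\<^sup>2) \<le> norm (indicator {0..p * (real L + 1)} t *\<^sub>R (real L)\<^sup>2)"
        using b z by (cases "t \<in> {0..p * (real L + 1)}") auto
    qed
  qed simp
  then show ?thesis by (simp add: L2_def)
qed

lemma fibre_comb: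
  assumes s: "s \<in> {0..<1}" and i: "i \<in> {0..<int L}"
  shows "fibre comb s i = indicator {s0..s0 + \<delta>} s *\<^sub>R fourier_mode i \<xi>"
proof -
  have arg: "p * (s + of_int i) / p - of_int j = s + of_int (i - j)" for j using p_pos by simp
  have "fibre comb s i = (\<Sum>j\<in>{0..<int L}. if j = i then indicator {s0..s0 + \<delta>} s *\<^sub>R fourier_mode i \<xi> else 0)"
    unfolding fibre_def comb_def arg
  proof (intro sum.cong refl)
    fix j
    show "indicator {s0..s0 + \<delta>} (s + of_int (i - j)) *\<^sub>R fourier_mode j \<xi>
       = (if j = i then indicator {s0..s0 + \<delta>} s *\<^sub>R fourier_mode i \<xi> else 0)"
    proof (cases "j = i")
      case False
      then have "i - j \<ge> 1 \<or> i - j \<le> -1" by linarith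
      then have "real_of_int (i - j) \<ge> 1 \<or> real_of_int (i - j) \<le> -1" by linarith
      then have "s + of_int (i - j) \<notin> {s0..s0 + \<delta>}" using s s0 \<delta> by auto
      then show ?thesis using False by simp
    qed simp
  qed
  then show ?thesis using i by simp
qed

lemma fibre_form_comb:
  assumes s: "s \<in> {0..<1}"
  shows "fibre_form s {0..<int L} (fibre comb s) = indicator {s0..s0 + \<delta>} s *
     (real n * real L * (time_symbol (real n * s) - 1 + toeplitz_mean L \<xi>))"
proof (cases "s \<in> {s0..s0 + \<delta>}")
  case True
  let ?J = "{0..<int L}"
  have f: "fibre comb s i = fourier_mode i \<xi>" if "i \<in> ?J" for i using fibre_comb[OF s that] True by simp
  have "(\<Sum>j\<in>?J. (norm (fibre comb s j))\<^sup>2) = (\<Sum>j\<in>?J. 1)" by (intro sum.cong refl) (simp add: f)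
  then have N: "(\<Sum>j\<in>?J. (norm (fibre comb s j))\<^sup>2) = real L" by simp
  have "Re (toeplitz_form ?J (fibre comb s)) = (\<Sum>i\<in>?J. \<Sum>j\<in>?J. xsinh (of_int (i - j) * (pi * p)) * cos (2 * pi * of_int (i - j) * \<xi>))"
    unfolding toeplitz_form_def Re_sum
  proof (intro sum.cong refl)
    fix i j assume ij: "i \<in> ?J" "j \<in> ?J"
    have "fibre comb s i * cnj (fibre comb s j) = fourier_mode (i - j) \<xi>"
      unfolding f[OF ij(1)] f[OF ij(2)] cnj_fourier_mode fourier_mode_mult by simp
    then show "Re (fibre comb s i * cnj (fibre comb s j) * of_real (xsinh (pi * p * of_int (i - j))))
      = xsinh (of_int (i - j) * (pi * p)) * cos (2 * pi * of_int (i - j) * \<xi>)"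
      by (simp add: fourier_mode_def mult_ac)
  qed
  also have "\<dots> = (\<Sum>i<L. \<Sum>j<L. xsinh (of_int (int i - int j) * (pi * p)) * cos (2 * pi * of_int (int i - int j) * \<xi>))"
  proof -
    have r: "(\<Sum>i\<in>?J. g i) = (\<Sum>i<L. g (int i))" for g :: "int \<Rightarrow> real"
      by (rule sum.reindex_bij_witness[of _ int nat]) auto
    show ?thesis unfolding r ..
  qed
  also have "\<dots> = real L * toeplitz_mean L \<xi>" using L by (simp add: toeplitz_mean_def)
  finally show ?thesis using True by (simp add: fibre_form_def N algebra_simps)
next
  case False
  have "fibre comb s i = 0" if "i \<in> {0..<int L}" for i using fibre_comb[OF s that] False by simp
  then show ?thesis using False by (simp add: fibre_form_def toeplitz_form_def)
qed

lemma nn_integral_torus_interval: "(\<integral>\<^sup>+s. ennreal (indicator {s0..s0 + \<delta>} s * c) \<partial>torus) = ennreal (c * \<delta>)"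
proof -
  have "(\<integral>\<^sup>+s. ennreal (indicator {s0..s0 + \<delta>} s * c) \<partial>torus) = (\<integral>\<^sup>+s. ennreal c * indicator {s0..s0 + \<delta>} s \<partial>torus)"
    by (intro nn_integral_cong) (auto split: split_indicator)
  also have "\<dots> = ennreal c * emeasure torus {s0..s0 + \<delta>}" by (rule nn_integral_cmult_indicator) simp
  also have "emeasure torus {s0..s0 + \<delta>} = emeasure lborel {s0..s0 + \<delta>}"
  proof -
    have "emeasure torus {s0..s0 + \<delta>} = (\<integral>\<^sup>+s. indicator {0..<1} s * indicator {s0..s0 + \<delta>} s \<partial>lborel)"
      unfolding torus_def by (rule emeasure_density) auto
    also have "\<dots> = (\<integral>\<^sup>+s. indicator {s0..s0 + \<delta>} s \<partial>lborel)"
      using s0 \<delta> by (intro nn_integral_cong) (auto split: split_indicator)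
    finally show ?thesis by simp
  qed
  finally show ?thesis using \<delta> by (simp add: ennreal_mult'')
qed

lemma L2_norm_comb: "ennreal ((L2_norm comb)\<^sup>2) = ennreal (p * \<delta> * real L)"
proof -
  have "(\<integral>\<^sup>+s. ennreal (\<Sum>j\<in>{0..<int L}. (norm (fibre comb s j))\<^sup>2) \<partial>torus) = (\<integral>\<^sup>+s. ennreal (indicator {s0..s0 + \<delta>} s * real L) \<partial>torus)"
  proof (intro nn_integral_cong_AE eventually_mono[OF AE_torus])
    fix s :: real assume s: "s \<in> {0..<1}"
    have "(\<Sum>j\<in>{0..<int L}. (norm (fibre comb s j))\<^sup>2) = (\<Sum>j\<in>{0..<int L}. indicator {s0..s0 + \<delta>} s)"
      by (intro sum.cong refl) (simp add: fibre_comb[OF s] split: split_indicator)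
    then show "ennreal (\<Sum>j\<in>{0..<int L}. (norm (fibre comb s j))\<^sup>2) = ennreal (indicator {s0..s0 + \<delta>} s * real L)"
      by (simp add: mult.commute)
  qed
  then show ?thesis unfolding L2_norm_fibre[OF comb_L2 comb_supported] nn_integral_torus_interval
    using p_pos \<delta> by (simp add: ennreal_mult[symmetric] mult_ac)
qed

lemma frame_sum_comb_bounds:
  assumes W: "\<And>s. s \<in> {s0..s0 + \<delta>} \<Longrightarrow> W1 \<le> time_symbol (real n * s) \<and> time_symbol (real n * s) \<le> W2"
  shows "ennreal (real n * (W1 - 1 + toeplitz_mean L \<xi>)) * ennreal ((L2_norm comb)\<^sup>2) \<le> gabor_sum comb"
    and "gabor_sum comb \<le> ennreal (real n * (W2 - 1 + toeplitz_mean L \<xi>)) * ennreal ((L2_norm comb)\<^sup>2)"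
proof -
  let ?S = "\<lambda>s. time_symbol (real n * s)"
  have val: "ennreal (real n * (w - 1 + toeplitz_mean L \<xi>)) * ennreal ((L2_norm comb)\<^sup>2)
     = ennreal p * (\<integral>\<^sup>+s. ennreal (indicator {s0..s0 + \<delta>} s * (real n * real L * (w - 1 + toeplitz_mean L \<xi>))) \<partial>torus)" for w
  proof -
    have "ennreal (real n * (w - 1 + toeplitz_mean L \<xi>)) * ennreal (p * \<delta> * real L) = ennreal (real n * (w - 1 + toeplitz_mean L \<xi>) * (p * \<delta> * real L))"
      using p_pos \<delta> by (simp add: ennreal_mult'')
    also have "real n * (w - 1 + toeplitz_mean L \<xi>) * (p * \<delta> * real L) = p * (real n * real L * (w - 1 + toeplitz_mean L \<xi>) * \<delta>)"
      by (simp only: mult_ac)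
    also have "ennreal \<dots> = ennreal p * ennreal (real n * real L * (w - 1 + toeplitz_mean L \<xi>) * \<delta>)"
      using p_pos by (simp add: ennreal_mult')
    finally show ?thesis unfolding L2_norm_comb nn_integral_torus_interval .
  qed
  have fs: "gabor_sum comb
     = ennreal p * (\<integral>\<^sup>+s. ennreal (indicator {s0..s0 + \<delta>} s * (real n * real L * (?S s - 1 + toeplitz_mean L \<xi>))) \<partial>torus)"
    unfolding frame_sum_fibre[OF comb_L2 comb_supported]
    by (intro arg_cong[where f = "(*) (ennreal p)"] nn_integral_cong_AE eventually_mono[OF AE_torus]) (simp only: fibre_form_comb)
  have mono: "ennreal (indicator {s0..s0 + \<delta>} s * (real n * real L * (u - 1 + toeplitz_mean L \<xi>)))
     \<le> ennreal (indicator {s0..s0 + \<delta>} s * (real n * real L * (v - 1 + toeplitz_mean L \<xi>)))" if "s \<in> {s0..s0 + \<delta>} \<Longrightarrow> u \<le> v" for s u v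
    using that by (cases "s \<in> {s0..s0 + \<delta>}") (auto intro!: ennreal_leI mult_left_mono)
  show "ennreal (real n * (W1 - 1 + toeplitz_mean L \<xi>)) * ennreal ((L2_norm comb)\<^sup>2) \<le> gabor_sum comb"
    unfolding val fs by (intro mult_left_mono nn_integral_mono mono) (use W in auto)
  show "gabor_sum comb \<le> ennreal (real n * (W2 - 1 + toeplitz_mean L \<xi>)) * ennreal ((L2_norm comb)\<^sup>2)"
    unfolding val fs by (intro mult_left_mono nn_integral_mono mono) (use W in auto)
qed

lemma comb_bounds:
  assumes W: "\<And>s. s \<in> {s0..s0 + \<delta>} \<Longrightarrow> W1 \<le> time_symbol (real n * s) \<and> time_symbol (real n * s) \<le> W2"
  shows "is_upper_frame_bound sech_window (rect_lattice a b) B \<Longrightarrow> ennreal (real n * (W1 - 1 + toeplitz_mean L \<xi>)) \<le> B"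
    and "is_lower_frame_bound sech_window (rect_lattice a b) A \<Longrightarrow> A \<le> ennreal (real n * (W2 - 1 + toeplitz_mean L \<xi>))"
proof -
  have "p * \<delta> * real L > 0" using p_pos \<delta> L by simp
  then have N: "ennreal ((L2_norm comb)\<^sup>2) \<noteq> 0" "ennreal ((L2_norm comb)\<^sup>2) \<noteq> top"
    unfolding L2_norm_comb by (simp_all add: ennreal_eq_0_iff)
  have cancel: "x \<le> y" if "x * ennreal ((L2_norm comb)\<^sup>2) \<le> y * ennreal ((L2_norm comb)\<^sup>2)" for x y
    using that ennreal_mult_le_mult_iff[OF N, of x y] by (simp only: mult.commute)
  show "ennreal (real n * (W1 - 1 + toeplitz_mean L \<xi>)) \<le> B" if "is_upper_frame_bound sech_window (rect_lattice a b) B"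
    by (rule cancel[OF order_trans[OF frame_sum_comb_bounds(1)[OF W]
          that[unfolded is_upper_frame_bound_def, rule_format, OF comb_L2]]])
  show "A \<le> ennreal (real n * (W2 - 1 + toeplitz_mean L \<xi>))" if "is_lower_frame_bound sech_window (rect_lattice a b) A"
    by (rule cancel[OF order_trans[OF that[unfolded is_lower_frame_bound_def, rule_format, OF comb_L2]
          frame_sum_comb_bounds(2)[OF W]]])
qed

end

text \<open>
  Letting the number of pulses grow and their width shrink shows that every value of
  \<open>n (\<sigma>\<^sub>y(\<theta>) + \<sigma>\<^sub>x(\<xi>) - 1)\<close>, with \<open>x = \<pi> n a\<close> and \<open>y = \<pi> n b\<close>, lies between the frame bounds.
\<close>

lemma spectrum_between_bounds:
  assumes \<theta>: "0 \<le> \<theta>" "\<theta> < real n"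
  shows "is_upper_frame_bound sech_window (rect_lattice a b) B \<Longrightarrow>
      ennreal (real n * (time_symbol \<theta> + freq_symbol \<xi> - 1)) \<le> B"
    and "is_lower_frame_bound sech_window (rect_lattice a b) A \<Longrightarrow>
      A \<le> ennreal (real n * (time_symbol \<theta> + freq_symbol \<xi> - 1))"
proof -
  let ?S = "time_symbol"
  have n0: "real n > 0" using n by simp
  define s0 where "s0 = \<theta> / real n"
  have s0: "0 \<le> s0" "s0 < 1" and ns0: "real n * s0 = \<theta>" using \<theta> n0 by (auto simp: s0_def)
  have step: "\<exists>\<delta>>0. s0 + \<delta> < 1 \<and> (\<forall>s\<in>{s0..s0 + \<delta>}. ?S \<theta> - \<epsilon> \<le> ?S (real n * s) \<and> ?S (real n * s) \<le> ?S \<theta> + \<epsilon>)" if e: "\<epsilon> > 0" for \<epsilon>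
  proof -
    have "continuous_on UNIV (\<lambda>s. ?S (real n * s))"
      by (rule continuous_on_compose2[OF continuous_sech_symbol[OF xy_pos(2)]]) (auto intro!: continuous_intros)
    then have "isCont (\<lambda>s. ?S (real n * s)) s0" by (simp add: continuous_on_eq_continuous_at)
    then obtain d where d: "d > 0" "\<And>s. \<bar>s - s0\<bar> < d \<Longrightarrow> \<bar>?S (real n * s) - ?S (real n * s0)\<bar> < \<epsilon>"
      using e unfolding continuous_at_eps_delta dist_real_def by blast
    define \<delta> where "\<delta> = min (d / 2) ((1 - s0) / 2)"
    have "\<delta> > 0" "s0 + \<delta> < 1" "\<delta> < d" using d(1) s0 by (auto simp: \<delta>_def min_def field_simps)
    moreover have "?S \<theta> - \<epsilon> \<le> ?S (real n * s) \<and> ?S (real n * s) \<le> ?S \<theta> + \<epsilon>" if "s \<in> {s0..s0 + \<delta>}" for s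
      using d(2)[of s] that \<open>\<delta> < d\<close> unfolding ns0 by fastforce
    ultimately show ?thesis by blast
  qed
  define m where "m = (\<lambda>L. toeplitz_mean (Suc L) \<xi>)"
  have m: "m \<longlonglongrightarrow> freq_symbol \<xi>"
    using LIMSEQ_Suc[OF toeplitz_mean_tendsto[OF sech_symbol_has_sum[OF xy_pos(1), of \<xi>]]]
    by (simp only: m_def toeplitz_mean_def)
  define \<epsilon> where "\<epsilon> = (\<lambda>L. inverse (real (Suc L)))"
  have \<epsilon>: "\<epsilon> \<longlonglongrightarrow> 0" unfolding \<epsilon>_def by (rule LIMSEQ_inverse_real_of_nat)
  have \<epsilon>_pos: "\<epsilon> L > 0" for L by (simp add: \<epsilon>_def)
  have lim: "(\<lambda>L. ennreal (real n * (?S \<theta> + \<sigma> * \<epsilon> L - 1 + m L))) \<longlonglongrightarrow> ennreal (real n * (?S \<theta> + freq_symbol \<xi> - 1))" for \<sigma>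
  proof (rule tendsto_ennrealI)
    have "(\<lambda>L. real n * (?S \<theta> + \<sigma> * \<epsilon> L - 1 + m L)) \<longlonglongrightarrow> real n * (?S \<theta> + \<sigma> * 0 - 1 + freq_symbol \<xi>)"
      by (intro tendsto_intros \<epsilon> m)
    moreover have "real n * (?S \<theta> + \<sigma> * 0 - 1 + freq_symbol \<xi>) = real n * (?S \<theta> + freq_symbol \<xi> - 1)" by simp
    ultimately show "(\<lambda>L. real n * (?S \<theta> + \<sigma> * \<epsilon> L - 1 + m L)) \<longlonglongrightarrow> real n * (?S \<theta> + freq_symbol \<xi> - 1)"
      by (simp only:)
  qed
  show "ennreal (real n * (?S \<theta> + freq_symbol \<xi> - 1)) \<le> B" if B: "is_upper_frame_bound sech_window (rect_lattice a b) B"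
  proof (rule LIMSEQ_le_const2[OF lim[of "-1"]], intro exI[of _ 0] allI impI)
    fix L
    obtain \<delta> where \<delta>: "\<delta> > 0" "s0 + \<delta> < 1" "\<And>s. s \<in> {s0..s0 + \<delta>} \<Longrightarrow> ?S \<theta> - \<epsilon> L \<le> ?S (real n * s) \<and> ?S (real n * s) \<le> ?S \<theta> + \<epsilon> L"
      using step[OF \<epsilon>_pos[of L]] by blast
    show "ennreal (real n * (?S \<theta> + (-1) * \<epsilon> L - 1 + m L)) \<le> B"
      using comb_bounds(1)[of "Suc L" s0 \<delta>, OF _ s0(1) \<delta> B, of \<xi>] by (simp add: m_def)
  qed
  show "A \<le> ennreal (real n * (?S \<theta> + freq_symbol \<xi> - 1))" if A: "is_lower_frame_bound sech_window (rect_lattice a b) A"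
  proof (rule LIMSEQ_le_const[OF lim[of "1"]], intro exI[of _ 0] allI impI)
    fix L
    obtain \<delta> where \<delta>: "\<delta> > 0" "s0 + \<delta> < 1" "\<And>s. s \<in> {s0..s0 + \<delta>} \<Longrightarrow> ?S \<theta> - \<epsilon> L \<le> ?S (real n * s) \<and> ?S (real n * s) \<le> ?S \<theta> + \<epsilon> L"
      using step[OF \<epsilon>_pos[of L]] by blast
    show "A \<le> ennreal (real n * (?S \<theta> + 1 * \<epsilon> L - 1 + m L))"
      using comb_bounds(2)[of "Suc L" s0 \<delta>, OF _ s0(1) \<delta> A, of \<xi>] by (simp add: m_def)
  qed
qed

theorem sharp_upper_frame_bound_eq:
  "sharp_upper_frame_bound sech_window (rect_lattice a b) = ennreal upper_value"
  unfolding sharp_upper_frame_bound_def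
proof (rule antisym)
  have "is_upper_frame_bound sech_window (rect_lattice a b) (ennreal upper_value)"
    unfolding is_upper_frame_bound_def using frame_sum_le by blast
  then show "Inf {B. is_upper_frame_bound sech_window (rect_lattice a b) B} \<le> ennreal upper_value" by (intro Inf_lower) simp
  show "ennreal upper_value \<le> Inf {B. is_upper_frame_bound sech_window (rect_lattice a b) B}"
    unfolding upper_value_def using n by (intro Inf_greatest spectrum_between_bounds(1)) auto
qed

definition lower_value :: real where
  "lower_value = real n * (time_symbol (1/2) + freq_symbol (1/2) - 1)"

text \<open>
  An inequality suffices for a general lattice; the value is attained at the
  square lattice, by the theorem that follows.
\<close>

theorem sharp_lower_frame_bound_le:
  "sharp_lower_frame_bound sech_window (rect_lattice a b) \<le> ennreal lower_value"
  unfolding sharp_lower_frame_bound_def lower_value_def using n by (intro Sup_least spectrum_between_bounds(2)) auto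

theorem sharp_lower_frame_bound_ge:
  assumes "pi * (real n * b) \<ge> 33/10" "pi * p \<ge> 33/10" "lower_value \<ge> 0"
  shows "ennreal lower_value \<le> sharp_lower_frame_bound sech_window (rect_lattice a b)"
  unfolding sharp_lower_frame_bound_def
proof (rule Sup_upper, rule CollectI, unfold is_lower_frame_bound_def, rule ballI)
  fix f assume "f \<in> L2"
  then show "ennreal lower_value * ennreal ((L2_norm f)\<^sup>2) \<le> gabor_sum f"
    by (rule frame_sum_ge[OF _ sech_symbol_ge_half[OF assms(1)] sech_symbol_ge_half[OF assms(2)] lower_value_def assms(3)])
qed

end

section \<open>Optimality of the square lattice\<close>

text \<open>
  \<open>cos\<close> is still positive at \<open>1556/1000\<close>. The bound is chosen so that \<open>\<pi> \<surd>2 \<ge> 44/10\<close>.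
\<close>

lemma pi_ge: "pi \<ge> 3112/1000"
proof (rule ccontr)
  assume "\<not> pi \<ge> 3112/1000"
  then have "pi / 2 \<le> 1556/1000" by simp
  define x :: real where "x = 1556/1000"
  have "cos x \<le> cos (pi / 2)" using \<open>pi / 2 \<le> _\<close> pi_gt3 by (intro cos_monotone_0_pi_le) (auto simp: x_def)
  then have neg: "cos x \<le> 0" by simp
  obtain t where t: "cos x = (\<Sum>m<8. cos_coeff m * x ^ m) + cos (t + 1/2 * real 8 * pi) / fact 8 * x ^ 8"
    using Maclaurin_cos_expansion2[of x 8] by (auto simp: x_def)
  have "\<bar>cos (t + 1/2 * real 8 * pi) / fact 8 * x ^ 8\<bar> \<le> 1 / fact 8 * x ^ 8"
    unfolding abs_mult by (intro mult_mono) (auto simp: x_def divide_right_mono)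
  moreover have "1 / fact 8 * x ^ 8 \<le> (1/1000 :: real)" by (simp add: x_def fact_numeral power_divide)
  moreover have "(\<Sum>m<8. cos_coeff m * x ^ m) \<ge> (1/100 :: real)"
    by (simp add: lessThan_nat_numeral lessThan_Suc cos_coeff_def fact_numeral x_def power_divide)
  ultimately show False using neg t by linarith
qed

lemma pi_sqrt_ge: 
  assumes "n \<ge> 2" shows "pi * sqrt (real n) \<ge> 44/10"
proof -
  have "(44/10)\<^sup>2 \<le> (3112/1000)\<^sup>2 * (2::real)" by (simp add: power_divide)
  also have "\<dots> \<le> pi\<^sup>2 * real n" using pi_ge assms by (intro mult_mono power_mono) auto
  also have "\<dots> = (pi * sqrt (real n))\<^sup>2" by (simp add: power_mult_distrib)
  finally show ?thesis by (rule power2_le_imp_le) simp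
qed

theorem theorem2p1:
  fixes n :: nat and a b :: real
  assumes "n \<ge> 2" and "a > 0" and "b > 0" and "1 / (a * b) = real n"
  shows "sharp_lower_frame_bound sech_window (rect_lattice (1 / sqrt n) (1 / sqrt n))
           \<ge> sharp_lower_frame_bound sech_window (rect_lattice a b)
       \<and> sharp_upper_frame_bound sech_window (rect_lattice (1 / sqrt n) (1 / sqrt n))
           \<le> sharp_upper_frame_bound sech_window (rect_lattice a b)
       \<and> (sharp_lower_frame_bound sech_window (rect_lattice (1 / sqrt n) (1 / sqrt n))
            = sharp_lower_frame_bound sech_window (rect_lattice a b)
          \<longleftrightarrow> a = 1 / sqrt n \<and> b = 1 / sqrt n)
       \<and> (sharp_upper_frame_bound sech_window (rect_lattice (1 / sqrt n) (1 / sqrt n))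
            = sharp_upper_frame_bound sech_window (rect_lattice a b)
          \<longleftrightarrow> a = 1 / sqrt n \<and> b = 1 / sqrt n)"
proof (cases "a = b")
  case True
  have n0: "real n > 0" using assms(1) by simp
  have "a\<^sup>2 = (1 / sqrt n)\<^sup>2" using assms(2,4) True n0 by (simp add: power2_eq_square field_simps)
  then have "a = 1 / sqrt n" using assms(2) n0 by (simp add: power2_eq_iff_nonneg)
  then show ?thesis using True by simp
next
  case False
  have n0: "real n > 0" using assms(1) by simp
  have nab: "real n * a * b = 1" using assms(2-4) by (simp add: field_simps)
  define r where "r = 1 / sqrt (real n)"
  have r: "r > 0" "real n * r * r = 1" "real n * r = sqrt (real n)"
    using n0 by (simp_all add: r_def real_div_sqrt)
  interpret L: sech_lattice n a b by unfold_locales (use assms nab in auto)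
  interpret C: sech_lattice n r r by unfold_locales (use assms r in auto)
  define c where "c = pi * sqrt (real n)"
  have c: "c \<ge> 44/10" unfolding c_def by (rule pi_sqrt_ge[OF assms(1)])
  have cC: "pi * (real n * r) = c" "pi * C.p = c" by (simp_all add: c_def r(3) C.p_def)
  define x y where "x = pi * (real n * a)" and "y = pi * (real n * b)"
  have pos: "x > 0" "y > 0" using assms n0 by (auto simp: x_def y_def)
  have xy: "x * y = c\<^sup>2"
  proof -
    have "x * y = pi\<^sup>2 * real n * (real n * a * b)" by (simp add: x_def y_def power2_eq_square)
    then show ?thesis unfolding nab by (simp add: c_def power_mult_distrib)
  qed
  have neq: "x \<noteq> y" using False n0 by (simp add: x_def y_def)
  have not_center: "\<not> (a = r \<and> b = r)" using False by auto
  have strict: "2 * sech_symbol c 0 < sech_symbol x 0 + sech_symbol y 0"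
     "sech_symbol x (1/2) + sech_symbol y (1/2) < 2 * sech_symbol c (1/2)"
    using sech_symbol_0_strict[OF pos(1) _ xy c] sech_symbol_0_strict[OF pos(2) _ _ c, of x]
      sech_symbol_half_strict[OF pos(1) _ xy c] sech_symbol_half_strict[OF pos(2) _ _ c, of x] neq xy
    by (cases "x < y"; force simp: mult.commute)+
  have "C.upper_value < L.upper_value"
    unfolding C.upper_value_def L.upper_value_def cC
    using strict(1) n0 by (intro mult_strict_left_mono) (auto simp: x_def y_def L.p_def)
  then have up: "sharp_upper_frame_bound sech_window (rect_lattice r r) < sharp_upper_frame_bound sech_window (rect_lattice a b)"
    unfolding C.sharp_upper_frame_bound_eq L.sharp_upper_frame_bound_eq
    using C.upper_value_nonneg by (simp add: ennreal_less_iff)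
  have Cpos: "C.lower_value > 0"
    unfolding C.lower_value_def cC using sech_symbol_half_ge[OF c] n0 by (intro mult_pos_pos) auto
  have "L.lower_value < C.lower_value"
    unfolding C.lower_value_def L.lower_value_def cC
    using strict(2) n0 by (intro mult_strict_left_mono) (auto simp: x_def y_def L.p_def)
  then have "ennreal L.lower_value < ennreal C.lower_value" using Cpos by (intro ennreal_lessI)
  moreover have "ennreal C.lower_value \<le> sharp_lower_frame_bound sech_window (rect_lattice r r)"
    by (rule C.sharp_lower_frame_bound_ge) (use c Cpos in \<open>auto simp: cC\<close>)
  ultimately have lo: "sharp_lower_frame_bound sech_window (rect_lattice a b) < sharp_lower_frame_bound sech_window (rect_lattice r r)"
    using L.sharp_lower_frame_bound_le by (metis order.strict_trans1 order.strict_trans2)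
  have ne: "sharp_lower_frame_bound sech_window (rect_lattice r r) \<noteq> sharp_lower_frame_bound sech_window (rect_lattice a b)"
    "sharp_upper_frame_bound sech_window (rect_lattice r r) \<noteq> sharp_upper_frame_bound sech_window (rect_lattice a b)"
    using lo up by (simp_all only: less_imp_neq less_imp_neq[THEN not_sym] not_False_eq_True)
  show ?thesis unfolding r_def[symmetric]
    using less_imp_le[OF lo] less_imp_le[OF up] ne not_center by blast
qed

end
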